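(* There is a countable union of real-algebraic hypersurfaces $\mathcal{H}\subset\mathbb{C}^4$ such that if $(A,B,C,D)\in\mathbb{C}^4\setminus\mathcal{H}$ then every fixed point of every element of $\mathcal{G}_{A,B,C,D}\setminus\{\mathrm{id}\}$ is in $\mathcal{J}_{A,B,C,D}$.
   Context: For $(A,B,C,D)\in\mathbb{C}^4$ let $S_{A,B,C,D}=\{(x,y,z)\in\mathbb{C}^3: x^2+y^2+z^2+xyz=Ax+By+Cz+D\}$. The involutions $s_x(x,y,z)=(-x-yz+A,\,y,\,z)$, $s_y(x,y,z)=(x,\,-y-xz+B,\,z)$, $s_z(x,y,z)=(x,\,y,\,-z-xy+C)$ preserve $S_{A,B,C,D}$. Let $\mathcal{G}_{A,B,C,D}=\langle g_x,g_y,g_z\rangle$ be the group of automorphisms of $S_{A,B,C,D}$ generated by $g_x=s_z\circ s_y$, $g_y=s_x\circ s_z$, $g_z=s_y\circ s_x$. Fixed points are fixed points in $S_{A,B,C,D}$. A sequence of maps $f_i$ converges to infinity on an open set $U\subset S_{A,B,C,D}$ if for every compact $\overline V\subset U$ and every compact $K\subset S_{A,B,C,D}$ only finitely many $i$ satisfy $f_i(\overline V)\cap K\neq\emptyset$. The group $\mathcal{G}_{A,B,C,D}$ forms a normal family on $U$ if every sequence of its elements has a subsequence that, on $U$, either converges uniformly on compact subsets or converges to infinity. The Fatou set $\mathcal{F}_{A,B,C,D}$ is the set of $p\in S_{A,B,C,D}$ having an open neighborhood on which $\mathcal{G}_{A,B,C,D}$ forms a normal family; the Julia set is $\mathcal{J}_{A,B,C,D}=S_{A,B,C,D}\setminus\mathcal{F}_{A,B,C,D}$.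 A real-algebraic hypersurface in $\mathbb{C}^4\cong\mathbb{R}^8$ is the zero set of a non-zero real polynomial. *)

theory Defs
  imports "HOL-Analysis.Analysis" "HOL-Algebra.Bij" "HOL-Algebra.Generated_Groups"
begin

type_synonym complex3 = "complex \<times> complex \<times> complex"
type_synonym complex4 = "complex \<times> complex \<times> complex \<times> complex"

definition cubic_surface :: "complex4 \<Rightarrow> complex3 set" where
  "cubic_surface = (\<lambda>(A, B, C, D).
     {(x, y, z). x\<^sup>2 + y\<^sup>2 + z\<^sup>2 + x * y * z = A * x + B * y + C * z + D})"

(* The involutions are polynomial maps of the ambient space; they are restricted to the
   surface only when the group is formed. *)

definition s_x :: "complex4 \<Rightarrow> complex3 \<Rightarrow> complex3" where
  "s_x = (\<lambda>(A, B, C, D) (x, y, z). (- x - y * z + A, y, z))"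

definition s_y :: "complex4 \<Rightarrow> complex3 \<Rightarrow> complex3" where
  "s_y = (\<lambda>(A, B, C, D) (x, y, z). (x, - y - x * z + B, z))"

definition s_z :: "complex4 \<Rightarrow> complex3 \<Rightarrow> complex3" where
  "s_z = (\<lambda>(A, B, C, D) (x, y, z). (x, y, - z - x * y + C))"

definition g_x :: "complex4 \<Rightarrow> complex3 \<Rightarrow> complex3" where
  "g_x P = s_z P \<circ> s_y P"

definition g_y :: "complex4 \<Rightarrow> complex3 \<Rightarrow> complex3" where
  "g_y P = s_x P \<circ> s_z P"

definition g_z :: "complex4 \<Rightarrow> complex3 \<Rightarrow> complex3" where
  "g_z P = s_y P \<circ> s_x P"

(* Elements are bijections of the surface, extended by undefined outside it, so equality of
   elements (in particular with the identity) is equality on the surface. *)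

definition surface_group :: "complex4 \<Rightarrow> (complex3 \<Rightarrow> complex3) set" where
  "surface_group P = generate (BijGroup (cubic_surface P))
     {restrict (g_x P) (cubic_surface P),
      restrict (g_y P) (cubic_surface P),
      restrict (g_z P) (cubic_surface P)}"

definition converges_to_infinity_on ::
    "'a::metric_space set \<Rightarrow> 'a set \<Rightarrow> (nat \<Rightarrow> 'a \<Rightarrow> 'a) \<Rightarrow> bool" where
  "converges_to_infinity_on S U f \<longleftrightarrow>
     (\<forall>V K. compact V \<and> V \<subseteq> U \<and> compact K \<and> K \<subseteq> S \<longrightarrow> finite {i. f i ` V \<inter> K \<noteq> {}})"

(* The limit map is not required to take values in the ambient set: this is automatic when that
   set is closed, as the surfaces above are. *)

definition converges_uniformly_on_compacts ::
    "'a::metric_space set \<Rightarrow> (nat \<Rightarrow> 'a \<Rightarrow> 'a) \<Rightarrow> bool" where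
  "converges_uniformly_on_compacts U f \<longleftrightarrow>
     (\<exists>h. \<forall>V. compact V \<and> V \<subseteq> U \<longrightarrow> uniform_limit V f h sequentially)"

definition normal_family_on ::
    "'a::metric_space set \<Rightarrow> 'a set \<Rightarrow> ('a \<Rightarrow> 'a) set \<Rightarrow> bool" where
  "normal_family_on S U G \<longleftrightarrow>
     (\<forall>f :: nat \<Rightarrow> 'a \<Rightarrow> 'a. range f \<subseteq> G \<longrightarrow>
        (\<exists>r. strict_mono r \<and>
           (converges_uniformly_on_compacts U (f \<circ> r) \<or>
            converges_to_infinity_on S U (f \<circ> r))))"

definition fatou_set :: "complex4 \<Rightarrow> complex3 set" where
  "fatou_set P = {p \<in> cubic_surface P.
     \<exists>U. openin (top_of_set (cubic_surface P)) U \<and> p \<in> U \<and>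
         normal_family_on (cubic_surface P) U (surface_group P)}"

definition julia_set :: "complex4 \<Rightarrow> complex3 set" where
  "julia_set P = cubic_surface P - fatou_set P"

(* On the real vector space complex4 (of dimension 8), real_polynomial_function describes exactly
   the real polynomials in the real and imaginary parts of the coordinates.  Since the reals are
   infinite, a polynomial is non-zero iff its polynomial function is not identically zero. *)

definition real_algebraic_hypersurface :: "complex4 set \<Rightarrow> bool" where
  "real_algebraic_hypersurface Z \<longleftrightarrow>
     (\<exists>p. real_polynomial_function p \<and> p \<noteq> (\<lambda>_. 0) \<and> Z = {P. p P = 0})"

lemma s_x_in_surface: "p \<in> cubic_surface P \<Longrightarrow> s_x P p \<in> cubic_surface P"
proof (cases P; cases p)
  fix A B C D x y z
  assume p: "p \<in> cubic_surface P" and eqs: "P = (A, B, C, D)" "p = (x, y, z)"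
  from p have "x\<^sup>2 + y\<^sup>2 + z\<^sup>2 + x * y * z = A * x + B * y + C * z + D"
    by (simp add: cubic_surface_def eqs)
  then have "(- x - y * z + A)\<^sup>2 + y\<^sup>2 + z\<^sup>2 + (- x - y * z + A) * y * z = A * (- x - y * z + A) + B * y + C * z + D"
    by algebra
  then show "s_x P p \<in> cubic_surface P"
    by (simp add: cubic_surface_def s_x_def eqs)
qed

lemma s_y_in_surface: "p \<in> cubic_surface P \<Longrightarrow> s_y P p \<in> cubic_surface P"
proof (cases P; cases p)
  fix A B C D x y z
  assume p: "p \<in> cubic_surface P" and eqs: "P = (A, B, C, D)" "p = (x, y, z)"
  from p have "x\<^sup>2 + y\<^sup>2 + z\<^sup>2 + x * y * z = A * x + B * y + C * z + D"
    by (simp add: cubic_surface_def eqs)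
  then have "x\<^sup>2 + (- y - x * z + B)\<^sup>2 + z\<^sup>2 + x * (- y - x * z + B) * z = A * x + B * (- y - x * z + B) + C * z + D"
    by algebra
  then show "s_y P p \<in> cubic_surface P"
    by (simp add: cubic_surface_def s_y_def eqs)
qed

lemma s_z_in_surface: "p \<in> cubic_surface P \<Longrightarrow> s_z P p \<in> cubic_surface P"
proof (cases P; cases p)
  fix A B C D x y z
  assume p: "p \<in> cubic_surface P" and eqs: "P = (A, B, C, D)" "p = (x, y, z)"
  from p have "x\<^sup>2 + y\<^sup>2 + z\<^sup>2 + x * y * z = A * x + B * y + C * z + D"
    by (simp add: cubic_surface_def eqs)
  then have "x\<^sup>2 + y\<^sup>2 + (- z - x * y + C)\<^sup>2 + x * y * (- z - x * y + C) = A * x + B * y + C * (- z - x * y + C) + D"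
    by algebra
  then show "s_z P p \<in> cubic_surface P"
    by (simp add: cubic_surface_def s_z_def eqs)
qed

lemma s_x_involution: "s_x P (s_x P p) = p"
  by (cases P; cases p) (simp add: s_x_def)

lemma s_y_involution: "s_y P (s_y P p) = p"
  by (cases P; cases p) (simp add: s_y_def)

lemma s_z_involution: "s_z P (s_z P p) = p"
  by (cases P; cases p) (simp add: s_z_def)

lemma bij_betw_involutions:
  "bij_betw (s_x P) (cubic_surface P) (cubic_surface P)"
  "bij_betw (s_y P) (cubic_surface P) (cubic_surface P)"
  "bij_betw (s_z P) (cubic_surface P) (cubic_surface P)"
proof -
  show "bij_betw (s_x P) (cubic_surface P) (cubic_surface P)"
    by (rule bij_betwI[where g = "s_x P"]) (auto simp only: Pi_iff s_x_in_surface s_x_involution)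
  show "bij_betw (s_y P) (cubic_surface P) (cubic_surface P)"
    by (rule bij_betwI[where g = "s_y P"]) (auto simp only: Pi_iff s_y_in_surface s_y_involution)
  show "bij_betw (s_z P) (cubic_surface P) (cubic_surface P)"
    by (rule bij_betwI[where g = "s_z P"]) (auto simp only: Pi_iff s_z_in_surface s_z_involution)
qed

(* generate does not itself require the generators to lie in the carrier. *)

lemma generators_in_carrier:
  "restrict (g_x P) (cubic_surface P) \<in> carrier (BijGroup (cubic_surface P))"
  "restrict (g_y P) (cubic_surface P) \<in> carrier (BijGroup (cubic_surface P))"
  "restrict (g_z P) (cubic_surface P) \<in> carrier (BijGroup (cubic_surface P))"
  by (simp_all add: BijGroup_def Bij_def g_x_def g_y_def g_z_def
        bij_betw_trans[OF bij_betw_involutions(2) bij_betw_involutions(3)]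
        bij_betw_trans[OF bij_betw_involutions(3) bij_betw_involutions(1)]
        bij_betw_trans[OF bij_betw_involutions(1) bij_betw_involutions(2)])

lemma surface_group_subgroup: "subgroup (surface_group P) (BijGroup (cubic_surface P))"
  unfolding surface_group_def
  by (rule group.generate_is_subgroup[OF group_BijGroup]) (simp add: generators_in_carrier)

end

theory Submission
  imports Defs "HOL-Complex_Analysis.Complex_Analysis"
begin

text \<open>
  Let \<open>P\<close> avoid the zero sets of all non-trivial polynomials with rational coefficients in
  \<open>(P, cnj P)\<close>.  Up to conjugation an element of the group is a cyclically reduced word in the
  three involutions.  If the word uses two letters only, it preserves a fibration by conics and acts
  affinely on the fibres; near any point there are fibres on which it is hyperbolic, so its powers
  are not normal near a fixed point.

  Otherwise let \<open>T\<close> be the trace of the derivative, on \<open>\<complex>\<^sup>3\<close>, at a fixed point \<open>p\<close>.  The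
  cubic form is invariant and the determinant is 1, so the eigenvalues are 1, \<open>\<kappa>\<close>, \<open>1 / \<kappa>\<close>; if
  \<open>p\<close> is in the Fatou set, Cauchy's estimate along a disc in the surface gives \<open>|\<kappa>| = 1\<close>, so
  \<open>T\<close> is real and in \<open>[-1, 3]\<close>.  A ping-pong argument with non-archimedean absolute values shows
  that \<open>p\<close>, hence \<open>T\<close>, is finite at every place of \<open>\<complex>\<close> where the parameters are finite.  As
  \<open>T = cnj T\<close> is also the trace for the conjugate parameters, take a place that is trivial on
  \<open>\<rat>(A, B, C, D)\<close> and specializes the conjugate parameters to the Cayley cubic \<open>(0, 0, 0, 4)\<close>.
  There the action is monomial and \<open>T\<close> specializes to an integer outside \<open>[-1, 3]\<close>.  Were \<open>T\<close>
  different from this integer \<open>n\<close>, it would be transcendental over \<open>\<rat>(A, B, C, D)\<close>, and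
  infinite at some place where \<open>A, B, C, D\<close> are finite.  So \<open>T = n\<close>, a contradiction.
\<close>

section \<open>Words in the involutions\<close>

text \<open>Beyond the bound on T, normality only says that T is real. Genericity makes A, B, C, D
  and their conjugates algebraically independent over the rationals, so T = \<open>cnj T\<close>
  allows the conjugate parameters to be specialized while everything built from A, B, C, D is kept.
  Fixed points are not explicit functions of the parameters and could escape along a path of
  parameters; a place specializes all complex numbers at once, and finiteness of p replaces control
  of the path. The Cayley cubic is the quotient of the torus of pairs (u, v) by inversion, and words
  act on the torus through integer matrices M. There T can only be 1 + tr M, 1 - tr M or, at the
  four singular points, (tr M)^2 - 1; since |tr M| >= 3, all of these lie outside [-1, 3], the range
  of 1 + 2 cos. A congruence modulo a maximal ideal carries no order, so by itself it does not
  exclude values in [-1, 3]; this is why a second place is used to turn it into an equality. Words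
  in two letters are treated apart because they can fix points that are infinite at a place
  (cusps).\<close>

datatype letter = Lx | Ly | Lz

lemma UNIV_letter: "(UNIV :: letter set) = {Lx, Ly, Lz}"
  using letter.exhaust by auto

instance letter :: finite
  by standard (simp add: UNIV_letter)

lemma all_letter: "(\<forall>l. P l) \<longleftrightarrow> P Lx \<and> P Ly \<and> P Lz"
  using letter.exhaust by metis

lemma letter_third: "\<exists>k. k \<noteq> i \<and> k \<noteq> (j :: letter)"
  by (cases i; cases j) (auto intro: exI[of _ Lx] exI[of _ Ly] exI[of _ Lz])

lemma letter_cases3: "i \<noteq> j \<Longrightarrow> j \<noteq> k \<Longrightarrow> i \<noteq> k \<Longrightarrow> l = i \<or> l = j \<or> l = (k :: letter)"
  by (cases i; cases j; cases k; cases l) auto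

fun nxt :: "letter \<Rightarrow> letter" where
  "nxt Lx = Ly" | "nxt Ly = Lz" | "nxt Lz = Lx"

definition vieta :: "(letter \<Rightarrow> 'a::comm_ring_1) \<Rightarrow> letter \<Rightarrow> (letter \<Rightarrow> 'a) \<Rightarrow> letter \<Rightarrow> 'a" where
  "vieta a l p = p(l := a l - p l - p (nxt l) * p (nxt (nxt l)))"

text \<open>The derivative is formal so that it can be reduced at a place;
  \<open>act_has_field_derivative\<close> identifies it with the analytic one.\<close>

definition dvieta :: "(letter \<Rightarrow> 'a::comm_ring_1) \<Rightarrow> letter \<Rightarrow> (letter \<Rightarrow> 'a) \<Rightarrow> letter \<Rightarrow> 'a" where
  "dvieta p l v = v(l := - v l - p (nxt l) * v (nxt (nxt l)) - p (nxt (nxt l)) * v (nxt l))"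

fun act :: "(letter \<Rightarrow> 'a::comm_ring_1) \<Rightarrow> letter list \<Rightarrow> (letter \<Rightarrow> 'a) \<Rightarrow> letter \<Rightarrow> 'a" where
  "act a [] p = p"
| "act a (l # w) p = vieta a l (act a w p)"

fun dact :: "(letter \<Rightarrow> 'a::comm_ring_1) \<Rightarrow> letter list \<Rightarrow> (letter \<Rightarrow> 'a) \<Rightarrow> (letter \<Rightarrow> 'a) \<Rightarrow> letter \<Rightarrow> 'a" where
  "dact a [] p v = v"
| "dact a (l # w) p v = dvieta (act a w p) l (dact a w p v)"

text \<open>D is left out: the surface is the level set of \<open>cubic a\<close> at D, the maps do
  not involve D, and finiteness of D at a place reads \<open>cubic a p \<in> R\<close>.\<close>

definition cubic :: "(letter \<Rightarrow> 'a::comm_ring_1) \<Rightarrow> (letter \<Rightarrow> 'a) \<Rightarrow> 'a" where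
  "cubic a p = (p Lx)\<^sup>2 + (p Ly)\<^sup>2 + (p Lz)\<^sup>2 + p Lx * p Ly * p Lz
     - a Lx * p Lx - a Ly * p Ly - a Lz * p Lz"

definition grad :: "(letter \<Rightarrow> 'a::comm_ring_1) \<Rightarrow> (letter \<Rightarrow> 'a) \<Rightarrow> letter \<Rightarrow> 'a" where
  "grad a p l = 2 * p l + p (nxt l) * p (nxt (nxt l)) - a l"

definition pair :: "(letter \<Rightarrow> 'a::comm_ring_1) \<Rightarrow> (letter \<Rightarrow> 'a) \<Rightarrow> 'a" where
  "pair g v = g Lx * v Lx + g Ly * v Ly + g Lz * v Lz"

definition single :: "letter \<Rightarrow> letter \<Rightarrow> 'a::comm_ring_1" where
  "single l = (\<lambda>m. if m = l then 1 else 0)"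

definition dtrace :: "(letter \<Rightarrow> 'a::comm_ring_1) \<Rightarrow> letter list \<Rightarrow> (letter \<Rightarrow> 'a) \<Rightarrow> 'a" where
  "dtrace a w p = dact a w p (single Lx) Lx + dact a w p (single Ly) Ly + dact a w p (single Lz) Lz"

text \<open>The cyclic order \<open>nxt\<close> serves only to write the definitions; as products
  commute, every ordering of the letters gives the same formulas. Later arguments order the letters
  by the size of the coordinates.\<close>

lemma vieta_eq:
  assumes "i \<noteq> j" "j \<noteq> k" "i \<noteq> k"
  shows "vieta a i p = p(i := a i - p i - p j * p k)"
  using assms by (cases i; cases j; cases k) (auto simp: vieta_def mult.commute)

lemma cubic_eq:
  assumes "i \<noteq> j" "j \<noteq> k" "i \<noteq> k"
  shows "cubic a p = (p i)\<^sup>2 + (p j)\<^sup>2 + (p k)\<^sup>2 + p i * p j * p k - a i * p i - a j * p j - a k * p k"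
  using assms by (cases i; cases j; cases k) (auto simp: cubic_def algebra_simps)

lemma grad_eq:
  assumes "i \<noteq> j" "j \<noteq> k" "i \<noteq> k"
  shows "grad a p i = 2 * p i + p j * p k - a i"
  using assms by (cases i; cases j; cases k) (auto simp: grad_def algebra_simps)

lemma pair_eq:
  assumes "i \<noteq> j" "j \<noteq> k" "i \<noteq> k"
  shows "pair g v = g i * v i + g j * v j + g k * v k"
  using assms by (cases i; cases j; cases k) (auto simp: pair_def algebra_simps)

lemma vieta_vieta: "vieta a l (vieta a l p) = p"
  by (cases l) (auto simp: vieta_def)

lemma act_append: "act a (u @ w) p = act a u (act a w p)"
  by (induction u) auto

lemma dact_append: "dact a (u @ w) p v = dact a u (act a w p) (dact a w p v)"
  by (induction u) (auto simp: act_append)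

lemma act_rev [simp]: "act a (rev w) (act a w p) = p"
  by (induction w arbitrary: p) (auto simp: act_append vieta_vieta)

lemma act_rev' [simp]: "act a w (act a (rev w) p) = p"
  using act_rev[of a "rev w" p] by simp

lemma cubic_vieta: "cubic a (vieta a l p) = cubic a p"
  by (cases l) (simp_all add: vieta_def cubic_def algebra_simps power2_eq_square)

lemma cubic_act [simp]: "cubic a (act a w p) = cubic a p"
  by (induction w) (auto simp: cubic_vieta)

text \<open>This is \<open>cubic_vieta\<close> differentiated.\<close>

lemma pair_grad_vieta: "pair (grad a (vieta a l p)) (dvieta p l v) = pair (grad a p) v"
  by (cases l) (simp_all add: vieta_def dvieta_def grad_def pair_def algebra_simps power2_eq_square)

lemma pair_grad_dact: "pair (grad a (act a w p)) (dact a w p v) = pair (grad a p) v"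
  by (induction w) (auto simp: pair_grad_vieta)

lemma dvieta_linear:
  "dvieta p l (\<lambda>m. c * v m + v' m) = (\<lambda>m. c * dvieta p l v m + dvieta p l v' m)"
  by (cases l) (auto simp: dvieta_def algebra_simps)

lemma dact_linear:
  "dact a w p (\<lambda>m. c * v m + v' m) = (\<lambda>m. c * dact a w p v m + dact a w p v' m)"
  by (induction w) (auto simp: dvieta_linear)

lemma dact_zero: "dact a w p (\<lambda>_. 0) = (\<lambda>_. 0)"
  by (induction w) (auto simp: dvieta_def)

lemma dact_scale: "dact a w p (\<lambda>m. c * v m) = (\<lambda>m. c * dact a w p v m)"
  using dact_linear[of a w p c v "\<lambda>_. 0"] by (simp add: dact_zero)

lemma vec_single: "v = (\<lambda>m. v Lx * single Lx m + (v Ly * single Ly m + (v Lz * single Lz m + 0)))"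
  by (rule ext, case_tac m) (auto simp: single_def)

lemma dact_expand:
  "dact a w p v m = v Lx * dact a w p (single Lx) m + v Ly * dact a w p (single Ly) m + v Lz * dact a w p (single Lz) m"
  by (subst vec_single[of v], simp only: dact_linear dact_zero) simp

definition det3 :: "(letter \<Rightarrow> 'a::comm_ring_1) \<Rightarrow> (letter \<Rightarrow> 'a) \<Rightarrow> (letter \<Rightarrow> 'a) \<Rightarrow> 'a" where
  "det3 u v w = u Lx * (v Ly * w Lz - v Lz * w Ly) - u Ly * (v Lx * w Lz - v Lz * w Lx)
     + u Lz * (v Lx * w Ly - v Ly * w Lx)"

text \<open>The derivative of an involution fixes two coordinates and negates the third up to a
  shear, which gives determinant -1.\<close>

lemma det3_dvieta: "det3 (dvieta p l u) (dvieta p l v) (dvieta p l w) = - det3 u v w"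
  by (cases l) (simp_all add: det3_def dvieta_def algebra_simps)

lemma det3_dact:
  "det3 (dact a c p u) (dact a c p v) (dact a c p w) = (-1) ^ length c * det3 u v w"
  by (induction c) (auto simp: det3_dvieta)

lemma det3_dact_single:
  "even (length c) \<Longrightarrow>
   det3 (dact a c p (single Lx)) (dact a c p (single Ly)) (dact a c p (single Lz)) = 1"
  by (simp add: det3_dact) (simp add: det3_def single_def)

section \<open>Fixed points over valuation rings\<close>

text \<open>A place of the field. Containing the rationals makes the residue characteristic 0. The
  condition \<open>total\<close> is automatic at 0, since \<open>inverse 0 = 0\<close>.\<close>

locale valuation_ring =
  fixes R :: "'a::field_char_0 set"
  assumes rat_mem [simp, intro]: "of_rat q \<in> R"
    and add_mem [simp, intro]: "x \<in> R \<Longrightarrow> y \<in> R \<Longrightarrow> x + y \<in> R"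
    and mult_mem [simp, intro]: "x \<in> R \<Longrightarrow> y \<in> R \<Longrightarrow> x * y \<in> R"
    and total: "x \<in> R \<or> inverse x \<in> R"
begin

lemma zero_mem [simp]: "0 \<in> R" using rat_mem[of 0] by simp
lemma one_mem [simp]: "1 \<in> R" using rat_mem[of 1] by simp
lemma of_int_mem [simp]: "of_int n \<in> R" using rat_mem[of "of_int n"] by (simp del: rat_mem)
lemma numeral_mem [simp]: "numeral n \<in> R" using of_int_mem[of "numeral n"] by (simp del: of_int_mem)
lemma uminus_mem [simp, intro]: "x \<in> R \<Longrightarrow> - x \<in> R"
  using mult_mem[of "- 1" x] rat_mem[of "- 1"] by (simp del: rat_mem add: of_rat_minus)
lemma diff_mem [simp, intro]: "x \<in> R \<Longrightarrow> y \<in> R \<Longrightarrow> x - y \<in> R"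
  using add_mem[of x "- y"] by simp
lemma power_mem [simp, intro]: "x \<in> R \<Longrightarrow> x ^ n \<in> R"
  by (induction n) auto

text \<open>The second disjunct is needed because \<open>x / 0 = 0\<close>.\<close>

definition smaller :: "'a \<Rightarrow> 'a \<Rightarrow> bool" where
  "smaller y x \<longleftrightarrow> x \<noteq> 0 \<and> x / y \<notin> R \<or> x \<noteq> 0 \<and> y = 0"

text \<open>|y| \<le> |x| for the absolute value of \<open>R\<close>, expressed as divisibility;
  such comparisons stand in for a value group.\<close>

definition atmost :: "'a \<Rightarrow> 'a \<Rightarrow> bool" where
  "atmost y x \<longleftrightarrow> (\<exists>c\<in>R. y = c * x)"

lemma smaller_iff: "smaller y x \<longleftrightarrow> \<not> atmost x y"
proof (cases "y = 0")
  case True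
  then show ?thesis by (auto simp: smaller_def atmost_def intro: bexI[of _ 0])
next
  case False
  then show ?thesis
    by (auto simp: smaller_def atmost_def intro: bexI[of _ "x / y"] bexI[of _ 0])
qed

lemma atmost_refl [simp]: "atmost x x"
  unfolding atmost_def by (rule bexI[of _ 1]) auto

lemma atmost_trans: "atmost x y \<Longrightarrow> atmost y z \<Longrightarrow> atmost x z"
  unfolding atmost_def by (metis mult.assoc mult_mem)

lemma atmost_total: "atmost x y \<or> atmost y x"
proof (cases "x = 0 \<or> y = 0")
  case True
  then show ?thesis unfolding atmost_def by (metis mult_zero_left zero_mem)
next
  case False
  then show ?thesis using total[of "x / y"] unfolding atmost_def
    by (auto intro: bexI[of _ "x / y"] bexI[of _ "y / x"])
qed

lemma atmost_mult: "atmost x y \<Longrightarrow> atmost u v \<Longrightarrow> atmost (x * u) (y * v)"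
  unfolding atmost_def by (metis mult.assoc mult.left_commute mult_mem)

lemma atmost_add: "atmost x z \<Longrightarrow> atmost y z \<Longrightarrow> atmost (x + y) z"
  unfolding atmost_def by (metis add_mem distrib_right)

lemma atmost_uminus: "atmost x z \<Longrightarrow> atmost (- x) z"
  unfolding atmost_def by (metis mult_minus_left uminus_mem)

lemma mem_iff_atmost: "x \<in> R \<longleftrightarrow> atmost x 1"
  unfolding atmost_def by auto

lemma notmem_iff_smaller: "x \<notin> R \<longleftrightarrow> smaller 1 x"
  by (simp add: smaller_iff mem_iff_atmost)

lemma smaller_imp_atmost: "smaller x y \<Longrightarrow> atmost x y"
  using atmost_total smaller_iff by blast

lemma smaller_trans1: "smaller x y \<Longrightarrow> atmost y z \<Longrightarrow> smaller x z"
  by (meson atmost_trans smaller_iff)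

lemma smaller_trans2: "atmost x y \<Longrightarrow> smaller y z \<Longrightarrow> smaller x z"
  by (meson atmost_trans smaller_iff)

lemma smaller_irrefl: "\<not> smaller x x"
  by (simp add: smaller_iff)

lemma smaller_add: "smaller x z \<Longrightarrow> smaller y z \<Longrightarrow> smaller (x + y) z"
  by (meson atmost_add atmost_total smaller_iff smaller_trans2 atmost_refl)

lemma smaller_uminus: "smaller x z \<Longrightarrow> smaller (- x) z"
  by (meson atmost_refl atmost_uminus smaller_trans2)

lemma smaller_diff: "smaller x z \<Longrightarrow> smaller y z \<Longrightarrow> smaller (x - y) z"
  using smaller_add[of x z "- y"] smaller_uminus by simp

lemma smaller_nonzero: "smaller x z \<Longrightarrow> z \<noteq> 0"
  by (auto simp: smaller_def)

lemma atmost_cancel: "z \<noteq> 0 \<Longrightarrow> atmost (x * z) (y * z) \<Longrightarrow> atmost x y"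
  unfolding atmost_def by (metis mult.assoc mult_right_cancel)

lemma smaller_mult1: "smaller x y \<Longrightarrow> atmost u v \<Longrightarrow> v \<noteq> 0 \<Longrightarrow> smaller (x * u) (y * v)"
  by (meson atmost_cancel atmost_mult atmost_refl smaller_iff smaller_trans2)

lemma smaller_mem: "x \<in> R \<Longrightarrow> y \<notin> R \<Longrightarrow> smaller x y"
  using mem_iff_atmost notmem_iff_smaller smaller_trans2 by blast

text \<open>Ultrametric principle: otherwise x would be the difference of two strictly smaller
  elements.\<close>

lemma atmost_dominant: "smaller y x \<Longrightarrow> atmost x (x + y)"
  by (metis add.commute add_diff_cancel_left' atmost_refl atmost_total smaller_add smaller_diff smaller_iff smaller_irrefl diff_add_cancel)

lemma atmost_max: "\<exists>i :: letter. \<forall>j. atmost (p j) (p i)"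
  using atmost_total[of "p Lx" "p Ly"] atmost_total[of "p Lx" "p Lz"] atmost_total[of "p Ly" "p Lz"]
    atmost_trans unfolding all_letter by (metis atmost_refl)

section \<open>Orbits of points and their derivatives at a place\<close>

lemma act_mem:
  assumes "\<And>l. a l \<in> R" "\<And>l. p l \<in> R"
  shows "act a w p m \<in> R"
  using assms(2) by (induction w arbitrary: m) (auto simp: vieta_def assms(1))

lemma dact_mem:
  assumes "\<And>l. a l \<in> R" "\<And>l. p l \<in> R" "\<And>l. v l \<in> R"
  shows "dact a w p v m \<in> R"
  using assms(3) by (induction w arbitrary: m) (auto simp: dvieta_def act_mem[OF assms(1,2)])

lemma dtrace_mem:
  assumes "\<And>l. a l \<in> R" "\<And>l. p l \<in> R"
  shows "dtrace a w p \<in> R"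
  unfolding dtrace_def by (intro add_mem dact_mem assms) (auto simp: single_def)

text \<open>The two shapes of a point of the surface that is infinite at the place.  Moving a coordinate
  other than \<open>i\<close> turns a peak at \<open>i\<close> into a larger peak, so a reduced cyclic word has no fixed
  peak; a cusp at \<open>k\<close> stays one until \<open>k\<close> moves, which makes it a peak.\<close>

definition peak :: "(letter \<Rightarrow> 'a) \<Rightarrow> letter \<Rightarrow> bool" where
  "peak p i \<longleftrightarrow> (\<forall>j. j \<noteq> i \<longrightarrow> p j \<notin> R \<and> smaller (p j) (p i))"

definition cusp :: "(letter \<Rightarrow> 'a) \<Rightarrow> letter \<Rightarrow> bool" where
  "cusp p k \<longleftrightarrow> p k \<in> R \<and> (\<forall>j. j \<noteq> k \<longrightarrow> p j \<notin> R)"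

lemma smaller_prod: "x \<notin> R \<Longrightarrow> y \<noteq> 0 \<Longrightarrow> smaller y (x * y)"
  using smaller_mult1[of 1 x y y] by (simp add: notmem_iff_smaller)

text \<open>The new coordinate is - \<open>p i * p j\<close> up to \<open>a k - p k\<close>. The
  product dominates both factors because both are infinite, and it dominates \<open>p k\<close>. The
  two alternatives for \<open>p k\<close> cover a cusp at k and a peak at i.\<close>

lemma vieta_peak_aux:
  assumes a: "a k \<in> R" and d: "i \<noteq> j" "j \<noteq> k" "i \<noteq> k"
    and big: "p i \<notin> R" "p j \<notin> R" and k: "p k \<in> R \<or> smaller (p k) (p i)"
  shows "peak (vieta a k p) k" and "smaller (p i) (vieta a k p k)" and "smaller (p j) (vieta a k p k)"
proof -
  have nz: "p i \<noteq> 0" "p j \<noteq> 0" using big by auto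
  have pi: "smaller (p i) (p i * p j)" "smaller (p j) (p i * p j)"
    using smaller_prod[of "p j" "p i"] smaller_prod[of "p i" "p j"] nz big by (simp_all add: mult.commute)
  have m: "smaller x (p i * p j)" if "x \<in> R" for x
    using smaller_mem[OF that big(1)] pi(1) smaller_imp_atmost smaller_trans1 by blast
  have pk: "smaller (p k) (p i * p j)"
    using k m pi(1) smaller_imp_atmost smaller_trans1 by blast
  have "atmost (- (p i * p j)) (- (p i * p j) + (a k - p k))"
    by (rule atmost_dominant) (metis atmost_refl atmost_uminus m[OF a] minus_minus pk smaller_diff smaller_trans1)
  moreover have e: "vieta a k p = p(k := - (p i * p j) + (a k - p k))"
    using vieta_eq[of k i j a p] d by (auto simp: algebra_simps)
  ultimately have "atmost (p i * p j) (vieta a k p k)"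
    by (metis atmost_refl atmost_trans atmost_uminus fun_upd_same minus_minus)
  then show *: "smaller (p i) (vieta a k p k)" "smaller (p j) (vieta a k p k)"
    using pi smaller_trans1 by blast+
  show "peak (vieta a k p) k" unfolding peak_def
  proof (intro allI impI)
    fix l assume "l \<noteq> k"
    then have "l = i \<or> l = j" using letter_cases3[of i j k l] d by auto
    moreover have "vieta a k p i = p i" "vieta a k p j = p j" using d by (auto simp: e)
    ultimately show "vieta a k p l \<notin> R \<and> smaller (vieta a k p l) (vieta a k p k)"
      using * big by auto
  qed
qed

lemma vieta_peak:
  assumes "a l \<in> R" "peak p i" "l \<noteq> i"
  shows "peak (vieta a l p) l" and "smaller (p i) (vieta a l p l)"
proof -
  obtain j where j: "j \<noteq> i" "j \<noteq> l" using letter_third by blast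
  have "p j \<notin> R" "p l \<notin> R" "smaller (p l) (p i)" using assms j by (auto simp: peak_def)
  moreover have "p i \<notin> R"
    using calculation smaller_imp_atmost smaller_mem smaller_trans2 notmem_iff_smaller smaller_trans1 by blast
  ultimately show "peak (vieta a l p) l" "smaller (p i) (vieta a l p l)"
    using vieta_peak_aux[of a l i j p] assms j by auto
qed

lemma act_peak:
  assumes a: "\<And>l. a l \<in> R" and "peak p i" "distinct_adj w" "w \<noteq> []" "last w \<noteq> i"
  shows "peak (act a w p) (hd w) \<and> smaller (p i) (act a w p (hd w))"
  using assms(3-)
proof (induction w)
  case (Cons l w)
  show ?case
  proof (cases "w = []")
    case True
    then show ?thesis using vieta_peak[of a l p i] a assms(2) Cons by auto
  next
    case False
    then have IH: "peak (act a w p) (hd w)" "smaller (p i) (act a w p (hd w))"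
      using Cons by (auto simp: distinct_adj_Cons)
    have "l \<noteq> hd w" using Cons False by (auto simp: distinct_adj_Cons)
    then have "peak (vieta a l (act a w p)) l" "smaller (act a w p (hd w)) (vieta a l (act a w p) l)"
      using vieta_peak[of a l "act a w p" "hd w"] a IH by auto
    then show ?thesis using IH(2) smaller_imp_atmost smaller_trans1 by fastforce
  qed
qed auto

text \<open>If the first move differs from i, the word ends with a peak at its head that is strictly
  larger than \<open>p i\<close>, which a fixed point cannot have. If the first move is i, the
  reversed word also fixes p and starts with \<open>hd w\<close>, which is different from i.\<close>

lemma fixed_not_peak:
  assumes a: "\<And>l. a l \<in> R" and w: "distinct_adj w" "w \<noteq> []" "hd w \<noteq> last w" and fx: "act a w p = p"
  shows "\<not> peak p i"
proof
  assume pk: "peak p i"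
  have *: False if v: "distinct_adj v" "v \<noteq> []" "last v \<noteq> i" "act a v p = p" for v
  proof -
    have P: "peak p (hd v)" "smaller (p i) (p (hd v))"
      using act_peak[of a p i v] a pk v by auto
    then have "hd v \<noteq> i" using smaller_irrefl by auto
    then show False using P pk unfolding peak_def
      by (metis smaller_imp_atmost smaller_irrefl smaller_trans1)
  qed
  show False
  proof (cases "last w = i")
    case True
    have "act a (rev w) p = p" by (metis act_rev fx)
    then show False using *[of "rev w"] w True by (auto simp: last_rev)
  next
    case False
    then show False using * w fx by auto
  qed
qed

text \<open>Compare the terms of the equation, with i a largest coordinate. If both other
  coordinates are finite, the square of \<open>p i\<close> dominates all other terms, which is
  impossible. If exactly one is finite, it is a cusp there. If both are infinite, a coordinate as
  large as \<open>p i\<close> would let the triple product dominate all other terms, so there is a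
  peak at i.\<close>

lemma peak_or_cusp:
  assumes a: "\<And>l. a l \<in> R" and D: "cubic a p \<in> R" and big: "p l \<notin> R"
  shows "(\<exists>i. peak p i) \<or> (\<exists>k. cusp p k)"
proof -
  obtain i where i: "\<And>j. atmost (p j) (p i)" using atmost_max by blast
  have bi: "p i \<notin> R"
    using big i[of l] mem_iff_atmost atmost_trans by blast
  define j where "j = nxt i"
  define k where "k = nxt j"
  have d: "i \<noteq> j" "j \<noteq> k" "i \<noteq> k" by (cases i; simp add: j_def k_def)+
  have eq: "cubic a p = (p i)\<^sup>2 + (p j)\<^sup>2 + (p k)\<^sup>2 + p i * p j * p k - a i * p i - a j * p j - a k * p k"
    by (rule cubic_eq[OF d])
  have nz: "p i \<noteq> 0" using bi by auto
  have ap: "atmost (a m * p m) (p i)" for m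
    using atmost_mult[of "a m" 1 "p m" "p i"] a i by (simp add: mem_iff_atmost)
  consider "p j \<in> R" "p k \<in> R" | "p j \<notin> R" "p k \<in> R" | "p j \<in> R" "p k \<notin> R" | "p j \<notin> R" "p k \<notin> R" by blast
  then show ?thesis
  proof cases
    case 1
    have b: "smaller (p i) (p i * p i)" using smaller_prod bi nz by blast
    have s: "smaller x (p i * p i)" if "atmost x (p i)" for x using b that smaller_trans2 by blast
    have r: "smaller x (p i * p i)" if "x \<in> R" for x
      using s smaller_imp_atmost smaller_mem[OF that bi] by blast
    have ijk: "atmost (p i * p j * p k) (p i)"
      using atmost_mult[of "p i" "p i" "p j * p k" 1] 1 by (simp add: mem_iff_atmost[symmetric] mult.assoc)
    have "p i * p i = cubic a p - (p j)\<^sup>2 - (p k)\<^sup>2 - p i * p j * p k + a i * p i + a j * p j + a k * p k"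
      unfolding eq by (simp add: power2_eq_square)
    moreover have "smaller \<dots> (p i * p i)"
      by (intro smaller_add smaller_diff r s[OF ijk] s[OF ap] D power_mem 1)
    ultimately show ?thesis using smaller_irrefl by auto
  next
    case 2
    then have "cusp p k" unfolding cusp_def using letter_cases3[OF d] bi by metis
    then show ?thesis by blast
  next
    case 3
    then have "cusp p j" unfolding cusp_def using letter_cases3[OF d] bi by metis
    then show ?thesis by blast
  next
    case 4
    have *: "smaller (p m) (p i)" if m: "m = j \<or> m = k" for m
    proof (rule ccontr)
      assume "\<not> ?thesis"
      then have le: "atmost (p i) (p m)" by (simp add: smaller_iff)
      obtain n where n: "n = j \<and> m = k \<or> n = k \<and> m = j" using m by blast
      have nR: "p n \<notin> R" "p n \<noteq> 0" "p m \<noteq> 0" using n 4 by auto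
      let ?t = "p n * (p i * p m)"
      have t: "?t = p i * p j * p k" using n by auto
      have b: "smaller (p i * p m) ?t" using smaller_prod[OF nR(1), of "p i * p m"] nz nR by auto
      have "smaller (p i) (p i * p m)" using smaller_prod[of "p m" "p i"] nz n 4 by (auto simp: mult.commute)
      then have bi': "smaller (p i) ?t" using b smaller_imp_atmost smaller_trans2 by blast
      have s: "smaller x ?t" if "atmost x (p i)" for x using bi' that smaller_trans2 by blast
      have r: "smaller x ?t" if "x \<in> R" for x
        using s smaller_imp_atmost smaller_mem[OF that bi] by blast
      have q: "smaller ((p h)\<^sup>2) ?t" for h
        using atmost_mult[OF i[of h] atmost_trans[OF i[of h] le]] b smaller_trans2
        by (auto simp: power2_eq_square)
      have "?t = cubic a p - (p i)\<^sup>2 - (p j)\<^sup>2 - (p k)\<^sup>2 + a i * p i + a j * p j + a k * p k"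
        unfolding eq t by simp
      moreover have "smaller \<dots> ?t"
        by (intro smaller_add smaller_diff r q s[OF ap] D)
      ultimately show False using smaller_irrefl by auto
    qed
    have "peak p i" unfolding peak_def using letter_cases3[OF d] * 4 by metis
    then show ?thesis by blast
  qed
qed

text \<open>A move at l keeps the finite coordinate k and the infinite third coordinate, so the new
  point is again infinite and \<open>peak_or_cusp\<close> applies. A peak would need
  \<open>p k\<close> to be infinite or larger than an infinite coordinate, and a cusp can only be at
  k.\<close>

lemma act_cusp:
  assumes a: "\<And>l. a l \<in> R" and D: "cubic a p \<in> R" and "cusp p k" "k \<notin> set w"
  shows "cusp (act a w p) k"
  using assms(4)
proof (induction w)
  case (Cons l w)
  let ?q = "act a w p" and ?r = "vieta a l (act a w p)"
  have c: "cusp ?q k" "l \<noteq> k" using Cons by auto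
  obtain j where j: "j \<noteq> k" "j \<noteq> l" using letter_third by blast
  have e: "?r j = ?q j" "?r k = ?q k" using j c by (auto simp: vieta_def)
  then have r: "?r j \<notin> R" "?r k \<in> R" using c j by (auto simp: cusp_def)
  have "cubic a ?r \<in> R" using D by (simp add: cubic_vieta)
  then consider i where "peak ?r i" | i where "cusp ?r i"
    using peak_or_cusp[of a ?r j] a r by blast
  then have "cusp ?r k"
  proof cases
    case 1
    then have ik: "i = k" using r unfolding peak_def by auto
    then have "smaller (?r j) (?r k)" using 1 j by (auto simp: peak_def)
    then show ?thesis using r smaller_mem smaller_imp_atmost smaller_trans2 smaller_irrefl by blast
  next
    case 2
    then have "i = k" using r unfolding cusp_def by auto
    then show ?thesis using 2 by simp
  qed
  then show ?case by simp
qed (use assms in auto)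

text \<open>An infinite fixed point is a cusp at some k. As all letters occur, k moves at some time
  and creates a peak, and the cyclic rotation of the word starting after that move fixes this
  peak.\<close>

theorem fixed_point_mem:
  assumes a: "\<And>l. a l \<in> R" and D: "cubic a p \<in> R"
    and w: "distinct_adj w" "hd w \<noteq> last w" "set w = UNIV" and fx: "act a w p = p"
  shows "p l \<in> R"
proof (rule ccontr)
  assume "p l \<notin> R"
  moreover have ne: "w \<noteq> []" using w by auto
  ultimately obtain k where k: "cusp p k"
    using peak_or_cusp[OF a D] fixed_not_peak[OF a w(1) ne w(2) fx] by blast
  have "k \<in> set w" using w by auto
  \<comment> \<open>Words act from the right: the last occurrence of k in the list is the first move
    of k.\<close>
  then obtain u v where uv: "w = u @ k # v" "k \<notin> set v" by (metis split_list_last)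
  let ?q = "act a (k # v) p"
  have c: "cusp (act a v p) k" using act_cusp[OF a D k uv(2)] .
  define i where "i = nxt k"
  define j where "j = nxt i"
  have d: "i \<noteq> j" "j \<noteq> k" "i \<noteq> k" by (cases k; simp add: j_def i_def)+
  have pk: "peak ?q k" using vieta_peak_aux(1)[of a k i j "act a v p"] a d c by (auto simp: cusp_def)
  have "act a ((k # v) @ u) ?q = act a (k # v) (act a (u @ k # v) p)" by (simp only: act_append)
  then have fq: "act a ((k # v) @ u) ?q = ?q" using fx uv by simp
  have "distinct_adj ((k # v) @ u)" "hd ((k # v) @ u) \<noteq> last ((k # v) @ u)"
  proof -
    have s: "distinct_adj u" "distinct_adj (k # v)" "u = [] \<or> last u \<noteq> k"
      using w(1) unfolding uv by (auto simp: distinct_adj_append_iff)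
    show "distinct_adj ((k # v) @ u)"
      using s w(2) unfolding distinct_adj_append_iff uv by (cases "u = []") auto
    show "hd ((k # v) @ u) \<noteq> last ((k # v) @ u)"
      using s w(2) unfolding uv by (cases "u = []") auto
  qed
  then show False using fixed_not_peak[OF a _ _ _ fq] pk by blast
qed

end

section \<open>Existence of valuation rings\<close>

definition rat_subring :: "'a::field_char_0 set \<Rightarrow> bool" where
  "rat_subring R \<longleftrightarrow> (\<forall>q. of_rat q \<in> R) \<and> (\<forall>x\<in>R. \<forall>y\<in>R. x + y \<in> R \<and> x * y \<in> R)"

lemma rat_subringD:
  assumes "rat_subring R"
  shows "0 \<in> R" "1 \<in> R" "x \<in> R \<Longrightarrow> y \<in> R \<Longrightarrow> x + y \<in> R" "x \<in> R \<Longrightarrow> y \<in> R \<Longrightarrow> x * y \<in> R"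
    "x \<in> R \<Longrightarrow> - x \<in> R" "x \<in> R \<Longrightarrow> y \<in> R \<Longrightarrow> x - y \<in> R" "x \<in> R \<Longrightarrow> x ^ n \<in> R"
    "finite A \<Longrightarrow> (\<And>i. i \<in> A \<Longrightarrow> f i \<in> R) \<Longrightarrow> sum f A \<in> R"
proof -
  have q: "of_rat q \<in> R" for q using assms by (auto simp: rat_subring_def)
  show *: "0 \<in> R" "1 \<in> R" "\<And>x y. x \<in> R \<Longrightarrow> y \<in> R \<Longrightarrow> x + y \<in> R" "\<And>x y. x \<in> R \<Longrightarrow> y \<in> R \<Longrightarrow> x * y \<in> R"
    using assms q[of 0] q[of 1] by (auto simp: rat_subring_def)
  have m: "- 1 \<in> R" using q[of "- 1"] by (simp add: of_rat_minus)
  show **: "\<And>x. x \<in> R \<Longrightarrow> - x \<in> R" using *(4)[OF m] by simp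
  show "x \<in> R \<Longrightarrow> y \<in> R \<Longrightarrow> x - y \<in> R" using *(3)[of x "- y"] ** by simp
  show "x \<in> R \<Longrightarrow> x ^ n \<in> R" by (induction n) (auto intro: *)
  show "finite A \<Longrightarrow> (\<And>i. i \<in> A \<Longrightarrow> f i \<in> R) \<Longrightarrow> sum f A \<in> R"
    by (induction A rule: finite_induct) (auto intro: *)
qed

definition adjoin :: "'a::field_char_0 set \<Rightarrow> 'a \<Rightarrow> 'a set" where
  "adjoin R x = {poly p x | p. \<forall>i. coeff p i \<in> R}"

lemma adjoin:
  assumes "rat_subring R"
  shows "rat_subring (adjoin R x)" "R \<subseteq> adjoin R x" "x \<in> adjoin R x"
proof -
  note R = rat_subringD[OF assms]
  show sub: "R \<subseteq> adjoin R x"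
  proof
    fix r assume "r \<in> R"
    then show "r \<in> adjoin R x" unfolding adjoin_def
      by (auto intro!: exI[of _ "[:r:]"] simp: R coeff_pCons split: nat.split)
  qed
  show "x \<in> adjoin R x" unfolding adjoin_def
    by (auto intro!: exI[of _ "[:0, 1:]"] simp: R coeff_pCons split: nat.split)
  have "poly p x + poly q x \<in> adjoin R x \<and> poly p x * poly q x \<in> adjoin R x"
    if "\<forall>i. coeff p i \<in> R" "\<forall>i. coeff q i \<in> R" for p q
  proof
    have "poly p x + poly q x = poly (p + q) x" "\<forall>i. coeff (p + q) i \<in> R"
      using that by (auto intro: R)
    then show "poly p x + poly q x \<in> adjoin R x" unfolding adjoin_def by blast
    have "poly p x * poly q x = poly (p * q) x" "\<forall>i. coeff (p * q) i \<in> R"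
      using that by (auto intro!: R simp: coeff_mult)
    then show "poly p x * poly q x \<in> adjoin R x" unfolding adjoin_def by blast
  qed
  then show "rat_subring (adjoin R x)"
    using assms sub by (auto simp: rat_subring_def adjoin_def)
qed

text \<open>Chevalley's argument. If neither x nor \<open>inverse x\<close> is in \<open>R\<close>,
  maximality puts \<open>inverse d\<close> into \<open>R[x]\<close> and \<open>R[inverse x]\<close>;
  multiplying by d writes 1 as a polynomial in x, and as one in \<open>inverse x\<close>, with
  coefficients in the ideal \<open>J = d R\<close>. Of two such relations of least degree, the
  longer one can be shortened by the other.\<close>

lemma maximal_subring_total:
  fixes R :: "'a::field_char_0 set"
  assumes R: "rat_subring R" and d: "d \<in> R" "inverse d \<notin> R"
    and max: "\<And>S. rat_subring S \<Longrightarrow> R \<subseteq> S \<Longrightarrow> inverse d \<notin> S \<Longrightarrow> S = R"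
  shows "x \<in> R \<or> inverse x \<in> R"
proof (rule ccontr)
  assume neg: "\<not> ?thesis"
  note RD = rat_subringD[OF R]
  have d0: "d \<noteq> 0" using d by auto
  define J where "J = (\<lambda>r. d * r) ` R"
  have J0: "0 \<in> J" unfolding J_def by (rule image_eqI[of _ _ 0]) (auto simp: RD(1))
  have Jadd: "x + y \<in> J" if xy: "x \<in> J" "y \<in> J" for x y
  proof -
    obtain r s where "r \<in> R" "s \<in> R" "x = d * r" "y = d * s" using xy unfolding J_def by auto
    then have "x + y = d * (r + s)" "r + s \<in> R" using RD by (auto simp: distrib_left)
    then show ?thesis unfolding J_def by blast
  qed
  have Jmult: "x * y \<in> J" if xy: "x \<in> J" "y \<in> R" for x y
  proof -
    obtain r where "r \<in> R" "x = d * r" using xy unfolding J_def by auto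
    then have "x * y = d * (r * y)" "r * y \<in> R" using RD xy by (auto simp: mult.assoc)
    then show ?thesis unfolding J_def by blast
  qed
  have Jmult': "y * x \<in> J" if "x \<in> J" "y \<in> R" for x y
    using Jmult[OF that] by (simp add: mult.commute)
  have JR: "x \<in> R" if "x \<in> J" for x using that d RD unfolding J_def by auto
  have Jdiff: "x - y \<in> J" if "x \<in> J" "y \<in> J" for x y
    using Jadd[OF that(1) Jmult[OF that(2), of "- 1"]] RD by simp
  have Jsum: "finite A \<Longrightarrow> (\<And>i. i \<in> A \<Longrightarrow> f i \<in> J) \<Longrightarrow> sum f A \<in> J" for A and f :: "nat \<Rightarrow> 'a"
    by (induction A rule: finite_induct) (auto intro: J0 Jadd)
  have J1: "1 \<notin> J"
  proof
    assume "1 \<in> J"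
    then obtain r where "r \<in> R" "1 = d * r" unfolding J_def by auto
    then have "inverse d = r" using d0 by (simp add: field_simps)
    then show False using d \<open>r \<in> R\<close> by simp
  qed
  \<comment> \<open>By maximality the ideal \<open>J\<close> lies in the Jacobson radical.\<close>
  have unit: "inverse (1 - r) \<in> R" if r: "r \<in> J" for r
  proof (rule ccontr)
    assume i: "inverse (1 - r) \<notin> R"
    have u0: "1 - r \<noteq> 0" using r J1 by auto
    have uR: "1 - r \<in> R" using JR[OF r] RD by auto
    have pw: "1 - (1 - r) ^ n \<in> J" for n
    proof (induction n)
      case (Suc n)
      have "1 - (1 - r) ^ Suc n = (1 - (1 - r) ^ n) + r * (1 - r) ^ n" by (simp add: algebra_simps)
      moreover have "\<dots> \<in> J" using Jadd[OF Suc Jmult[OF r RD(7)[OF uR]]] .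
      ultimately show ?case by (simp only:)
    qed (use J0 in auto)
    \<comment> \<open>The localization of \<open>R\<close> at \<open>1 - r\<close>. By maximality it
      would contain \<open>inverse d\<close>, so that a power of \<open>1 - r\<close> lies in
      \<open>J\<close>; but such powers are 1 modulo \<open>J\<close>.\<close>
    define S where "S = {b / (1 - r) ^ n | b n. b \<in> R}"
    have SR: "R \<subseteq> S" unfolding S_def by (force intro: exI[of _ 0])
    have "b / (1 - r) ^ n + c / (1 - r) ^ m = (b * (1 - r) ^ m + c * (1 - r) ^ n) / (1 - r) ^ (n + m)" for b c n m
      using u0 by (simp add: field_simps power_add)
    moreover have "b / (1 - r) ^ n * (c / (1 - r) ^ m) = (b * c) / (1 - r) ^ (n + m)" for b c n m
      using u0 by (simp add: field_simps power_add)
    moreover have "b * (1 - r) ^ m + c * (1 - r) ^ n \<in> R" "b * c \<in> R" if "b \<in> R" "c \<in> R" for b c n m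
      by (intro RD(3,4,7) that uR)+
    ultimately have cl: "b / (1 - r) ^ n + c / (1 - r) ^ m \<in> S" "b / (1 - r) ^ n * (c / (1 - r) ^ m) \<in> S"
      if "b \<in> R" "c \<in> R" for b c n m
      unfolding S_def mem_Collect_eq using that by metis+
    have "x + y \<in> S \<and> x * y \<in> S" if "x \<in> S" "y \<in> S" for x y
    proof -
      obtain b n c m where "b \<in> R" "c \<in> R" "x = b / (1 - r) ^ n" "y = c / (1 - r) ^ m"
        using \<open>x \<in> S\<close> \<open>y \<in> S\<close> unfolding S_def by blast
      then show ?thesis using cl by simp
    qed
    then have "rat_subring S" using R SR unfolding rat_subring_def by blast
    moreover have "inverse (1 - r) \<in> S" unfolding S_def
      by (auto intro!: exI[of _ 1] RD simp: field_simps)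
    ultimately have "inverse d \<in> S" using max SR i by blast
    then obtain b n where b: "b \<in> R" "inverse d = b / (1 - r) ^ n" unfolding S_def by auto
    then have "(1 - r) ^ n = d * b" using d0 u0 by (simp add: field_simps)
    then have "(1 - r) ^ n \<in> J" using b unfolding J_def by auto
    then show False using Jadd[OF pw[of n]] J1 by fastforce
  qed
  define rel where "rel y n \<longleftrightarrow> (\<exists>p. degree p \<le> n \<and> (\<forall>i. coeff p i \<in> J) \<and> poly p y = 1)" for y n
  have ex: "\<exists>n. rel y n" if "y \<notin> R" for y
  proof -
    have "adjoin R y \<noteq> R" using adjoin(3)[OF R, of y] that by auto
    then have "inverse d \<in> adjoin R y" using max adjoin[OF R] by blast
    then obtain p where p: "\<forall>i. coeff p i \<in> R" "poly p y = inverse d" unfolding adjoin_def by auto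
    then show ?thesis unfolding rel_def
      by (intro exI[of _ "degree p"] exI[of _ "smult d p"]) (auto simp: J_def d0)
  qed
  have n0: "\<not> rel y 0" for y
  proof
    assume "rel y 0"
    then obtain p where p: "degree p = 0" "\<forall>i. coeff p i \<in> J" "poly p y = 1" unfolding rel_def by auto
    then obtain c where "p = [:c:]" using degree_eq_zeroE by blast
    then show False using p(2)[rule_format, of 0] p(3) J1 by auto
  qed
  have red: "rel y (n - 1)" if y: "y \<noteq> 0" and ry: "rel y n" and ri: "rel (inverse y) m" and mn: "m \<le> n" for y n m
  proof -
    obtain p where p: "degree p \<le> n" "\<And>i. coeff p i \<in> J" "poly p y = 1" using ry rel_def by auto
    obtain q where q: "degree q \<le> m" "\<And>i. coeff q i \<in> J" "poly q (inverse y) = 1" using ri rel_def by auto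
    have np: "n \<ge> 1" using ry n0 by (cases n) auto
    define w where "w = inverse (1 - coeff q 0)"
    have "1 - coeff q 0 \<noteq> 0" using J1 q(2)[of 0] by auto
    then have w: "w \<in> R" "w * (1 - coeff q 0) = 1" using unit[OF q(2)] unfolding w_def by auto
    have "poly q (inverse y) = (\<Sum>i\<le>m. coeff q i * inverse y ^ i)"
      unfolding poly_altdef by (rule sum.mono_neutral_left) (use q(1) in \<open>auto simp: coeff_eq_0\<close>)
    then have "(\<Sum>i\<le>m. coeff q i * inverse y ^ i) = 1" using q(3) by simp
    then have s: "(\<Sum>i=1..m. coeff q i * inverse y ^ i) = 1 - coeff q 0"
      by (simp add: atMost_atLeast0 sum.atLeast_Suc_atMost[of 0 m] algebra_simps)
    \<comment> \<open>Multiplying the relation for \<open>inverse y\<close> by \<open>y ^ n\<close>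
      and by w, the inverse of 1 minus its constant term, gives \<open>y ^ n = poly g y\<close> with
      \<open>g\<close> of degree below n. This replaces the leading term of p.\<close>
    define g where "g = (\<Sum>i=1..m. monom (w * coeff q i) (n - i))"
    have gc: "coeff g i \<in> J" for i
      unfolding g_def coeff_sum by (rule Jsum) (auto simp: J0 Jmult' q w)
    have gh: "coeff g i = 0" if "i \<ge> n" for i
      unfolding g_def coeff_sum by (rule sum.neutral) (use that np in auto)
    have "poly g y = (\<Sum>i=1..m. w * coeff q i * y ^ (n - i))"
      unfolding g_def by (simp add: poly_sum poly_monom)
    also have "\<dots> = (\<Sum>i=1..m. (w * y ^ n) * (coeff q i * inverse y ^ i))"
      by (rule sum.cong) (use y mn in \<open>auto simp: power_diff field_simps\<close>)
    also have "\<dots> = y ^ n"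
    proof -
      have "w * y ^ n * (1 - coeff q 0) = w * (1 - coeff q 0) * y ^ n" by (simp only: mult_ac)
      then show ?thesis unfolding sum_distrib_left[symmetric] s w(2) by simp
    qed
    finally have gy: "poly g y = y ^ n" .
    let ?p = "p - monom (coeff p n) n + smult (coeff p n) g"
    have "degree ?p \<le> n - 1"
    proof (rule degree_le, intro allI impI)
      fix i assume "n - 1 < i"
      then have "i \<ge> n" by simp
      then show "coeff ?p i = 0" using gh[of i] p(1) by (cases "i = n") (auto simp: coeff_eq_0)
    qed
    moreover have "coeff ?p i \<in> J" for i
      using p gc[of i] J0 by (auto intro!: Jadd Jdiff Jmult JR)
    moreover have "poly ?p y = 1" using p gy by (simp add: poly_monom)
    ultimately show ?thesis unfolding rel_def by blast
  qed
  have x0: "x \<noteq> 0" using neg RD by auto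
  define n where "n = (LEAST n. rel x n)"
  define m where "m = (LEAST n. rel (inverse x) n)"
  have n: "rel x n" "\<And>k. rel x k \<Longrightarrow> n \<le> k"
    unfolding n_def using ex neg by (auto intro: LeastI_ex Least_le)
  have m: "rel (inverse x) m" "\<And>k. rel (inverse x) k \<Longrightarrow> m \<le> k"
    unfolding m_def using ex neg by (auto intro: LeastI_ex Least_le)
  have pos: "n \<noteq> 0" "m \<noteq> 0" using n m n0 by metis+
  show False
  proof (cases "m \<le> n")
    case True
    then show False using n(2)[OF red[OF x0 n(1) m(1)]] pos by simp
  next
    case False
    then have "rel (inverse x) (m - 1)" using red[of "inverse x" m n] n(1) m(1) x0 by simp
    then show False using m(2) pos by fastforce
  qed
qed

text \<open>A non-unit d of \<open>S\<close> can be made infinitesimal at a place that is finite on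
  \<open>S\<close>; equivalently, \<open>inverse d\<close> can be made infinite. The union of a
  chain of subrings avoiding \<open>inverse d\<close> avoids it too, so a maximal one
  exists.\<close>

theorem valuation_ring_exists:
  fixes S :: "'a::field_char_0 set"
  assumes S: "rat_subring S" and d: "d \<in> S" "inverse d \<notin> S"
  shows "\<exists>R. valuation_ring R \<and> S \<subseteq> R \<and> inverse d \<notin> R"
proof -
  define A where "A = {R. rat_subring R \<and> S \<subseteq> R \<and> inverse d \<notin> R}"
  have "\<exists>M\<in>A. \<forall>X\<in>A. M \<subseteq> X \<longrightarrow> X = M"
  proof (rule subset_Zorn_nonempty)
    show "A \<noteq> {}" using S d by (auto simp: A_def)
    fix C assume C: "C \<noteq> {}" "subset.chain A C"
    then have CA: "C \<subseteq> A" and lin: "\<And>U V. U \<in> C \<Longrightarrow> V \<in> C \<Longrightarrow> U \<subseteq> V \<or> V \<subseteq> U"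
      by (auto simp: subset_chain_def)
    have "x + y \<in> \<Union>C \<and> x * y \<in> \<Union>C" if "x \<in> \<Union>C" "y \<in> \<Union>C" for x y
    proof -
      obtain U V where UV: "U \<in> C" "V \<in> C" "x \<in> U" "y \<in> V" using \<open>x \<in> \<Union>C\<close> \<open>y \<in> \<Union>C\<close> by auto
      then obtain W where W: "W \<in> C" "x \<in> W" "y \<in> W" using lin[OF UV(1,2)] by auto
      then have "rat_subring W" using CA by (auto simp: A_def)
      then show ?thesis using W rat_subringD(3,4) by blast
    qed
    moreover have "of_rat q \<in> \<Union>C" for q using C(1) CA by (force simp: A_def rat_subring_def)
    moreover have "S \<subseteq> \<Union>C" using C(1) CA unfolding A_def by blast
    ultimately show "\<Union>C \<in> A" using CA by (auto simp: A_def rat_subring_def)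
  qed
  then obtain M where M: "M \<in> A" "\<And>X. X \<in> A \<Longrightarrow> M \<subseteq> X \<Longrightarrow> X = M" by blast
  have "x \<in> M \<or> inverse x \<in> M" for x
  proof (rule maximal_subring_total[of M d])
    show "rat_subring M" "inverse d \<notin> M" "d \<in> M" using M(1) d by (auto simp: A_def)
    fix T assume "rat_subring T" "M \<subseteq> T" "inverse d \<notin> T"
    then show "T = M" using M by (auto simp: A_def)
  qed
  then have "valuation_ring M"
    using M(1) by unfold_locales (auto simp: A_def rat_subring_def)
  then show ?thesis using M(1) by (auto simp: A_def)
qed

section \<open>The Cayley cubic\<close>

text \<open>The tuple (a, b, c, d) is the matrix of the map sending (u, v) to (u^a v^b, u^c v^d).
  The rules for the letters are the three substitutions of \<open>vieta_Phi\<close>.\<close>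

fun monomial :: "letter list \<Rightarrow> int \<times> int \<times> int \<times> int" where
  "monomial [] = (1, 0, 0, 1)"
| "monomial (Lx # w) = (case monomial w of (a, b, c, d) \<Rightarrow> (a + 2 * c, b + 2 * d, - c, - d))"
| "monomial (Ly # w) = (case monomial w of (a, b, c, d) \<Rightarrow> (- a, - b, 2 * a + c, 2 * b + d))"
| "monomial (Lz # w) = (case monomial w of (a, b, c, d) \<Rightarrow> (a, b, - c, - d))"

lemma monomial_det:
  "monomial w = (a, b, c, d) \<Longrightarrow> a * d - b * c = (- 1) ^ length w"
proof (induction w arbitrary: a b c d)
  case (Cons l w)
  obtain a' b' c' d' where m: "monomial w = (a', b', c', d')" by (metis prod_cases4)
  have "a' * d' - b' * c' = (- 1) ^ length w" by (rule Cons.IH[OF m])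
  then show ?case using Cons.prems m by (cases l) (auto simp: algebra_simps)
qed auto

text \<open>Ping-pong for the monomial action: up to sign, each letter maps the cones of the other two
  letters into its own cone.\<close>

fun in_cone :: "letter \<Rightarrow> int \<Rightarrow> int \<Rightarrow> bool" where
  "in_cone Lz a b \<longleftrightarrow> a \<ge> 0 \<and> b \<ge> 0"
| "in_cone Lx a b \<longleftrightarrow> a + b \<ge> 0 \<and> b \<le> 0"
| "in_cone Ly a b \<longleftrightarrow> a \<le> 0 \<and> a + b \<ge> 0"

fun inside_cone :: "letter \<Rightarrow> int \<Rightarrow> int \<Rightarrow> bool" where
  "inside_cone Lz a b \<longleftrightarrow> a > 0 \<and> b > 0"
| "inside_cone Lx a b \<longleftrightarrow> a + b > 0 \<and> b < 0"
| "inside_cone Ly a b \<longleftrightarrow> a < 0 \<and> a + b > 0"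

fun cone_step1 :: "letter \<Rightarrow> int \<Rightarrow> int \<Rightarrow> int" where
  "cone_step1 Lx a c = a + 2 * c" | "cone_step1 Ly a c = - a" | "cone_step1 Lz a c = a"

fun cone_step2 :: "letter \<Rightarrow> int \<Rightarrow> int \<Rightarrow> int" where
  "cone_step2 Lx a c = - c" | "cone_step2 Ly a c = 2 * a + c" | "cone_step2 Lz a c = - c"

text \<open>The vector (1, 0) lies on the boundary of cones, is fixed by Lx and Lz, and is moved
  into an open cone by Ly; y records whether that has happened. Only the passage from the cone of Ly
  to that of Lz needs a sign. For (0, 1) in the next lemma, Lx plays the role of Ly.\<close>

lemma cone_step_column1:
  fixes a c :: int
  assumes "l \<noteq> h" "in_cone h a c" "if y then inside_cone h a c else a = 1 \<and> c = 0"
  shows "let s = (if l = Lz \<and> h = Ly then - 1 else 1); a' = s * cone_step1 l a c; c' = s * cone_step2 l a c in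
    in_cone l a' c' \<and> (if l = Ly \<or> y then inside_cone l a' c' else a' = 1 \<and> c' = 0)"
  using assms by (cases l; cases h; cases y; simp)

lemma cone_step_column2:
  fixes a c :: int
  assumes "l \<noteq> h" "in_cone h a c" "if y then inside_cone h a c else a = 0 \<and> c = 1"
  shows "let s = (if l = Lz \<and> h = Ly then - 1 else 1); a' = s * cone_step1 l a c; c' = s * cone_step2 l a c in
    in_cone l a' c' \<and> (if l = Lx \<or> y then inside_cone l a' c' else a' = 0 \<and> c' = 1)"
  using assms by (cases l; cases h; cases y; simp)

text \<open>The appended Lz stands for the start of the game: the columns of the identity matrix lie
  in the closed cone of Lz. The sign s must be common to both columns, so that it cancels in
  products of entries.\<close>

lemma monomial_cone:
  assumes "distinct_adj (w @ [Lz])" "monomial w = (a, b, c, d)"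
  shows "\<exists>s\<in>{1, - 1}. in_cone (hd (w @ [Lz])) (s * a) (s * c) \<and> in_cone (hd (w @ [Lz])) (s * b) (s * d)
    \<and> (if Ly \<in> set w then inside_cone (hd (w @ [Lz])) (s * a) (s * c) else s * a = 1 \<and> s * c = 0)
    \<and> (if Lx \<in> set w then inside_cone (hd (w @ [Lz])) (s * b) (s * d) else s * b = 0 \<and> s * d = 1)"
  using assms
proof (induction w arbitrary: a b c d)
  case (Cons l w)
  obtain a' b' c' d' where m: "monomial w = (a', b', c', d')" by (metis prod_cases4)
  have da: "distinct_adj (w @ [Lz])" and ne: "l \<noteq> hd (w @ [Lz])"
    using Cons.prems(1) by (auto simp: distinct_adj_Cons)
  obtain h where h: "hd (w @ [Lz]) = h" by simp
  obtain s where s: "s = 1 \<or> s = - 1" "in_cone h (s * a') (s * c')" "in_cone h (s * b') (s * d')"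
    "if Ly \<in> set w then inside_cone h (s * a') (s * c') else s * a' = 1 \<and> s * c' = 0"
    "if Lx \<in> set w then inside_cone h (s * b') (s * d') else s * b' = 0 \<and> s * d' = 1"
    using Cons.IH[OF da m] unfolding h by blast
  define t where "t = (if l = Lz \<and> h = Ly then - s else s)"
  have t: "t = 1 \<or> t = -1" using s(1) by (auto simp: t_def)
  have lh: "l \<noteq> h" using ne h by simp
  have e: "a = cone_step1 l a' c'" "b = cone_step1 l b' d'" "c = cone_step2 l a' c'" "d = cone_step2 l b' d'"
    using Cons.prems(2) m by (cases l; simp)+
  have ts: "t * cone_step1 l x y = (if l = Lz \<and> h = Ly then - 1 else 1) * cone_step1 l (s * x) (s * y)"
    "t * cone_step2 l x y = (if l = Lz \<and> h = Ly then - 1 else 1) * cone_step2 l (s * x) (s * y)" for x y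
    by (cases l; simp add: t_def algebra_simps)+
  have "in_cone l (t * a) (t * c) \<and> in_cone l (t * b) (t * d)
    \<and> (if Ly \<in> set (l # w) then inside_cone l (t * a) (t * c) else t * a = 1 \<and> t * c = 0)
    \<and> (if Lx \<in> set (l # w) then inside_cone l (t * b) (t * d) else t * b = 0 \<and> t * d = 1)"
  proof -
    have mem: "Ly \<in> set (l # w) \<longleftrightarrow> l = Ly \<or> Ly \<in> set w" "Lx \<in> set (l # w) \<longleftrightarrow> l = Lx \<or> Lx \<in> set w"
      by auto
    show ?thesis
      using cone_step_column1[OF lh s(2,4)] cone_step_column2[OF lh s(3,5)]
      unfolding e ts mem Let_def by blast
  qed
  then show ?case using t by (auto simp only: append_Cons list.sel)
qed auto

text \<open>Ending in the cone of Lz makes all entries positive up to a common sign. Then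
  determinant 1 gives a d = 1 + b c >= 2, so a and d cannot both have absolute value 1.\<close>

lemma monomial_trace:
  assumes w: "distinct_adj w" "hd w = Lz" "last w \<noteq> Lz" "set w = UNIV" "even (length w)"
    and m: "monomial w = (a, b, c, d)"
  shows "\<bar>a + d\<bar> \<ge> 3"
proof -
  have ne: "w \<noteq> []" using w by auto
  have da: "distinct_adj (w @ [Lz])" using w ne by (auto simp: distinct_adj_append_iff)
  have h: "hd (w @ [Lz]) = Lz" using ne w by simp
  have "\<exists>s\<in>{1, - 1}. inside_cone Lz (s * a) (s * c) \<and> inside_cone Lz (s * b) (s * d)"
    using monomial_cone[OF da m] unfolding h w(4) by (simp only: UNIV_I if_True) blast
  then obtain s where s: "s \<in> {1, - 1}" "s * a > 0" "s * c > 0" "s * b > 0" "s * d > 0"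
    unfolding inside_cone.simps by blast
  have det: "a * d - b * c = 1" using monomial_det[OF m] w by simp
  have "(s * b) * (s * c) \<ge> 1" using s by (simp add: mult_pos_pos int_one_le_iff_zero_less)
  then have "a * d \<ge> 2" using det s by auto
  then have "(s * a) * (s * d) \<ge> 2" using s by auto
  moreover have "(s * a) * (s * d) \<le> 1" if "s * a \<le> 1" "s * d \<le> 1"
    using s that by (auto intro: mult_le_one)
  ultimately have "s * a + s * d \<ge> 3" using s by linarith
  then show ?thesis using s by auto
qed

text \<open>The parametrization of the Cayley cubic by the torus; it identifies (u, v) with (1 / u,
  1 / v).\<close>

definition Phi :: "complex \<Rightarrow> complex \<Rightarrow> letter \<Rightarrow> complex" where
  "Phi u v = (\<lambda>l. case l of Lx \<Rightarrow> u + 1 / u | Ly \<Rightarrow> v + 1 / v | Lz \<Rightarrow> - (u * v + 1 / (u * v)))"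

text \<open>\<open>dPhi1\<close> and \<open>dPhi2\<close> are the images of the invariant vector
  fields u d/du and v d/dv, in which a monomial map has its integer matrix as derivative.\<close>

definition dPhi1 :: "complex \<Rightarrow> complex \<Rightarrow> letter \<Rightarrow> complex" where
  "dPhi1 u v = (\<lambda>l. case l of Lx \<Rightarrow> u - 1 / u | Ly \<Rightarrow> 0 | Lz \<Rightarrow> - (u * v - 1 / (u * v)))"

definition dPhi2 :: "complex \<Rightarrow> complex \<Rightarrow> letter \<Rightarrow> complex" where
  "dPhi2 u v = (\<lambda>l. case l of Lx \<Rightarrow> 0 | Ly \<Rightarrow> v - 1 / v | Lz \<Rightarrow> - (u * v - 1 / (u * v)))"

abbreviation zero_par :: "letter \<Rightarrow> complex" where
  "zero_par \<equiv> \<lambda>_. 0"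

lemma vieta_Phi:
  assumes "u \<noteq> 0" "v \<noteq> 0"
  shows "vieta zero_par Lx (Phi u v) = Phi (u * v\<^sup>2) (1 / v)"
    "vieta zero_par Ly (Phi u v) = Phi (1 / u) (u\<^sup>2 * v)"
    "vieta zero_par Lz (Phi u v) = Phi u (1 / v)"
  by (rule ext, rename_tac l, case_tac l; use assms in \<open>simp add: vieta_def Phi_def field_simps power2_eq_square\<close>)+

lemma dvieta_Phi:
  assumes "u \<noteq> 0" "v \<noteq> 0"
  shows "dvieta (Phi u v) Lx (dPhi1 u v) = dPhi1 (u * v\<^sup>2) (1 / v)"
    "dvieta (Phi u v) Lx (dPhi2 u v) = (\<lambda>m. 2 * dPhi1 (u * v\<^sup>2) (1 / v) m - dPhi2 (u * v\<^sup>2) (1 / v) m)"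
    "dvieta (Phi u v) Ly (dPhi1 u v) = (\<lambda>m. - dPhi1 (1 / u) (u\<^sup>2 * v) m + 2 * dPhi2 (1 / u) (u\<^sup>2 * v) m)"
    "dvieta (Phi u v) Ly (dPhi2 u v) = dPhi2 (1 / u) (u\<^sup>2 * v)"
    "dvieta (Phi u v) Lz (dPhi1 u v) = dPhi1 u (1 / v)"
    "dvieta (Phi u v) Lz (dPhi2 u v) = (\<lambda>m. - dPhi2 u (1 / v) m)"
  by (rule ext, rename_tac l, case_tac l; use assms in \<open>simp add: dvieta_def Phi_def dPhi1_def dPhi2_def field_simps power2_eq_square\<close>)+

lemma act_Phi:
  assumes "u \<noteq> 0" "v \<noteq> 0" "monomial w = (a, b, c, d)"
  shows "act zero_par w (Phi u v) = Phi (u powi a * v powi b) (u powi c * v powi d)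
    \<and> dact zero_par w (Phi u v) (dPhi1 u v) = (\<lambda>m. of_int a * dPhi1 (u powi a * v powi b) (u powi c * v powi d) m
        + of_int c * dPhi2 (u powi a * v powi b) (u powi c * v powi d) m)
    \<and> dact zero_par w (Phi u v) (dPhi2 u v) = (\<lambda>m. of_int b * dPhi1 (u powi a * v powi b) (u powi c * v powi d) m
        + of_int d * dPhi2 (u powi a * v powi b) (u powi c * v powi d) m)"
  using assms(3)
proof (induction w arbitrary: a b c d)
  case (Cons l w)
  obtain a' b' c' d' where m: "monomial w = (a', b', c', d')" by (metis prod_cases4)
  define r where "r = u powi a' * v powi b'"
  define s where "s = u powi c' * v powi d'"
  have nz: "r \<noteq> 0" "s \<noteq> 0" using assms by (auto simp: r_def s_def)
  have IH: "act zero_par w (Phi u v) = Phi r s"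
    "dact zero_par w (Phi u v) (dPhi1 u v) = (\<lambda>m. of_int a' * dPhi1 r s m + of_int c' * dPhi2 r s m)"
    "dact zero_par w (Phi u v) (dPhi2 u v) = (\<lambda>m. of_int b' * dPhi1 r s m + of_int d' * dPhi2 r s m)"
    using Cons.IH[OF m] unfolding r_def s_def by auto
  have dbl: "x powi (2 * n) = (x powi n)\<^sup>2" for x :: complex and n
    by (metis mult.commute power_int_mult power_int_numeral)
  have pw: "u powi (a' + 2 * c') * v powi (b' + 2 * d') = r * s\<^sup>2"
    "u powi (- c') * v powi (- d') = 1 / s" "u powi (- a') * v powi (- b') = 1 / r"
    "u powi (2 * a' + c') * v powi (2 * b' + d') = r\<^sup>2 * s"
    using assms by (simp_all add: r_def s_def power_int_add power_int_minus dbl power_mult_distrib divide_inverse)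
  have lin: "dvieta (Phi r s) l (\<lambda>m. k * dPhi1 r s m + n * dPhi2 r s m)
    = (\<lambda>m. k * dvieta (Phi r s) l (dPhi1 r s) m + n * dvieta (Phi r s) l (dPhi2 r s) m)" for k n l
    by (cases l) (auto simp: dvieta_def algebra_simps)
  show ?case
  proof (cases l)
    case Lx
    then have e: "a = a' + 2 * c'" "b = b' + 2 * d'" "c = - c'" "d = - d'" using Cons.prems m by auto
    show ?thesis unfolding e pw Lx act.simps dact.simps IH lin
      using vieta_Phi(1)[OF nz] dvieta_Phi(1,2)[OF nz] by (simp add: algebra_simps)
  next
    case Ly
    then have e: "a = - a'" "b = - b'" "c = 2 * a' + c'" "d = 2 * b' + d'" using Cons.prems m by auto
    show ?thesis unfolding e pw Ly act.simps dact.simps IH lin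
      using vieta_Phi(2)[OF nz] dvieta_Phi(3,4)[OF nz] by (simp add: algebra_simps)
  next
    case Lz
    then have e: "a = a'" "b = b'" "c = - c'" "d = - d'" using Cons.prems m by auto
    have pw1: "u powi a' * v powi b' = r" by (simp add: r_def)
    show ?thesis unfolding e pw pw1 Lz act.simps dact.simps IH lin
      using vieta_Phi(3)[OF nz] dvieta_Phi(5,6)[OF nz] by (simp add: algebra_simps)
  qed
qed (use assms in simp)

text \<open>The cross product of the two tangent vectors is the normal vector, with exactly this
  factor -1.\<close>

lemma det3_dPhi:
  assumes "u \<noteq> 0" "v \<noteq> 0"
  shows "det3 (dPhi1 u v) (dPhi2 u v) e = - pair (grad zero_par (Phi u v)) e"
  using assms by (simp add: det3_def pair_def grad_def Phi_def dPhi1_def dPhi2_def field_simps power2_eq_square)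

text \<open>The trace as a derivation on volume forms. It needs no basis, so it can be used where
  the determinant is infinitesimal.\<close>

lemma trace_det3:
  assumes "\<And>v m. f v m = v Lx * f1 m + v Ly * f2 m + v Lz * f3 m"
  shows "(f1 Lx + f2 Ly + f3 Lz) * det3 u v w = det3 (f u) v w + det3 u (f v) w + det3 u v (f w)"
  unfolding det3_def assms by (simp add: algebra_simps)

text \<open>At the singular points of the Cayley cubic the derivative is the action of the monomial
  matrix on the squares of the linear forms \<open>X\<close>, \<open>Y\<close>, \<open>X + Y\<close>.\<close>

lemma dact_torsion:
  assumes s: "s = 1 \<or> s = - 1" and t: "t = 1 \<or> t = - 1" and m: "monomial w = (a, b, c, d)"
  shows "act zero_par w (Phi s t) = Phi s t \<and>
    s * dact zero_par w (Phi s t) v Lx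
      = of_int (a * a - a * b) * (s * v Lx) + of_int (b * b - a * b) * (t * v Ly) - of_int (a * b) * (s * t * v Lz) \<and>
    t * dact zero_par w (Phi s t) v Ly
      = of_int (c * c - c * d) * (s * v Lx) + of_int (d * d - c * d) * (t * v Ly) - of_int (c * d) * (s * t * v Lz) \<and>
    - (s * t * dact zero_par w (Phi s t) v Lz)
      = of_int ((a + c) * (a + c) - (a + c) * (b + d)) * (s * v Lx)
        + of_int ((b + d) * (b + d) - (a + c) * (b + d)) * (t * v Ly) - of_int ((a + c) * (b + d)) * (s * t * v Lz)"
  using m
proof (induction w arbitrary: a b c d)
  case (Cons l w)
  obtain a' b' c' d' where m: "monomial w = (a', b', c', d')" by (metis prod_cases4)
  have fx: "vieta zero_par l (Phi s t) = Phi s t"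
    by (rule ext, rename_tac l', case_tac l'; cases l; use s t in \<open>auto simp: vieta_def Phi_def\<close>)
  define V where "V = dact zero_par w (Phi s t) v"
  define v1 v2 v3 where "v1 = s * v Lx" and "v2 = t * v Ly" and "v3 = s * t * v Lz"
  define A B C D :: complex where "A = of_int a'" and "B = of_int b'" and "C = of_int c'" and "D = of_int d'"
  note IH = Cons.IH[OF m]
  have st: "s * s = 1" "t * t = 1" using s t by auto
  have V: "s * V Lx = (A * A - A * B) * v1 + (B * B - A * B) * v2 - (A * B) * v3"
    "t * V Ly = (C * C - C * D) * v1 + (D * D - C * D) * v2 - (C * D) * v3"
    "s * t * V Lz = - (((A + C) * (A + C) - (A + C) * (B + D)) * v1 + ((B + D) * (B + D) - (A + C) * (B + D)) * v2 - ((A + C) * (B + D)) * v3)"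
    using IH unfolding V_def v1_def v2_def v3_def A_def B_def C_def D_def
    by (simp_all add: minus_equation_iff[of "s * t * _"])
  have dv: "s * dvieta (Phi s t) Lx V Lx = - (s * V Lx) + 2 * (t * V Ly) - 2 * (s * t * V Lz)"
    "t * dvieta (Phi s t) Ly V Ly = - (t * V Ly) + 2 * (s * V Lx) - 2 * (s * t * V Lz)"
    "s * t * dvieta (Phi s t) Lz V Lz = - (s * t * V Lz) - 2 * (t * V Ly) - 2 * (s * V Lx)"
    using s t by (auto simp: dvieta_def Phi_def algebra_simps)
  have dd: "dvieta (Phi s t) Lx V Ly = V Ly" "dvieta (Phi s t) Lx V Lz = V Lz"
    "dvieta (Phi s t) Ly V Lx = V Lx" "dvieta (Phi s t) Ly V Lz = V Lz"
    "dvieta (Phi s t) Lz V Lx = V Lx" "dvieta (Phi s t) Lz V Ly = V Ly"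
    by (simp_all add: dvieta_def)
  have ac: "act zero_par w (Phi s t) = Phi s t" using IH by blast
  show ?case
  proof (cases l)
    case Lx
    then have e: "a = a' + 2 * c'" "b = b' + 2 * d'" "c = - c'" "d = - d'" using Cons.prems m by auto
    show ?thesis unfolding act.simps dact.simps ac fx V_def[symmetric] v1_def[symmetric] v2_def[symmetric] v3_def[symmetric]
      unfolding e of_int_add of_int_mult of_int_diff of_int_minus of_int_numeral A_def[symmetric] B_def[symmetric] C_def[symmetric] D_def[symmetric]
      unfolding Lx by (intro conjI; simp only: dv dd V; simp add: algebra_simps)
  next
    case Ly
    then have e: "a = - a'" "b = - b'" "c = 2 * a' + c'" "d = 2 * b' + d'" using Cons.prems m by auto
    show ?thesis unfolding act.simps dact.simps ac fx V_def[symmetric] v1_def[symmetric] v2_def[symmetric] v3_def[symmetric]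
      unfolding e of_int_add of_int_mult of_int_diff of_int_minus of_int_numeral A_def[symmetric] B_def[symmetric] C_def[symmetric] D_def[symmetric]
      unfolding Ly by (intro conjI; simp only: dv dd V; simp add: algebra_simps)
  next
    case Lz
    then have e: "a = a'" "b = b'" "c = - c'" "d = - d'" using Cons.prems m by auto
    show ?thesis unfolding act.simps dact.simps ac fx V_def[symmetric] v1_def[symmetric] v2_def[symmetric] v3_def[symmetric]
      unfolding e of_int_add of_int_mult of_int_diff of_int_minus of_int_numeral A_def[symmetric] B_def[symmetric] C_def[symmetric] D_def[symmetric]
      unfolding Lz by (intro conjI; simp only: dv dd V; simp add: algebra_simps)
  qed
qed auto

text \<open>The trace of the symmetric square of M is (tr M)^2 - det M, and here det M = 1.\<close>

lemma dtrace_torsion: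
  assumes s: "s = 1 \<or> s = - 1" and t: "t = 1 \<or> t = - 1" and m: "monomial w = (a, b, c, d)"
    and ev: "even (length w)"
  shows "dtrace zero_par w (Phi s t) = of_int ((a + d)\<^sup>2 - 1)"
proof -
  define V where "V = dact zero_par w (Phi s t)"
  note D = dact_torsion[OF s t m, folded V_def]
  have 1: "V (single Lx) Lx = of_int (a * a - a * b)"
    using D[of "single Lx"] s by (auto simp: single_def)
  have 2: "V (single Ly) Ly = of_int (d * d - c * d)"
    using D[of "single Ly"] t by (auto simp: single_def)
  have 3: "V (single Lz) Lz = of_int ((a + c) * (b + d))"
    using D[of "single Lz"] s t by (auto simp: single_def)
  have "a * a - a * b + (d * d - c * d) + (a + c) * (b + d) = (a + d)\<^sup>2 - 1"
    using monomial_det[OF m] ev by (simp add: algebra_simps power2_eq_square)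
  then show ?thesis unfolding dtrace_def V_def[symmetric] 1 2 3 by (simp only: of_int_add[symmetric])
qed

section \<open>Specialization to the Cayley cubic\<close>

context valuation_ring
begin

text \<open>Equality in the residue field, without passing to a quotient.\<close>

definition cong :: "'a \<Rightarrow> 'a \<Rightarrow> bool" where
  "cong x y \<longleftrightarrow> smaller (x - y) 1"

lemma smaller_one_mem: "smaller x 1 \<Longrightarrow> x \<in> R"
  using mem_iff_atmost smaller_imp_atmost by blast

lemma small_mult: "smaller x 1 \<Longrightarrow> y \<in> R \<Longrightarrow> smaller (x * y) 1"
  using smaller_mult1[of x 1 y 1] by (simp add: mem_iff_atmost)

lemma small_prime: "x \<in> R \<Longrightarrow> y \<in> R \<Longrightarrow> smaller (x * y) 1 \<Longrightarrow> smaller x 1 \<or> smaller y 1"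
  using atmost_mult[of 1 x 1 y] by (auto simp: smaller_iff)

lemma small_zero [simp]: "smaller 0 1"
  by (simp add: smaller_def)

lemma cong_refl [simp]: "cong x x" by (simp add: cong_def)
lemma cong_sym: "cong x y \<Longrightarrow> cong y x"
  unfolding cong_def using smaller_uminus by fastforce
lemma cong_trans: "cong x y \<Longrightarrow> cong y z \<Longrightarrow> cong x z"
  unfolding cong_def using smaller_add by fastforce
lemma cong_add: "cong x x' \<Longrightarrow> cong y y' \<Longrightarrow> cong (x + y) (x' + y')"
  unfolding cong_def using smaller_add[of "x - x'" 1 "y - y'"] by (simp add: algebra_simps)
lemma cong_uminus: "cong x x' \<Longrightarrow> cong (- x) (- x')"
  unfolding cong_def using smaller_uminus[of "x - x'"] by simp
lemma cong_diff: "cong x x' \<Longrightarrow> cong y y' \<Longrightarrow> cong (x - y) (x' - y')"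
  using cong_add[of x x' "- y" "- y'"] cong_uminus by simp
lemma cong_mem: "cong x y \<Longrightarrow> x \<in> R \<Longrightarrow> y \<in> R"
  using diff_mem[of x "x - y"] smaller_one_mem[of "x - y"] unfolding cong_def by simp
lemma cong_mult: 
  assumes "cong x x'" "cong y y'" "x \<in> R" "y \<in> R"
  shows "cong (x * y) (x' * y')"
proof -
  have "x' \<in> R" using cong_mem assms by blast
  have "x * y - x' * y' = (x - x') * y + (y - y') * x'" by (simp add: algebra_simps)
  then show ?thesis using small_mult assms \<open>x' \<in> R\<close> smaller_add unfolding cong_def by metis
qed
lemma cong_small: "cong x 0 \<longleftrightarrow> smaller x 1"
  by (simp add: cong_def)

lemma act_cong:
  assumes "\<And>l. cong (a l) (a' l)" "\<And>l. a l \<in> R" "\<And>l. cong (p l) (p' l)" "\<And>l. p l \<in> R"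
  shows "cong (act a w p m) (act a' w p' m)"
proof (induction w arbitrary: m)
  case (Cons l w)
  show ?case unfolding act.simps vieta_def
    by (auto intro!: cong_diff cong_mult Cons assms act_mem)
qed (use assms in simp)

lemma dact_cong:
  assumes "\<And>l. cong (a l) (a' l)" "\<And>l. a l \<in> R" "\<And>l. cong (p l) (p' l)" "\<And>l. p l \<in> R"
    "\<And>l. v l \<in> R"
  shows "cong (dact a w p v m) (dact a' w p' v m)"
proof (induction w arbitrary: m)
  case (Cons l w)
  show ?case unfolding dact.simps dvieta_def
    by (auto intro!: cong_diff cong_uminus cong_mult Cons assms act_mem dact_mem act_cong)
qed simp

lemma dtrace_cong:
  assumes "\<And>l. cong (a l) (a' l)" "\<And>l. a l \<in> R" "\<And>l. cong (p l) (p' l)" "\<And>l. p l \<in> R"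
  shows "cong (dtrace a w p) (dtrace a' w p')"
  unfolding dtrace_def by (intro cong_add dact_cong assms) (auto simp: single_def)

text \<open>One of u and \<open>1 / u\<close> is finite, and then so is the other as the difference
  from the sum.\<close>

lemma joukowski_mem:
  assumes "u \<noteq> 0" "u + 1 / u \<in> R"
  shows "u \<in> R" "1 / u \<in> R"
proof -
  have "1 / u \<in> R" if "u \<in> R" using diff_mem[OF assms(2) that] by simp
  moreover have "u \<in> R" if "1 / u \<in> R" using diff_mem[OF assms(2) that] by simp
  ultimately show "u \<in> R" "1 / u \<in> R" using total[of u] by (auto simp: inverse_eq_divide)
qed

lemma joukowski_cong:
  assumes "u \<noteq> 0" "v \<noteq> 0" "u \<in> R" "v \<in> R" "1 / v \<in> R" and c: "cong (u + 1 / u) (v + 1 / v)"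
  shows "cong u v \<or> cong u (1 / v)"
proof -
  have "(u - v) * (u - 1 / v) = ((u + 1 / u) - (v + 1 / v)) * u"
    using assms by (simp add: field_simps power2_eq_square)
  then have "smaller ((u - v) * (u - 1 / v)) 1" using small_mult c assms unfolding cong_def by metis
  then show ?thesis unfolding cong_def using small_prime assms by blast
qed

lemma cong_recip:
  assumes "cong x y" "x \<noteq> 0" "y \<noteq> 0" "1 / x \<in> R" "1 / y \<in> R"
  shows "cong (1 / x) (1 / y)"
proof -
  have "1 / x - 1 / y = - ((x - y) * (1 / x * (1 / y)))"
    using assms by (simp add: field_simps)
  moreover have "smaller ((x - y) * (1 / x * (1 / y))) 1"
    using assms by (intro small_mult mult_mem) (auto simp: cong_def)
  ultimately show ?thesis unfolding cong_def using smaller_uminus by metis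
qed

lemma cong_cancel: "cong (x * u) (y * u) \<Longrightarrow> u \<noteq> 0 \<Longrightarrow> 1 / u \<in> R \<Longrightarrow> cong x y"
  unfolding cong_def left_diff_distrib[symmetric]
  using small_mult[of "(x - y) * u" "1 / u"] by simp

end

section \<open>Reduction of fixed points to the Cayley cubic at a place\<close>

lemma joukowski_exists: "\<exists>u. u \<noteq> 0 \<and> x = u + 1 / (u :: complex)"
proof -
  define u where "u = (x + csqrt (x\<^sup>2 - 4)) / 2"
  have "u * (x - u) = (x\<^sup>2 - (csqrt (x\<^sup>2 - 4))\<^sup>2) / 4"
    unfolding u_def by (simp add: field_simps power2_eq_square del: power2_csqrt)
  then have e: "u * (x - u) = 1" by simp
  then have "u \<noteq> 0" by auto
  then show ?thesis using e by (intro exI[of _ u]) (simp add: field_simps)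
qed

locale complex_valuation_ring = valuation_ring R for R :: "complex set"
begin

text \<open>The first two coordinates determine u and v up to separate inversions. The third allows
  a mixed choice only if u or v is congruent to its own inverse, and then the choice is not really
  mixed.\<close>

lemma Phi_cong:
  assumes nz: "u \<noteq> 0" "v \<noteq> 0" "u' \<noteq> 0" "v' \<noteq> 0"
    and mem: "u \<in> R" "v \<in> R" "u' \<in> R" "v' \<in> R" "1 / u \<in> R" "1 / v \<in> R" "1 / u' \<in> R" "1 / v' \<in> R"
    and c: "\<And>l. cong (Phi u' v' l) (Phi u v l)"
  shows "cong u' u \<and> cong v' v \<or> cong u' (1 / u) \<and> cong v' (1 / v)"
proof -
  have uv: "1 / (u * v) \<in> R" using mult_mem[OF mem(5,6)] by simp
  have 1: "cong u' u \<or> cong u' (1 / u)"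
    using c[of Lx] by (intro joukowski_cong nz mem) (simp add: Phi_def)
  have 2: "cong v' v \<or> cong v' (1 / v)"
    using c[of Ly] by (intro joukowski_cong nz mem) (simp add: Phi_def)
  have 3: "cong (u' * v') (u * v) \<or> cong (u' * v') (1 / (u * v))"
    using cong_uminus[OF c[of Lz]]
    by (intro joukowski_cong mult_mem nz mem uv) (use nz in \<open>simp_all add: Phi_def add.commute\<close>)
  consider "cong u' u" "cong v' (1 / v)" | "cong u' (1 / u)" "cong v' v"
    | "cong u' u \<and> cong v' v \<or> cong u' (1 / u) \<and> cong v' (1 / v)" using 1 2 by blast
  then show ?thesis
  proof cases
    case 1
    then have p: "cong (u' * v') (u * (1 / v))" using mem by (intro cong_mult) auto
    from 3 show ?thesis
    proof
      assume "cong (u' * v') (u * v)"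
      then have "cong (u * (1 / v)) (u * v)" using p cong_sym cong_trans by blast
      then have "cong ((1 / v) * u) (v * u)" by (simp only: mult.commute)
      then have "cong (1 / v) v" using cong_cancel nz mem by blast
      then show ?thesis using 1 cong_trans by blast
    next
      assume "cong (u' * v') (1 / (u * v))"
      then have "cong (u * (1 / v)) (1 / (u * v))" using p cong_sym cong_trans by blast
      then have "cong (u * (1 / v)) ((1 / u) * (1 / v))" by simp
      then have "cong u (1 / u)" using cong_cancel[of u "1 / v" "1 / u"] nz mem by simp
      then show ?thesis using 1 cong_trans by blast
    qed
  next
    case 2
    then have p: "cong (u' * v') ((1 / u) * v)" using mem by (intro cong_mult) auto
    from 3 show ?thesis
    proof
      assume "cong (u' * v') (u * v)"
      then have "cong ((1 / u) * v) (u * v)" using p cong_sym cong_trans by blast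
      then have "cong (1 / u) u" using cong_cancel nz mem by blast
      then show ?thesis using 2 cong_trans by blast
    next
      assume "cong (u' * v') (1 / (u * v))"
      then have "cong ((1 / u) * v) (1 / (u * v))" using p cong_sym cong_trans by blast
      then have "cong (v * (1 / u)) ((1 / v) * (1 / u))" by (simp add: mult.commute)
      then have "cong v (1 / v)" using cong_cancel[of v "1 / u" "1 / v"] nz mem by simp
      then show ?thesis using 2 cong_trans by blast
    qed
  next
    case 3
    then show ?thesis .
  qed
qed

lemma unit_powi_mem: "u \<in> R \<Longrightarrow> 1 / u \<in> R \<Longrightarrow> u powi n \<in> R"
  by (auto simp: power_int_def inverse_eq_divide)

text \<open>The first two coordinates are parametrized exactly. As a polynomial in the third, the
  equation of the Cayley cubic splits into two linear factors, exchanged by inverting v; one of them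
  must be infinitesimal.\<close>

lemma Phi_exists:
  assumes p: "\<And>l. p l \<in> R" and c: "cong (cubic zero_par p) 4"
  obtains u v where "u \<noteq> 0" "v \<noteq> 0" "u \<in> R" "v \<in> R" "1 / u \<in> R" "1 / v \<in> R" "\<And>l. cong (p l) (Phi u v l)"
proof -
  obtain u where u: "u \<noteq> 0" "p Lx = u + 1 / u" using joukowski_exists by blast
  obtain v where v: "v \<noteq> 0" "p Ly = v + 1 / v" using joukowski_exists by blast
  have um: "u \<in> R" "1 / u \<in> R" using joukowski_mem[OF u(1)] p[of Lx] u(2) by auto
  have vm: "v \<in> R" "1 / v \<in> R" using joukowski_mem[OF v(1)] p[of Ly] v(2) by auto
  let ?f = "p Lz + (u * v + 1 / u * (1 / v))" and ?g = "p Lz + (u * (1 / v) + 1 / u * v)"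
  have "cubic zero_par p - 4 = ?f * ?g"
    unfolding cubic_def u(2) v(2) using u(1) v(1) by (simp add: field_simps power2_eq_square)
  then have "smaller (?f * ?g) 1" using c unfolding cong_def by simp
  then consider "smaller ?f 1" | "smaller ?g 1"
    using small_prime[of ?f ?g] um vm p by blast
  then show ?thesis
  proof cases
    case 1
    have "cong (p l) (Phi u v l)" for l
    proof (cases l)
      case Lz
      have *: "p Lz - Phi u v Lz = ?f" by (simp add: Phi_def)
      show ?thesis using 1 unfolding cong_def Lz * .
    qed (use u v in \<open>auto simp: Phi_def cong_def\<close>)
    then show ?thesis using that u(1) v(1) um vm by blast
  next
    case 2
    have "cong (p l) (Phi u (1 / v) l)" for l
    proof (cases l)
      case Lz
      have *: "p Lz - Phi u (1 / v) Lz = ?g" by (simp add: Phi_def)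
      show ?thesis using 2 unfolding cong_def Lz * .
    qed (use u v in \<open>auto simp: Phi_def cong_def\<close>)
    moreover have "1 / (1 / v) \<in> R" using vm by simp
    ultimately show ?thesis using that[of u "1 / v"] u(1) v(1) um vm by simp
  qed
qed

lemma cong_sign: 
  assumes "u \<noteq> 0" "u \<in> R" "cong u (1 / u)"
  obtains s where "s = 1 \<or> s = - 1" "cong u s"
proof -
  have "(u - 1 / u) * u = (u - 1) * (u - - 1)" using assms by (simp add: field_simps)
  then have "smaller ((u - 1) * (u - - 1)) 1" using small_mult assms unfolding cong_def by metis
  then have "cong u 1 \<or> cong u (- 1)" unfolding cong_def
    by (intro small_prime) (auto intro: assms)
  then show ?thesis using that by blast
qed

theorem dtrace_picard:
  assumes a: "\<And>l. cong (a l) 0" and p: "\<And>l. p l \<in> R" and D: "cong (cubic a p) 4"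
    and fx: "act a w p = p" and ev: "even (length w)" and m: "monomial w = (\<alpha>, \<beta>, \<gamma>, \<delta>)"
  shows "\<exists>n\<in>{1 + (\<alpha> + \<delta>), 1 - (\<alpha> + \<delta>), (\<alpha> + \<delta>)\<^sup>2 - 1}. cong (dtrace a w p) (of_int n)"
proof -
  have am: "a l \<in> R" for l using a smaller_one_mem cong_small by blast
  have "cong (cubic a p) (cubic zero_par p)"
    unfolding cubic_def power2_eq_square
    by (intro cong_add cong_diff cong_mult cong_refl p a am mult_mem)
  then have c4: "cong (cubic zero_par p) 4" using D cong_sym cong_trans by blast
  obtain u v where nz: "u \<noteq> 0" "v \<noteq> 0" and mem: "u \<in> R" "v \<in> R" "1 / u \<in> R" "1 / v \<in> R"
    and pc: "\<And>l. cong (p l) (Phi u v l)" by (rule Phi_exists[of p, OF p c4]) (rule that)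
  let ?q = "Phi u v"
  have qm: "?q l \<in> R" for l using cong_mem[OF pc p] .
  have T: "cong (dtrace a w p) (dtrace zero_par w ?q)"
    by (rule dtrace_cong) (use a am pc p in auto)
  define u' v' where "u' = u powi \<alpha> * v powi \<beta>" and "v' = u powi \<gamma> * v powi \<delta>"
  have nz': "u' \<noteq> 0" "v' \<noteq> 0" using nz by (auto simp: u'_def v'_def)
  have inv: "1 / u' = (1 / u) powi \<alpha> * (1 / v) powi \<beta>" "1 / v' = (1 / u) powi \<gamma> * (1 / v) powi \<delta>"
    unfolding u'_def v'_def by (simp_all add: power_int_divide_distrib)
  have mem': "u' \<in> R" "v' \<in> R" "1 / u' \<in> R" "1 / v' \<in> R"
    unfolding inv unfolding u'_def v'_def using mem by (auto intro!: mult_mem unit_powi_mem)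
  have A: "act zero_par w ?q = Phi u' v'"
    "dact zero_par w ?q (dPhi1 u v) = (\<lambda>m. of_int \<alpha> * dPhi1 u' v' m + of_int \<gamma> * dPhi2 u' v' m)"
    "dact zero_par w ?q (dPhi2 u v) = (\<lambda>m. of_int \<beta> * dPhi1 u' v' m + of_int \<delta> * dPhi2 u' v' m)"
    using act_Phi[OF nz m] unfolding u'_def v'_def by auto
  have q'q: "cong (Phi u' v' l) (?q l)" for l
  proof -
    have "cong (act a w p l) (act zero_par w ?q l)" by (rule act_cong) (use a am pc p in auto)
    then show ?thesis unfolding fx A using pc cong_sym cong_trans by blast
  qed
  \<comment> \<open>The fixed point lifts to a pair (u, v) that the monomial map fixes or inverts
    modulo the maximal ideal. Inversion changes the sign of both invariant vector fields.\<close>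
  have "\<exists>s\<in>{1, - 1 :: int}. \<forall>l. cong (dPhi1 u' v' l) (of_int s * dPhi1 u v l) \<and> cong (dPhi2 u' v' l) (of_int s * dPhi2 u v l)"
  proof -
    consider "cong u' u" "cong v' v" | "cong u' (1 / u)" "cong v' (1 / v)"
      using Phi_cong[OF nz nz' mem(1,2) mem'(1,2) mem(3,4) mem'(3,4) q'q] by blast
    then show ?thesis
    proof cases
      case 1
      have i: "cong (1 / u') (1 / u)"
        by (intro cong_recip 1 nz nz' mem mem')
      have j: "cong (1 / v') (1 / v)"
        by (intro cong_recip 1 nz nz' mem mem')
      have "cong (dPhi1 u' v' l) (dPhi1 u v l) \<and> cong (dPhi2 u' v' l) (dPhi2 u v l)" for l
      proof -
        have "cong (u' * v' - 1 / u' * (1 / v')) (u * v - 1 / u * (1 / v))"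
          by (intro cong_diff cong_mult 1 i j mem')
        then have "cong (u' * v' - 1 / (u' * v')) (u * v - 1 / (u * v))" by simp
        from cong_uminus[OF this] cong_diff[OF 1(1) i] cong_diff[OF 1(2) j] show ?thesis
          by (cases l) (auto simp: dPhi1_def dPhi2_def)
      qed
      then show ?thesis by (intro bexI[of _ 1]) auto
    next
      case 2
      have i: "cong (1 / u') u"
        using cong_recip[OF 2(1)] nz nz' mem mem' by simp
      have j: "cong (1 / v') v"
        using cong_recip[OF 2(2)] nz nz' mem mem' by simp
      have "cong (dPhi1 u' v' l) (- dPhi1 u v l) \<and> cong (dPhi2 u' v' l) (- dPhi2 u v l)" for l
      proof -
        have *: "cong (x - y) (- (x' - y'))" if "cong x y'" "cong y x'" for x y x' y'
          using cong_diff[OF that] by simp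
        have "cong (u' * v' - 1 / u' * (1 / v')) (- (u * v - 1 / u * (1 / v)))"
          by (intro * cong_mult 2 i j mem')
        then have "cong (u' * v' - 1 / (u' * v')) (- (u * v - 1 / (u * v)))" by simp
        from cong_uminus[OF this] *[OF 2(1) i] *[OF 2(2) j] show ?thesis
          by (cases l) (auto simp: dPhi1_def dPhi2_def)
      qed
      then show ?thesis by (intro bexI[of _ "- 1"]) auto
    qed
  qed
  then obtain s where s: "s \<in> {1, - 1 :: int}"
    and d: "\<And>l. cong (dPhi1 u' v' l) (of_int s * dPhi1 u v l)" "\<And>l. cong (dPhi2 u' v' l) (of_int s * dPhi2 u v l)"
    by blast
  have E: "dPhi1 u v l \<in> R" "dPhi2 u v l \<in> R" for l
    using mem mult_mem[OF mem(3,4)] by (cases l; auto simp: dPhi1_def dPhi2_def)+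
  have E': "dPhi1 u' v' l \<in> R" "dPhi2 u' v' l \<in> R" for l
    using mem' mult_mem[OF mem'(3,4)] by (cases l; auto simp: dPhi1_def dPhi2_def)+
  define N where "N = dact zero_par w ?q"
  have NE1: "cong (N (dPhi1 u v) l) (of_int s * (of_int \<alpha> * dPhi1 u v l + of_int \<gamma> * dPhi2 u v l))" for l
  proof -
    have "cong (N (dPhi1 u v) l) (of_int \<alpha> * (of_int s * dPhi1 u v l) + of_int \<gamma> * (of_int s * dPhi2 u v l))"
      unfolding N_def A by (intro cong_add cong_mult d cong_refl of_int_mem E')
    then show ?thesis by (simp add: algebra_simps)
  qed
  have NE2: "cong (N (dPhi2 u v) l) (of_int s * (of_int \<beta> * dPhi1 u v l + of_int \<delta> * dPhi2 u v l))" for l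
  proof -
    have "cong (N (dPhi2 u v) l) (of_int \<beta> * (of_int s * dPhi1 u v l) + of_int \<delta> * (of_int s * dPhi2 u v l))"
      unfolding N_def A by (intro cong_add cong_mult d cong_refl of_int_mem E')
    then show ?thesis by (simp add: algebra_simps)
  qed
  have Nm: "N x l \<in> R" if "\<And>l. x l \<in> R" for x l unfolding N_def by (rule dact_mem) (use qm that in auto)
  have det_cong: "cong (det3 x y z) (det3 x' y' z')"
    if "\<And>l. cong (x l) (x' l)" "\<And>l. cong (y l) (y' l)" "\<And>l. cong (z l) (z' l)"
      "\<And>l. x l \<in> R" "\<And>l. y l \<in> R" "\<And>l. z l \<in> R" for x y z x' y' z'
    unfolding det3_def by (intro cong_add cong_diff cong_mult that mult_mem diff_mem)
  let ?T = "dtrace zero_par w ?q" and ?\<tau> = "of_int s * (of_int \<alpha> + of_int \<delta>) :: complex"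
  \<comment> \<open>The derivative acts on the span of \<open>dPhi1\<close> and \<open>dPhi2\<close>
    as s times the integer matrix, and modulo this span as 1, because the gradient is invariant.
    Everything stays multiplied by the determinant, which may vanish in the residue field.\<close>
  have key: "cong (?T * det3 (dPhi1 u v) (dPhi2 u v) e) ((?\<tau> + 1) * det3 (dPhi1 u v) (dPhi2 u v) e)"
    if e: "\<And>l. e l \<in> R" for e
  proof -
    let ?E1 = "dPhi1 u v" and ?E2 = "dPhi2 u v"
    have "?T * det3 ?E1 ?E2 e = det3 (N ?E1) ?E2 e + det3 ?E1 (N ?E2) e + det3 ?E1 ?E2 (N e)"
      unfolding dtrace_def N_def by (rule trace_det3) (rule dact_expand)
    moreover have "cong (det3 (N ?E1) ?E2 e) (of_int s * of_int \<alpha> * det3 ?E1 ?E2 e)"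
    proof -
      have "cong (det3 (N ?E1) ?E2 e) (det3 (\<lambda>l. of_int s * (of_int \<alpha> * ?E1 l + of_int \<gamma> * ?E2 l)) ?E2 e)"
        by (intro det_cong NE1 cong_refl Nm E e)
      then show ?thesis by (simp add: det3_def algebra_simps)
    qed
    moreover have "cong (det3 ?E1 (N ?E2) e) (of_int s * of_int \<delta> * det3 ?E1 ?E2 e)"
    proof -
      have "cong (det3 ?E1 (N ?E2) e) (det3 ?E1 (\<lambda>l. of_int s * (of_int \<beta> * ?E1 l + of_int \<delta> * ?E2 l)) e)"
        by (intro det_cong NE2 cong_refl Nm E e)
      then show ?thesis by (simp add: det3_def algebra_simps)
    qed
    moreover have "cong (det3 ?E1 ?E2 (N e)) (det3 ?E1 ?E2 e)"
    proof -
      have "cong (pair (grad zero_par ?q) (N e)) (pair (grad zero_par (Phi u' v')) (N e))"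
        unfolding pair_def grad_def
        by (intro cong_add cong_diff cong_mult cong_refl cong_sym[OF q'q] qm Nm e mult_mem add_mem diff_mem numeral_mem zero_mem)
      then have "cong (pair (grad zero_par ?q) (N e)) (pair (grad zero_par ?q) e)"
        unfolding N_def using pair_grad_dact[of zero_par w ?q e] A(1) by simp
      then show ?thesis unfolding det3_dPhi[OF nz] by (rule cong_uminus)
    qed
    ultimately have "cong (?T * det3 ?E1 ?E2 e)
      (of_int s * of_int \<alpha> * det3 ?E1 ?E2 e + of_int s * of_int \<delta> * det3 ?E1 ?E2 e + det3 ?E1 ?E2 e)"
      by (metis cong_add)
    then show ?thesis by (simp add: algebra_simps)
  qed
  have Tm: "?T \<in> R" by (rule dtrace_mem) (use qm in auto)
  show ?thesis
  proof (cases "cong ?T (?\<tau> + 1)")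
    case True
    then have "cong (dtrace a w p) (?\<tau> + 1)" using T cong_trans by blast
    then have "cong (dtrace a w p) (of_int (1 + s * (\<alpha> + \<delta>)))" by (simp add: add.commute)
    moreover have "1 + s * (\<alpha> + \<delta>) \<in> {1 + (\<alpha> + \<delta>), 1 - (\<alpha> + \<delta>), (\<alpha> + \<delta>)\<^sup>2 - 1}" using s by auto
    ultimately show ?thesis by blast
  next
    case False
    \<comment> \<open>In the remaining case the normal vector vanishes in the residue field: the
      point reduces to a singular point of the Cayley cubic, where \<open>dtrace_torsion\<close>
      applies.\<close>
    have sm: "smaller (det3 (dPhi1 u v) (dPhi2 u v) (single l)) 1" for l
    proof -
      have e: "single l m \<in> R" for m :: letter by (simp add: single_def)
      have "smaller ((?T - (?\<tau> + 1)) * det3 (dPhi1 u v) (dPhi2 u v) (single l)) 1"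
        using key[of "single l", OF e] unfolding cong_def by (simp add: left_diff_distrib)
      moreover have "det3 (dPhi1 u v) (dPhi2 u v) (single l) \<in> R"
        unfolding det3_def by (intro add_mem diff_mem mult_mem E e)
      moreover have "?T - (?\<tau> + 1) \<in> R"
        by (intro diff_mem add_mem mult_mem Tm of_int_mem one_mem)
      ultimately show ?thesis using small_prime[of "?T - (?\<tau> + 1)"] False unfolding cong_def by blast
    qed
    define x y z where "x = u - 1 / u" and "y = v - 1 / v" and "z = u * v - 1 / u * (1 / v)"
    have xyz: "x \<in> R" "y \<in> R" "z \<in> R" unfolding x_def y_def z_def using mem by blast+
    have "det3 (dPhi1 u v) (dPhi2 u v) (single Lx) = z * y"
      "det3 (dPhi1 u v) (dPhi2 u v) (single Ly) = z * x"
      "det3 (dPhi1 u v) (dPhi2 u v) (single Lz) = x * y"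
      using nz by (simp_all add: det3_def single_def dPhi1_def dPhi2_def x_def y_def z_def field_simps)
    then have "smaller (z * y) 1" "smaller (z * x) 1" "smaller (x * y) 1"
      using sm[of Lx] sm[of Ly] sm[of Lz] by simp_all
    \<comment> \<open>The pairwise products of x, y, z are infinitesimal, so at most one of the
      three is not; the relations below then force x and y to be infinitesimal in every
      case.\<close>
    then have two: "smaller x 1 \<and> smaller y 1 \<or> smaller y 1 \<and> smaller z 1 \<or> smaller x 1 \<and> smaller z 1"
      using small_prime xyz by blast
    have "smaller x 1 \<and> smaller y 1"
    proof -
      have "x * v = z - (1 / u) * y" "y * u = z - (1 / v) * x"
        unfolding x_def y_def z_def using nz by (simp_all add: field_simps)
      then have "smaller (x * v) 1" if "smaller z 1" "smaller y 1"
        using that small_mult[of y "1 / u"] smaller_diff mem by (metis mult.commute)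
      moreover have "smaller (y * u) 1" if "smaller z 1" "smaller x 1"
        using that small_mult[of x "1 / v"] smaller_diff mem \<open>y * u = z - (1 / v) * x\<close> by (metis mult.commute)
      moreover have "smaller x 1" if "smaller (x * v) 1" using small_mult[OF that mem(4)] nz by simp
      moreover have "smaller y 1" if "smaller (y * u) 1" using small_mult[OF that mem(3)] nz by simp
      ultimately show ?thesis using two by blast
    qed
    then have c2: "cong u (1 / u)" "cong v (1 / v)" unfolding cong_def x_def y_def by auto
    obtain s where s: "s = 1 \<or> s = - 1" "cong u s" using cong_sign[OF nz(1) mem(1) c2(1)] .
    obtain t where t: "t = 1 \<or> t = - 1" "cong v t" using cong_sign[OF nz(2) mem(2) c2(2)] .
    have i: "cong (1 / u) (1 / s)" "cong (1 / v) (1 / t)"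
      using s t c2 cong_sym cong_trans by (metis div_by_1 divide_minus1 minus_divide_right)+
    have "cong (?q l) (Phi s t l)" for l
    proof -
      have "cong (u * v + 1 / u * (1 / v)) (s * t + 1 / s * (1 / t))"
        by (intro cong_add cong_mult s t i mem)
      from cong_uminus[OF this] show ?thesis
        using cong_add[OF s(2) i(1)] cong_add[OF t(2) i(2)] by (cases l) (auto simp: Phi_def)
    qed
    then have "cong ?T (dtrace zero_par w (Phi s t))"
      by (intro dtrace_cong) (use qm in auto)
    then have "cong (dtrace a w p) (of_int ((\<alpha> + \<delta>)\<^sup>2 - 1))"
      unfolding dtrace_torsion[OF s(1) t(1) m ev] using T cong_trans by blast
    then show ?thesis by blast
  qed
qed

end

section \<open>Generic parameters\<close>

text \<open>Rational polynomials as syntax: the type is countable, and one expression can be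
  evaluated both at the generic parameters and at any specialization.\<close>

datatype poly_expr = Cst rat | Var nat | Add poly_expr poly_expr | Mul poly_expr poly_expr

instance poly_expr :: countable
  by countable_datatype

primrec peval :: "poly_expr \<Rightarrow> (nat \<Rightarrow> 'a::field_char_0) \<Rightarrow> 'a" where
  "peval (Cst q) x = of_rat q"
| "peval (Var i) x = x i"
| "peval (Add e f) x = peval e x + peval f x"
| "peval (Mul e f) x = peval e x * peval f x"

primrec psubst :: "(nat \<Rightarrow> poly_expr) \<Rightarrow> poly_expr \<Rightarrow> poly_expr" where
  "psubst g (Cst q) = Cst q"
| "psubst g (Var i) = g i"
| "psubst g (Add e f) = Add (psubst g e) (psubst g f)"
| "psubst g (Mul e f) = Mul (psubst g e) (psubst g f)"

primrec ppow :: "poly_expr \<Rightarrow> nat \<Rightarrow> poly_expr" where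
  "ppow e 0 = Cst 1"
| "ppow e (Suc n) = Mul e (ppow e n)"

lemma peval_psubst: "peval (psubst g e) x = peval e (\<lambda>i. peval (g i) x)"
  by (induction e) auto

lemma peval_ppow: "peval (ppow e n) x = peval e x ^ n"
  by (induction n) auto

lemma rat_subring_eval: "rat_subring {peval e y | e. True}"
  unfolding rat_subring_def
proof (intro conjI allI ballI)
  fix q show "of_rat q \<in> {peval e y | e. True}" by (auto intro: exI[of _ "Cst q"])
next
  fix u v assume "u \<in> {peval e y | e. True}" "v \<in> {peval e y | e. True}"
  then obtain e f where "u = peval e y" "v = peval f y" by auto
  then show "u + v \<in> {peval e y | e. True}" "u * v \<in> {peval e y | e. True}"
    by (auto intro: exI[of _ "Add e f"] exI[of _ "Mul e f"])
qed

lemma peval_univariate: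
  assumes "\<And>i. \<exists>q. \<forall>t. \<xi> t i = poly q t"
  shows "\<exists>q. \<forall>t. peval e (\<xi> t) = poly q t"
proof (induction e)
  case (Cst c)
  then show ?case by (intro exI[of _ "[:of_rat c:]"]) simp
next
  case (Var i)
  then show ?case using assms by simp
next
  case (Add e f)
  then obtain q r where "\<forall>t. peval e (\<xi> t) = poly q t" "\<forall>t. peval f (\<xi> t) = poly r t" by blast
  then show ?case by (intro exI[of _ "q + r"]) simp
next
  case (Mul e f)
  then obtain q r where "\<forall>t. peval e (\<xi> t) = poly q t" "\<forall>t. peval f (\<xi> t) = poly r t" by blast
  then show ?case by (intro exI[of _ "q * r"]) simp
qed

text \<open>N and f do not depend on x, so an identity between fractions at one point becomes a
  polynomial identity that can be moved to other points.\<close>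

lemma clear_denominators:
  "\<exists>N f. \<forall>x :: nat \<Rightarrow> 'a::field_char_0. peval d x \<noteq> 0 \<longrightarrow>
     peval e (\<lambda>i. peval (g i) x / peval d x) * peval d x ^ N = peval f x"
proof (induction e)
  case (Cst q)
  show ?case by (intro exI[of _ 0] exI[of _ "Cst q"]) simp
next
  case (Var i)
  show ?case by (intro exI[of _ 1] exI[of _ "g i"]) simp
next
  case (Add e e')
  then obtain N f M h where fh:
    "\<forall>x :: nat \<Rightarrow> 'a. peval d x \<noteq> 0 \<longrightarrow> peval e (\<lambda>i. peval (g i) x / peval d x) * peval d x ^ N = peval f x"
    "\<forall>x :: nat \<Rightarrow> 'a. peval d x \<noteq> 0 \<longrightarrow> peval e' (\<lambda>i. peval (g i) x / peval d x) * peval d x ^ M = peval h x"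
    by blast
  have "peval (Add e e') (\<lambda>i. peval (g i) x / peval d x) * peval d x ^ (N + M)
      = peval (Add (Mul f (ppow d M)) (Mul h (ppow d N))) x"
    if "peval d x \<noteq> 0" for x :: "nat \<Rightarrow> 'a"
  proof -
    let ?y = "\<lambda>i. peval (g i) x / peval d x"
    have "peval (Add e e') ?y * peval d x ^ (N + M)
      = (peval e ?y * peval d x ^ N) * peval d x ^ M + (peval e' ?y * peval d x ^ M) * peval d x ^ N"
      by (simp add: power_add algebra_simps)
    then show ?thesis using fh that by (simp add: peval_ppow)
  qed
  then show ?case by blast
next
  case (Mul e e')
  then obtain N f M h where fh:
    "\<forall>x :: nat \<Rightarrow> 'a. peval d x \<noteq> 0 \<longrightarrow> peval e (\<lambda>i. peval (g i) x / peval d x) * peval d x ^ N = peval f x"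
    "\<forall>x :: nat \<Rightarrow> 'a. peval d x \<noteq> 0 \<longrightarrow> peval e' (\<lambda>i. peval (g i) x / peval d x) * peval d x ^ M = peval h x"
    by blast
  have "peval (Mul e e') (\<lambda>i. peval (g i) x / peval d x) * peval d x ^ (N + M) = peval (Mul f h) x"
    if "peval d x \<noteq> 0" for x :: "nat \<Rightarrow> 'a"
  proof -
    let ?y = "\<lambda>i. peval (g i) x / peval d x"
    have "peval (Mul e e') ?y * peval d x ^ (N + M) = (peval e ?y * peval d x ^ N) * (peval e' ?y * peval d x ^ M)"
      by (simp add: power_add mult_ac)
    then show ?thesis using fh that by simp
  qed
  then show ?case by blast
qed

lemma poly_real_zeros:
  assumes "\<And>t. poly q (complex_of_real t) = 0"
  shows "q = 0"
proof (rule ccontr)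
  assume "q \<noteq> 0"
  then have "finite {z. poly q z = 0}" by (rule poly_roots_finite)
  moreover have "range complex_of_real \<subseteq> {z. poly q z = 0}" using assms by auto
  moreover have "infinite (range complex_of_real)"
    using finite_imageD[of complex_of_real UNIV] infinite_UNIV_char_0 by (auto simp: inj_on_def)
  ultimately show False using finite_subset by blast
qed

text \<open>A polynomial cannot equal c / s with c non-zero. The extra factor in the proof makes the
  equation hold at s = 0 as well.\<close>

lemma no_polynomial_pole:
  fixes c :: complex
  assumes "\<And>s. s \<noteq> 0 \<Longrightarrow> s * poly q s = c"
  shows "c = 0"
proof -
  have "poly ([:0, 1:] * pCons (- c) q) (complex_of_real t) = 0" for t
    using assms[of "complex_of_real t"] by (cases "t = 0") auto
  then have "[:0, 1:] * pCons (- c) q = 0" by (rule poly_real_zeros)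
  then have "pCons (- c) q = 0" by (metis mult_eq_0_iff pCons_eq_0_iff one_neq_zero)
  then show ?thesis by simp
qed

text \<open>Variables 0 to 3 are the parameters, 4 to 7 their conjugates; the zeros beyond keep the
  number of effective variables at 8.\<close>

definition coords :: "complex4 \<Rightarrow> nat \<Rightarrow> complex" where
  "coords = (\<lambda>(A, B, C, D) i. if i < 4 then [A, B, C, D] ! i
     else if i < 8 then cnj ([A, B, C, D] ! (i - 4)) else 0)"

text \<open>In terms of real and imaginary parts, the hypothesis is that a polynomial vanishes on the real
  points.\<close>

lemma polarization:
  fixes x :: "nat \<Rightarrow> complex"
  assumes van: "\<And>P. peval e (coords P) = 0" and x: "\<And>i. i \<ge> 8 \<Longrightarrow> x i = 0"
  shows "peval e x = 0"
proof -
  \<comment> \<open>Passage from real and imaginary parts, taken as independent complex variables,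
    to the parameters and their formal conjugates.\<close>
  define \<psi> where "\<psi> u = (\<lambda>i. if i < 4 then u i + \<i> * u (i + 4)
    else if i < 8 then u (i - 4) - \<i> * u i else 0 :: complex)" for u :: "nat \<Rightarrow> complex"
  \<comment> \<open>Coordinates are freed from being real one at a time: in the newly freed variable
    the value is a polynomial that vanishes on the real line.\<close>
  have "peval e (\<psi> u) = 0" if "\<And>i. i \<ge> n \<Longrightarrow> u i \<in> \<real>" for n and u :: "nat \<Rightarrow> complex"
    using that
  proof (induction n arbitrary: u)
    case 0
    then have c: "cnj (u i) = u i" for i by (simp add: Reals_cnj_iff)
    have "\<psi> u = coords (u 0 + \<i> * u 4, u 1 + \<i> * u 5, u 2 + \<i> * u 6, u 3 + \<i> * u 7)"
    proof
      fix i :: nat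
      have "i < 8 \<Longrightarrow> i \<in> {0,1,2,3,4,5,6,7}" by auto
      then show "\<psi> u i = coords (u 0 + \<i> * u 4, u 1 + \<i> * u 5, u 2 + \<i> * u 6, u 3 + \<i> * u 7) i"
        by (cases "i < 8") (auto simp: \<psi>_def coords_def c numeral_eq_Suc)
    qed
    then show ?case using van by simp
  next
    case (Suc n)
    have *: "\<exists>q. \<forall>t. \<psi> (u(n := t)) i = poly q t" for i
    proof -
      have l: "\<exists>q. \<forall>t. (u(n := t)) j = poly q t" for j
        by (cases "j = n") (auto intro: exI[of _ "[:0, 1:]"] exI[of _ "[:u j:]"])
      obtain q where q: "\<And>j t. (u(n := t)) j = poly (q j) t" using l by metis
      show ?thesis unfolding \<psi>_def q
        by (cases "i < 4"; cases "i < 8")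
          (auto intro: exI[of _ "q i + smult \<i> (q (i + 4))"] exI[of _ "q (i - 4) - smult \<i> (q i)"] exI[of _ 0])
    qed
    obtain q where q: "\<And>t. peval e (\<psi> (u(n := t))) = poly q t"
      using peval_univariate[of "\<lambda>t. \<psi> (u(n := t))" e, OF *] by blast
    have "poly q (complex_of_real t) = 0" for t
      unfolding q[symmetric] by (rule Suc.IH) (use Suc.prems in auto)
    then have "q = 0" by (rule poly_real_zeros)
    then show ?case using q[of "u n"] by simp
  qed
  from this[of 8] have *: "peval e (\<psi> u) = 0" if "\<And>i. i \<ge> 8 \<Longrightarrow> u i = 0" for u using that by auto
  define u where "u = (\<lambda>i. if i < 4 then (x i + x (i + 4)) / 2
    else if i < 8 then (x (i - 4) - x i) / (2 * \<i>) else 0)"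
  have "\<psi> u = x"
  proof
    fix i
    show "\<psi> u i = x i"
      by (cases "i < 4"; cases "i < 8") (auto simp: \<psi>_def u_def x field_simps)
  qed
  moreover have "peval e (\<psi> u) = 0" by (rule *) (simp add: u_def)
  ultimately show ?thesis by simp
qed

text \<open>The expressions are tested only at actual parameters Q; by \<open>polarization\<close>
  this means that the eight numbers in \<open>coords P\<close> satisfy no non-trivial algebraic
  relation over the rationals.\<close>

definition generic :: "complex4 \<Rightarrow> bool" where
  "generic P \<longleftrightarrow> (\<forall>e. peval e (coords P) = 0 \<longrightarrow> (\<forall>Q. peval e (coords Q) = 0))"

lemma generic_polynomial:
  fixes x :: "nat \<Rightarrow> complex"
  shows "generic P \<Longrightarrow> peval e (coords P) = 0 \<Longrightarrow> (\<And>i. i \<ge> 8 \<Longrightarrow> x i = 0) \<Longrightarrow> peval e x = 0"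
  by (rule polarization) (auto simp: generic_def)

lemma generic_rational:
  fixes x :: "nat \<Rightarrow> complex"
  assumes P: "generic P" and d: "peval d (coords P) \<noteq> 0"
    and eq: "peval a (coords P) = peval b (coords P) * peval e (\<lambda>i. peval (g i) (coords P) / peval d (coords P))"
    and x: "\<And>i. i \<ge> 8 \<Longrightarrow> x i = 0" "peval d x \<noteq> 0"
  shows "peval a x = peval b x * peval e (\<lambda>i. peval (g i) x / peval d x)"
proof -
  obtain N f where f: "\<And>x :: nat \<Rightarrow> complex. peval d x \<noteq> 0 \<Longrightarrow>
     peval e (\<lambda>i. peval (g i) x / peval d x) * peval d x ^ N = peval f x"
    using clear_denominators[of d e g] by blast
  let ?h = "Add (Mul a (ppow d N)) (Mul (Cst (- 1)) (Mul b f))"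
  have h: "peval ?h x = (peval a x - peval b x * peval e (\<lambda>i. peval (g i) x / peval d x)) * peval d x ^ N"
    if "peval d x \<noteq> 0" for x :: "nat \<Rightarrow> complex"
    using f[OF that, symmetric] by (simp add: peval_ppow algebra_simps of_rat_minus)
  have "peval ?h (coords P) = 0" unfolding h[OF d] using eq by simp
  then have "peval ?h x = 0" using generic_polynomial[OF P] x(1) by blast
  then show ?thesis unfolding h[OF x(2)] using x(2) by simp
qed

text \<open>In the ring generated by A, B, C and \<open>inverse D\<close>, the element
  \<open>inverse D\<close> is not a unit: a formula for D could be specialized to A = B = C = 0 and
  D = t, writing t as a polynomial in 1 / t.\<close>

theorem generic_place_pole:
  assumes P: "generic (A, B, C, D)"
  shows "\<exists>R. complex_valuation_ring R \<and> A \<in> R \<and> B \<in> R \<and> C \<in> R \<and> D \<notin> R"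
proof -
  define x where "x = coords (A, B, C, D)"
  have x: "x 0 = A" "x 1 = B" "x 2 = C" "x 3 = D" by (auto simp: x_def coords_def numeral_eq_Suc)
  \<comment> \<open>Numerators over the common denominator D of the generators A, B, C, 1 /
    D.\<close>
  define g where "g i = (if i < 3 then Mul (Var i) (Var 3) else if i = 3 then Cst 1 else Cst 0)" for i
  define y where "y i = peval (g i) x / D" for i
  have D: "D \<noteq> 0"
    using generic_polynomial[OF P, of "Var 3" "\<lambda>i. if i = 3 then 1 else 0"] x by (auto simp: x_def[symmetric])
  have y: "y 0 = A" "y 1 = B" "y 2 = C" "y 3 = inverse D" using D x by (auto simp: y_def g_def inverse_eq_divide)
  let ?S = "{peval e y | e. True}"
  have yS: "y i \<in> ?S" for i by (auto intro: exI[of _ "Var i"])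
  have "D \<notin> ?S"
  proof
    assume "D \<in> ?S"
    then obtain e where e: "D = peval e y" by auto
    have "(\<lambda>i. peval (g i) x / peval (Var 3) x) = y" by (auto simp: y_def x)
    then have e': "peval (Var 3) x = peval (Cst 1) x * peval e (\<lambda>i. peval (g i) x / peval (Var 3) x)"
      by (simp add: e[symmetric] x)
    have tr: "t = peval e (\<lambda>i. if i = 3 then 1 / t else 0)" if t: "t \<noteq> 0" for t :: complex
    proof -
      have "peval (Var 3) (\<lambda>i. if i = 3 then t else 0)
        = peval (Cst 1) (\<lambda>i. if i = 3 then t else 0) * peval e (\<lambda>i. peval (g i) (\<lambda>i. if i = 3 then t else 0) / peval (Var 3) (\<lambda>i. if i = 3 then t else 0))"
        by (rule generic_rational[OF P, of "Var 3" "Var 3" "Cst 1" e g])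
          (use D t x e' in \<open>auto simp: x_def[symmetric]\<close>)
      moreover have "(\<lambda>i. peval (g i) (\<lambda>i. if i = 3 then t else 0) / peval (Var 3) (\<lambda>i. if i = 3 then t else 0))
        = (\<lambda>i. if i = 3 then 1 / t else 0)" by (auto simp: g_def)
      ultimately show ?thesis by simp
    qed
    have "\<exists>q. \<forall>s :: complex. peval e (\<lambda>i. if i = 3 then s else 0) = poly q s"
      by (rule peval_univariate, case_tac "i = 3") (auto intro: exI[of _ "[:0, 1:]"] exI[of _ 0])
    then obtain q where q: "\<And>s :: complex. peval e (\<lambda>i. if i = 3 then s else 0) = poly q s" by blast
    have "s * poly q s = 1" if "s \<noteq> 0" for s
    proof -
      have "1 / s = peval e (\<lambda>i. if i = 3 then 1 / (1 / s) else 0)" by (rule tr) (use that in simp)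
      also have "(\<lambda>i :: nat. if i = 3 then 1 / (1 / s) else 0) = (\<lambda>i. if i = 3 then s else 0)" by auto
      finally have "1 / s = poly q s" unfolding q .
      then show ?thesis using that by (simp add: field_simps)
    qed
    then have "(1 :: complex) = 0" by (rule no_polynomial_pole)
    then show False by simp
  qed
  then have "inverse (inverse D) \<notin> ?S" by simp
  then obtain R where "valuation_ring R" "?S \<subseteq> R" "inverse (inverse D) \<notin> R"
    using valuation_ring_exists[OF rat_subring_eval, of "inverse D" y] yS[of 3] y by auto
  then show ?thesis using yS[of 0] yS[of 1] yS[of 2] y unfolding complex_valuation_ring_def by auto
qed

text \<open>Let d be \<open>cnj D - 4\<close>. The ring generated over the rational functions of A,
  B, C, D by d and by the quotients of \<open>cnj A\<close>, \<open>cnj B\<close>,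
  \<open>cnj C\<close> by d has d as a non-unit. Because of the quotients, a place where this single
  element is infinitesimal makes all four congruences true.\<close>

theorem generic_place_picard:
  assumes P: "generic (A, B, C, D)"
  defines "z \<equiv> \<lambda>i. if i < 4 then coords (A, B, C, D) i else 0"
  shows "\<exists>R. complex_valuation_ring R \<and> (\<forall>e. peval e z \<noteq> 0 \<longrightarrow> peval e z \<in> R \<and> inverse (peval e z) \<in> R)
    \<and> valuation_ring.cong R (cnj A) 0 \<and> valuation_ring.cong R (cnj B) 0 \<and> valuation_ring.cong R (cnj C) 0
    \<and> valuation_ring.cong R (cnj D) 4"
proof -
  define x where "x = coords (A, B, C, D)"
  have x: "x 4 = cnj A" "x 5 = cnj B" "x 6 = cnj C" "x 7 = cnj D" by (auto simp: x_def coords_def numeral_eq_Suc)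
  define d where "d = cnj D - 4"
  define \<delta> where "\<delta> = Add (Var 7) (Cst (- 4))"
  have \<delta>: "peval \<delta> x = d" by (simp add: \<delta>_def d_def x of_rat_minus)
  \<comment> \<open>Numerators over the common denominator d of the generators \<open>y\<close>,
    with d itself written as d d / d.\<close>
  define g where "g i = (if i < 4 then Mul (Var i) \<delta> else if i < 7 then Var i else if i = 7 then Mul \<delta> \<delta> else Cst 0)" for i
  define y where "y i = peval (g i) x / d" for i
  have d0: "d \<noteq> 0"
    using generic_polynomial[OF P, of \<delta> "\<lambda>i. 0"] \<delta> by (auto simp: x_def[symmetric] \<delta>_def of_rat_minus)
  have y: "i < 4 \<Longrightarrow> y i = x i" "y 4 = cnj A / d" "y 5 = cnj B / d" "y 6 = cnj C / d" "y 7 = d" for i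
    using d0 x \<delta> by (auto simp: y_def g_def)
  \<comment> \<open>Truncation to the variables of A, B, C, D, so that one value is obtained at x, y
    and z.\<close>
  define tr where "tr = psubst (\<lambda>i. if i < 4 then Var i else Cst 0)"
  have z: "z i = (if i < 4 then x i else 0)" for i by (simp add: z_def x_def)
  have tr: "peval (tr e) y = peval e z" "peval (tr e) x = peval e z" for e
    unfolding tr_def peval_psubst by (rule arg_cong[of _ _ "peval e"]; auto simp: y z)+
  define S where "S = {peval e y / peval f z | e f. peval f z \<noteq> 0}"
  have yS: "peval e y \<in> S" for e 
  proof -
    have "peval e y = peval e y / peval (Cst 1) z" "peval (Cst 1) z \<noteq> 0" by simp_all
    then show ?thesis unfolding S_def by blast
  qed
  have sub: "rat_subring S"
    unfolding rat_subring_def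
  proof (intro conjI allI ballI)
    fix q show "of_rat q \<in> S" using yS[of "Cst q"] by simp
  next
    fix u v assume "u \<in> S" "v \<in> S"
    then obtain e f e' f' where uv: "u = peval e y / peval f z" "v = peval e' y / peval f' z" "peval f z \<noteq> 0" "peval f' z \<noteq> 0"
      unfolding S_def by auto
    have "u + v = peval (Add (Mul e (tr f')) (Mul e' (tr f))) y / peval (Mul f f') z"
      "u * v = peval (Mul e e') y / peval (Mul f f') z" "peval (Mul f f') z \<noteq> 0"
      unfolding uv(1,2) using uv(3,4) by (simp_all add: tr field_simps)
    then show "u + v \<in> S" "u * v \<in> S" unfolding S_def by blast+
  qed
  have "inverse d \<notin> S"
  proof
    assume "inverse d \<in> S"
    then obtain e f where e: "inverse d = peval e y / peval f z" "peval f z \<noteq> 0" unfolding S_def by auto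
    then have eq: "peval f z = d * peval e y" using d0 by (simp add: field_simps)
    have "(\<lambda>i. peval (g i) x / peval \<delta> x) = y" by (auto simp: y_def \<delta>)
    then have e': "peval (tr f) x = peval \<delta> x * peval e (\<lambda>i. peval (g i) x / peval \<delta> x)"
      by (simp add: eq \<delta> tr)
    have tr': "peval f z = s * peval e (\<lambda>i. if i < 4 then x i else if i = 7 then s else 0)" if s: "s \<noteq> 0" for s
    proof -
      \<comment> \<open>Genericity allows A, B, C, D to be kept while the conjugates become 0, 0, 0
        and 4 + s, so that d specializes to s.\<close>
      define w where "w i = (if i < 4 then x i else if i = 7 then 4 + s else 0)" for i
      have ws: "peval \<delta> w = s" by (simp add: \<delta>_def w_def of_rat_minus)
      have "peval (tr f) w = peval \<delta> w * peval e (\<lambda>i. peval (g i) w / peval \<delta> w)"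
        by (rule generic_rational[OF P, of \<delta> "tr f" \<delta> e g])
          (use d0 s ws e' in \<open>auto simp: x_def[symmetric] \<delta> w_def\<close>)
      moreover have "(\<lambda>i. peval (g i) w / peval \<delta> w) = (\<lambda>i. if i < 4 then x i else if i = 7 then s else 0)"
        unfolding ws using s ws by (auto simp: g_def w_def)
      moreover have "peval (tr f) w = peval f z"
        unfolding tr_def peval_psubst by (rule arg_cong[of _ _ "peval f"]) (auto simp: z w_def)
      ultimately show ?thesis using ws by simp
    qed
    have "\<exists>q. \<forall>s. peval e (\<lambda>i. if i < 4 then x i else if i = 7 then s else 0) = poly q s"
      by (rule peval_univariate, case_tac "i < 4"; case_tac "i = 7")
        (auto intro: exI[of _ "[:0, 1:]"] exI[of _ 0] exI[of _ "[:x i:]" for i])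
    then obtain q where "\<And>s. peval e (\<lambda>i. if i < 4 then x i else if i = 7 then s else 0) = poly q s" by blast
    then have "s * poly q s = peval f z" if "s \<noteq> 0" for s using tr'[OF that] by simp
    then have "peval f z = 0" by (rule no_polynomial_pole)
    then show False using e(2) by simp
  qed
  then obtain R where R: "valuation_ring R" "S \<subseteq> R" "inverse d \<notin> R"
    using valuation_ring_exists[OF sub, of d] yS[of "Var 7"] y by auto
  interpret valuation_ring R by (rule R)
  have sd: "smaller d 1" using R(3) by (simp add: smaller_def inverse_eq_divide)
  have sm: "cong c 0" if "c / d \<in> R" for c
    using small_mult[OF sd that] d0 by (simp add: cong_small)
  have yR: "y i \<in> R" for i using yS[of "Var i"] R(2) by auto
  have "cong (cnj A) 0" "cong (cnj B) 0" "cong (cnj C) 0"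
    using sm yR[of 4] yR[of 5] yR[of 6] y by auto
  moreover have "cong (cnj D) 4" using sd by (simp add: cong_def d_def)
  moreover have "peval e z \<in> R \<and> inverse (peval e z) \<in> R" if "peval e z \<noteq> 0" for e
  proof -
    have "inverse (peval e z) = peval (Cst 1) y / peval e z" by (simp add: inverse_eq_divide)
    then have "inverse (peval e z) \<in> S" unfolding S_def using that by blast
    then show ?thesis using yS[of "tr e"] R(2) tr by auto
  qed
  ultimately show ?thesis using R(1) unfolding complex_valuation_ring_def by blast
qed

section \<open>Changing the place, and finiteness of singular points\<close>

context valuation_ring
begin

text \<open>Horner's scheme: at each step the product with s is infinite or at least strictly larger
  than the next coefficient. Thus an infinite element is transcendental over a ring on which the
  place is trivial.\<close>

lemma poly_not_zero_at_pole:
  assumes "r \<noteq> 0" "\<And>i. coeff r i \<noteq> 0 \<Longrightarrow> coeff r i \<in> R \<and> inverse (coeff r i) \<in> R" and s: "s \<notin> R"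
  shows "poly r s \<noteq> 0 \<and> inverse (poly r s) \<in> R"
  using assms(1,2)
proof (induction r)
  case (pCons c q)
  show ?case
  proof (cases "q = 0")
    case True
    then show ?thesis using pCons(1) pCons.prems(2)[of 0] by auto
  next
    case False
    have q: "poly q s \<noteq> 0" "inverse (poly q s) \<in> R"
      using pCons.IH[OF False] pCons.prems(2)[of "Suc _"] by auto
    have c: "c \<in> R" using pCons.prems(2)[of 0] by (cases "c = 0") auto
    have s0: "s \<noteq> 0" using s by auto
    have "atmost 1 (poly q s)" unfolding atmost_def using q by (intro bexI[of _ "inverse (poly q s)"]) auto
    then have "smaller (1 * 1) (s * poly q s)" using smaller_mult1[of 1 s 1 "poly q s"] s q by (simp add: notmem_iff_smaller)
    then have sm: "smaller 1 (s * poly q s)" by simp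
    then have "smaller c (s * poly q s)" using c mem_iff_atmost smaller_trans2 by blast
    then have "atmost (s * poly q s) (s * poly q s + c)" by (rule atmost_dominant)
    then have "smaller 1 (c + s * poly q s)" using sm smaller_trans1 by (simp add: add.commute)
    then have n: "c + s * poly q s \<noteq> 0" "atmost 1 (c + s * poly q s)"
      using smaller_nonzero smaller_imp_atmost by blast+
    then obtain k where "k \<in> R" "1 = k * (c + s * poly q s)" unfolding atmost_def by blast
    then have "inverse (c + s * poly q s) = k" using n(1) by (simp add: field_simps)
    then show ?thesis using n(1) \<open>k \<in> R\<close> by simp
  qed
qed simp

text \<open>A polynomial expression of t in \<open>inverse t\<close> over K would be an algebraic
  relation for the infinite element \<open>inverse t\<close>. So t is not in
  \<open>K[inverse t]\<close>, and another place makes it infinite.\<close>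

lemma place_avoiding_small:
  assumes K: "rat_subring K" "\<And>c. c \<in> K \<Longrightarrow> c \<noteq> 0 \<Longrightarrow> c \<in> R \<and> inverse c \<in> R"
    and t: "t \<noteq> 0" "smaller t 1"
  shows "\<exists>R'. valuation_ring R' \<and> K \<subseteq> R' \<and> t \<notin> R'"
proof -
  have s: "inverse t \<notin> R" using t by (auto simp: smaller_def inverse_eq_divide)
  have "t \<notin> adjoin K (inverse t)"
  proof
    assume "t \<in> adjoin K (inverse t)"
    then obtain q where q: "t = poly q (inverse t)" "\<forall>i. coeff q i \<in> K" unfolding adjoin_def by auto
    have "- 1 \<in> K" using rat_subringD[OF K(1)] by blast
    then have "coeff (pCons (- 1) q) i \<in> K" for i using q(2) by (auto simp: coeff_pCons split: nat.split)
    then have "poly (pCons (- 1) q) (inverse t) \<noteq> 0"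
      using poly_not_zero_at_pole[OF _ _ s, of "pCons (- 1) q"] K(2) by auto
    then show False using q(1) t(1) by (metis left_inverse poly_pCons add.left_inverse)
  qed
  then have "\<exists>R'. valuation_ring R' \<and> adjoin K (inverse t) \<subseteq> R' \<and> inverse (inverse t) \<notin> R'"
    by (intro valuation_ring_exists adjoin K) simp
  then show ?thesis using adjoin(2)[OF K(1), of "inverse t"] by auto
qed

text \<open>At a largest coordinate i, the equation \<open>grad a p j = 0\<close> bounds the product
  \<open>p k * p i\<close> by \<open>p i\<close>, so the other two coordinates are finite. Then
  \<open>grad a p i = 0\<close> bounds \<open>p i\<close>; this divides by 2.\<close>

lemma singular_point_mem:
  assumes a: "\<And>l. a l \<in> R" and sing: "\<And>l. grad a p l = 0"
  shows "p l \<in> R"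
proof (rule ccontr)
  assume "p l \<notin> R"
  obtain i where i: "\<And>j. atmost (p j) (p i)" using atmost_max by blast
  have bi: "p i \<notin> R"
    using \<open>p l \<notin> R\<close> i[of l] mem_iff_atmost atmost_trans by blast
  then have nz: "p i \<noteq> 0" by auto
  have *: "p k \<in> R" if d: "j \<noteq> i" "i \<noteq> k" "j \<noteq> k" for j k
  proof -
    have "p k * p i = a j + - (2 * p j)" using sing[of j] grad_eq[OF d, of a p] by (simp add: algebra_simps)
    moreover have "atmost (a j) (1 * p i)"
      using smaller_mem[OF a bi, of j] smaller_imp_atmost by simp
    moreover have "atmost (- (2 * p j)) (1 * p i)"
      using atmost_mult[OF _ i[of j], of 2 1] mem_iff_atmost[of 2] by (auto intro: atmost_uminus)
    ultimately have "atmost (p k * p i) (1 * p i)" using atmost_add by metis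
    then show ?thesis using atmost_cancel[OF nz] mem_iff_atmost by blast
  qed
  define j where "j = nxt i"
  define k where "k = nxt j"
  have d: "i \<noteq> j" "j \<noteq> k" "i \<noteq> k" by (cases i; simp add: j_def k_def)+
  have "p j \<in> R" "p k \<in> R" using *[of k j] *[of j k] d by auto
  moreover have "p i = of_rat (1 / 2) * (a i - p j * p k)"
    using sing[of i] grad_eq[OF d, of a p] by (simp add: of_rat_divide field_simps)
  ultimately have "p i \<in> R" using a by (metis diff_mem mult_mem rat_mem)
  then show False using bi by simp
qed

end

section \<open>Smoothness and traces for generic parameters\<close>

fun params :: "complex4 \<Rightarrow> letter \<Rightarrow> complex" where
  "params (A, B, C, D) Lx = A" | "params (A, B, C, D) Ly = B" | "params (A, B, C, D) Lz = C"

text \<open>A singular point is finite wherever A, B, C are, and hence so is D, the value of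
  \<open>cubic\<close> there; but some place has a pole at D alone.\<close>

theorem generic_smooth:
  assumes P: "generic (A, B, C, D)" and D: "cubic (params (A, B, C, D)) p = D"
  shows "\<exists>l. grad (params (A, B, C, D)) p l \<noteq> 0"
proof (rule ccontr)
  let ?a = "params (A, B, C, D)"
  assume "\<not> ?thesis"
  then have sing: "\<And>l. grad ?a p l = 0" by blast
  obtain R where R: "complex_valuation_ring R" "A \<in> R" "B \<in> R" "C \<in> R" "D \<notin> R"
    using generic_place_pole[OF P] by blast
  interpret complex_valuation_ring R by (rule R)
  have a: "?a l \<in> R" for l using R by (cases l) auto
  have p: "p l \<in> R" for l by (rule singular_point_mem[of ?a p]) (use a sing in auto)
  have "cubic ?a p \<in> R" unfolding cubic_def by (intro add_mem diff_mem mult_mem power_mem p a)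
  then show False using D R by simp
qed

lemma act_cnj: "act (\<lambda>l. cnj (a l)) w (\<lambda>l. cnj (p l)) m = cnj (act a w p m)"
  by (induction w arbitrary: m) (auto simp: vieta_def)

lemma dact_cnj: "dact (\<lambda>l. cnj (a l)) w (\<lambda>l. cnj (p l)) (\<lambda>l. cnj (v l)) m = cnj (dact a w p v m)"
  by (induction w arbitrary: m) (auto simp: dvieta_def act_cnj)

lemma dtrace_cnj: "dtrace (\<lambda>l. cnj (a l)) w (\<lambda>l. cnj (p l)) = cnj (dtrace a w p)"
proof -
  have "(\<lambda>m. cnj (single l m)) = single l" for l by (auto simp: single_def)
  then show ?thesis unfolding dtrace_def using dact_cnj[of a w p "single _"] by (simp add: fun_eq_iff)
qed

theorem generic_trace:
  assumes P: "generic (A, B, C, D)" and D: "cubic (params (A, B, C, D)) p = D"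
    and w: "distinct_adj w" "hd w = Lz" "last w \<noteq> Lz" "set w = UNIV" "even (length w)"
    and fx: "act (params (A, B, C, D)) w p = p"
    and re: "dtrace (params (A, B, C, D)) w p = complex_of_real r"
  shows "r < - 1 \<or> r > 3"
proof -
  let ?a = "params (A, B, C, D)" and ?T = "dtrace (params (A, B, C, D)) w p"
  define z where "z = (\<lambda>i. if i < 4 then coords (A, B, C, D) i else 0)"
  obtain R where R: "complex_valuation_ring R"
    and u: "\<And>e. peval e z \<noteq> 0 \<Longrightarrow> peval e z \<in> R \<and> inverse (peval e z) \<in> R"
    and c: "valuation_ring.cong R (cnj A) 0" "valuation_ring.cong R (cnj B) 0"
      "valuation_ring.cong R (cnj C) 0" "valuation_ring.cong R (cnj D) 4"
    using generic_place_picard[OF P] unfolding z_def by blast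
  interpret complex_valuation_ring R by (rule R)
  let ?b = "\<lambda>l. cnj (?a l)" and ?q = "\<lambda>l. cnj (p l)"
  have b: "cong (?b l) 0" for l using c by (cases l) auto
  have bm: "?b l \<in> R" for l using b smaller_one_mem cong_small by blast
  have Dq: "cubic ?b ?q = cnj D" using D by (auto simp: cubic_def)
  have fq: "act ?b w ?q = ?q" using act_cnj[of ?a w p] fx by auto
  have ne: "hd w \<noteq> last w" using w by metis
  have qm: "?q l \<in> R" for l
    by (rule fixed_point_mem[of ?b ?q w]) (use bm Dq w ne fq cong_mem[OF cong_sym[OF c(4)]] in auto)
  obtain \<alpha> \<beta> \<gamma> \<delta> where m: "monomial w = (\<alpha>, \<beta>, \<gamma>, \<delta>)" by (metis prod_cases4)
  have "\<exists>n\<in>{1 + (\<alpha> + \<delta>), 1 - (\<alpha> + \<delta>), (\<alpha> + \<delta>)\<^sup>2 - 1}. cong (dtrace ?b w ?q) (of_int n)"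
    by (rule dtrace_picard[of ?b ?q w]) (use b qm Dq c fq w m in auto)
  then obtain n where n: "n \<in> {1 + (\<alpha> + \<delta>), 1 - (\<alpha> + \<delta>), (\<alpha> + \<delta>)\<^sup>2 - 1}" "cong (dtrace ?b w ?q) (of_int n)"
    by blast
  \<comment> \<open>Here the reality of T passes from the conjugate parameters back to the given
    ones.\<close>
  have "cong ?T (of_int n)" using n(2) re unfolding dtrace_cnj by simp
  then have sm: "smaller (?T - of_int n) 1" by (simp add: cong_def)
  have "?T = of_int n"
  proof (rule ccontr)
    assume "?T \<noteq> of_int n"
    then have t0: "?T - of_int n \<noteq> 0" by simp
    have "\<exists>R'. valuation_ring R' \<and> {peval e z | e. True} \<subseteq> R' \<and> ?T - of_int n \<notin> R'"
      by (rule place_avoiding_small) (use u sm t0 rat_subring_eval in auto)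
    then obtain R' where R': "valuation_ring R'" "{peval e z | e. True} \<subseteq> R'" "?T - of_int n \<notin> R'" by blast
    interpret V: valuation_ring R' by (rule R')
    have z: "z i \<in> R'" for i using R'(2) by (auto intro: exI[of _ "Var i"])
    have am: "?a l \<in> R'" for l
      using z[of 0] z[of 1] z[of 2] by (cases l) (auto simp: z_def coords_def)
    have "D \<in> R'" using z[of 3] by (auto simp: z_def coords_def)
    then have "p l \<in> R'" for l
      by (intro V.fixed_point_mem[of ?a p w]) (use am D w ne fx in auto)
    then have "?T \<in> R'" by (intro V.dtrace_mem) (use am in auto)
    then show False using R'(3) V.diff_mem V.of_int_mem by blast
  qed
  then have r: "r = of_int n" using re by (metis of_real_eq_iff of_real_of_int_eq)
  have t3: "\<bar>\<alpha> + \<delta>\<bar> \<ge> 3" by (rule monomial_trace[OF w m])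
  have "(\<alpha> + \<delta>)\<^sup>2 \<ge> 9"
    using power_mono[OF t3, of 2] by simp
  \<comment> \<open>Of the two values 1 + tr and 1 - tr, one is at least 4 and the other at most -2;
    the third value is at least 8.\<close>
  then have "n < - 1 \<or> n > 3" using n(1) t3 by auto
  then show ?thesis unfolding r by auto
qed

section \<open>Bounded powers near a fixed point\<close>

text \<open>All that is extracted from normality. A subsequence suffices, as does a bound only on
  nearby points of the surface.\<close>

definition locally_bounded_powers ::
  "(letter \<Rightarrow> complex) \<Rightarrow> complex \<Rightarrow> letter list \<Rightarrow> (letter \<Rightarrow> complex) \<Rightarrow> bool" where
  "locally_bounded_powers a D c q \<longleftrightarrow> (\<exists>r \<epsilon> B. strict_mono (r :: nat \<Rightarrow> nat) \<and> \<epsilon> > 0 \<and>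
     (\<forall>q'. cubic a q' = D \<longrightarrow> (\<forall>l. cmod (q' l - q l) < \<epsilon>) \<longrightarrow> (\<forall>m l. cmod ((act a c ^^ r m) q' l) \<le> B)))"

lemma unbounded_powers:
  fixes x c :: real
  assumes "x > 1" "c > 0" "\<And>m. x ^ (f m) * c \<le> K" "\<And>m. f m \<ge> m"
  shows False
proof -
  obtain m where m: "K / c < x ^ m" using assms(1) real_arch_pow by blast
  have "x ^ m \<le> x ^ f m" using assms by (intro power_increasing) auto
  then have "K < x ^ f m * c" using m assms(2) by (simp add: field_simps) (metis less_le_trans mult.commute mult_le_cancel_left_pos)
  then show False using assms(3)[of m] by simp
qed

lemma joukowski_unimodular:
  assumes "cmod u = 1"
  shows "u + 1 / u = complex_of_real (2 * Re u)" "\<bar>Re u\<bar> \<le> 1"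
proof -
  have "u * cnj u = 1" using assms by (simp add: complex_norm_square[symmetric])
  then have "1 / u = cnj u" by (metis nonzero_mult_div_cancel_left mult_zero_left zero_neq_one)
  then show "u + 1 / u = complex_of_real (2 * Re u)" by (simp add: complex_add_cnj)
  show "\<bar>Re u\<bar> \<le> 1" using abs_Re_le_cmod[of u] assms by simp
qed

text \<open>The value at y is the product of the distances to the two roots. This puts points of the
  surface near a given one even where the derivative in the solved coordinate vanishes.\<close>

lemma quadratic_root_near:
  fixes b e y :: complex
  shows "\<exists>x. x\<^sup>2 + b * x + e = 0 \<and> (cmod (y - x))\<^sup>2 \<le> cmod (y\<^sup>2 + b * y + e)"
proof -
  define s where "s = csqrt (b\<^sup>2 - 4 * e)"
  have s: "s * s = b\<^sup>2 - 4 * e" using power2_csqrt[of "b\<^sup>2 - 4 * e"] by (simp add: s_def power2_eq_square)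
  define x1 x2 where "x1 = (- b + s) / 2" and "x2 = (- b - s) / 2"
  have f: "z\<^sup>2 + b * z + e = (z - x1) * (z - x2)" for z
    using s unfolding x1_def x2_def by (simp add: field_simps power2_eq_square)
  have n: "cmod (y\<^sup>2 + b * y + e) = cmod (y - x1) * cmod (y - x2)" unfolding f by (rule norm_mult)
  show ?thesis
  proof (cases "cmod (y - x1) \<le> cmod (y - x2)")
    case True
    then have "(cmod (y - x1))\<^sup>2 \<le> cmod (y\<^sup>2 + b * y + e)"
      unfolding n power2_eq_square[of "cmod _"] by (intro mult_left_mono) auto
    then show ?thesis using f[of x1] by auto
  next
    case False
    then have "(cmod (y - x2))\<^sup>2 \<le> cmod (y\<^sup>2 + b * y + e)"
      unfolding n power2_eq_square[of "cmod _"] by (intro mult_right_mono) auto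
    then show ?thesis using f[of x2] by auto
  qed
qed

lemma act_replicate: "act a (concat (replicate n c)) = act a c ^^ n"
proof (induction n)
  case (Suc n)
  show ?case by (rule ext) (simp add: act_append Suc)
qed (rule ext, simp)

text \<open>On a fibre with \<open>p k = \<mu> + 1 / \<mu>\<close> the two involutions are affine; centred at the
  common fixed point they exchange the two factors of the invariant quadratic form, up to scalars.\<close>

theorem parabolic_unbounded:
  assumes q: "cubic a q = D" and d: "i \<noteq> j" "j \<noteq> k" "i \<noteq> k" and n: "n \<ge> 1"
  shows "\<not> locally_bounded_powers a D (concat (replicate n [i, j])) q"
proof
  assume "locally_bounded_powers a D (concat (replicate n [i, j])) q"
  then obtain r \<epsilon> B where r: "strict_mono (r :: nat \<Rightarrow> nat)" and \<epsilon>: "\<epsilon> > 0"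
    and B: "\<And>q' m l. cubic a q' = D \<Longrightarrow> (\<And>l. cmod (q' l - q l) < \<epsilon>) \<Longrightarrow>
      cmod ((act a (concat (replicate n [i, j])) ^^ r m) q' l) \<le> B"
    unfolding locally_bounded_powers_def by blast
  \<comment> \<open>The defect of the equation when only coordinate k is moved; it is repaired by
    changing coordinate j to the nearby root.\<close>
  define f where "f \<xi> = cubic a (q(k := \<xi>)) - D" for \<xi>
  have f: "f \<xi> = (q i)\<^sup>2 + (q j)\<^sup>2 + \<xi>\<^sup>2 + q i * q j * \<xi> - a i * q i - a j * q j - a k * \<xi> - D" for \<xi>
    unfolding f_def using cubic_eq[OF d, of a "q(k := \<xi>)"] d by auto
  have "isCont f (q k)" unfolding f by (intro continuous_intros)
  moreover have "f (q k) = 0" using q by (simp add: f_def)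
  ultimately obtain \<delta> where \<delta>: "\<delta> > 0" "\<And>\<xi>. cmod (\<xi> - q k) < \<delta> \<Longrightarrow> cmod (f \<xi>) < \<epsilon>\<^sup>2"
    unfolding continuous_at_eps_delta dist_norm using \<epsilon> zero_less_power[of \<epsilon> 2]
    by (metis diff_zero)
  \<comment> \<open>Up to the factor \<open>4 - \<xi>\<^sup>2\<close>, the value of the invariant
    quadratic form on the fibre at \<xi>; its zeros are the fibres where the conic degenerates. It
    is monic, so there are finitely many.\<close>
  define h where "h = [:4 * D + (a i)\<^sup>2 + (a j)\<^sup>2, 4 * a k - a i * a j, - 4 - D, - a k, 1:]"
  have "finite {z. poly h z = 0}" by (rule poly_roots_finite) (simp add: h_def)
  then have "finite ((\<lambda>t. q k + \<i> * complex_of_real t) -` {z. poly h z = 0})"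
    by (rule finite_vimageI) (auto simp: inj_def)
  then have "finite ((\<lambda>t. q k + \<i> * complex_of_real t) -` {z. poly h z = 0} \<union> {- Im (q k)})" by simp
  moreover have "infinite {0<..<min \<delta> \<epsilon>}" using \<delta>(1) \<epsilon> by simp
  \<comment> \<open>Moving k in the imaginary direction, off the real axis, excludes |\<mu>| = 1,
    since then \<xi> would be real.\<close>
  ultimately have "\<not> {0<..<min \<delta> \<epsilon>} \<subseteq> (\<lambda>t. q k + \<i> * complex_of_real t) -` {z. poly h z = 0} \<union> {- Im (q k)}"
    using finite_subset by blast
  then obtain t where t: "0 < t" "t < \<delta>" "t < \<epsilon>" "poly h (q k + \<i> * complex_of_real t) \<noteq> 0" "t \<noteq> - Im (q k)"
    by (auto simp: subset_iff)
  define \<xi> where "\<xi> = q k + \<i> * complex_of_real t"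
  have \<xi>: "cmod (\<xi> - q k) = t" "poly h \<xi> \<noteq> 0" "Im \<xi> \<noteq> 0" using t by (auto simp: \<xi>_def norm_mult)
  obtain x where x: "x\<^sup>2 + (q i * \<xi> - a j) * x + ((q i)\<^sup>2 + \<xi>\<^sup>2 - a i * q i - a k * \<xi> - D) = 0"
    "(cmod (q j - x))\<^sup>2 \<le> cmod ((q j)\<^sup>2 + (q i * \<xi> - a j) * q j + ((q i)\<^sup>2 + \<xi>\<^sup>2 - a i * q i - a k * \<xi> - D))"
    using quadratic_root_near by blast
  have "(q j)\<^sup>2 + (q i * \<xi> - a j) * q j + ((q i)\<^sup>2 + \<xi>\<^sup>2 - a i * q i - a k * \<xi> - D) = f \<xi>"
    unfolding f by (simp add: algebra_simps)
  then have "(cmod (q j - x))\<^sup>2 < \<epsilon>\<^sup>2" using x(2) \<delta>(2)[of \<xi>] \<xi>(1) t by simp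
  then have xj: "cmod (x - q j) < \<epsilon>" using \<epsilon> by (metis norm_minus_commute norm_ge_zero power2_less_imp_less less_imp_le)
  define p where "p = q(k := \<xi>, j := x)"
  have p: "p i = q i" "p j = x" "p k = \<xi>" using d by (auto simp: p_def)
  have pD: "cubic a p = D"
    using x(1) unfolding cubic_eq[OF d] p by (simp add: algebra_simps)
  have near: "cmod (p l - q l) < \<epsilon>" for l
    using letter_cases3[OF d, of l] by (elim disjE) (simp_all add: p \<xi>(1) t xj \<epsilon>)
  obtain \<mu> where \<mu>: "\<mu> \<noteq> 0" "\<xi> = \<mu> + 1 / \<mu>" using joukowski_exists by blast
  have \<mu>1: "cmod \<mu> \<noteq> 1"
  proof
    assume "cmod \<mu> = 1"
    then have "\<xi> = complex_of_real (2 * Re \<mu>)" using joukowski_unimodular(1) \<mu>(2) by simp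
    then show False using \<xi>(3) by (metis Im_complex_of_real)
  qed
  have nz: "4 - \<xi>\<^sup>2 \<noteq> 0"
  proof
    assume "4 - \<xi>\<^sup>2 = 0"
    then have "(\<xi> - 2) * (\<xi> + 2) = 0" by (simp add: algebra_simps power2_eq_square)
    then have "\<xi> = 2 \<or> \<xi> = - 2" by (auto simp: eq_neg_iff_add_eq_0)
    then show False using \<xi>(3) by auto
  qed
  \<comment> \<open>The centre of the conic, the solution of the linear system for the common fixed
    point of both involutions.\<close>
  define ci cj where "ci = (2 * a i - \<xi> * a j) / (4 - \<xi>\<^sup>2)" and "cj = (2 * a j - \<xi> * a i) / (4 - \<xi>\<^sup>2)"
  have cw: "ci * (4 - \<xi>\<^sup>2) = 2 * a i - \<xi> * a j" "cj * (4 - \<xi>\<^sup>2) = 2 * a j - \<xi> * a i"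
    using nz by (simp_all add: ci_def cj_def)
  have "(2 * ci + \<xi> * cj) * (4 - \<xi>\<^sup>2) = 2 * (ci * (4 - \<xi>\<^sup>2)) + \<xi> * (cj * (4 - \<xi>\<^sup>2))"
    "(2 * cj + \<xi> * ci) * (4 - \<xi>\<^sup>2) = 2 * (cj * (4 - \<xi>\<^sup>2)) + \<xi> * (ci * (4 - \<xi>\<^sup>2))"
    by (simp_all only: distrib_right mult.assoc)
  then have "(2 * ci + \<xi> * cj) * (4 - \<xi>\<^sup>2) = a i * (4 - \<xi>\<^sup>2)" "(2 * cj + \<xi> * ci) * (4 - \<xi>\<^sup>2) = a j * (4 - \<xi>\<^sup>2)"
    unfolding cw by (simp_all add: algebra_simps power2_eq_square)
  then have c: "2 * ci + \<xi> * cj = a i" "2 * cj + \<xi> * ci = a j" using nz by auto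
  \<comment> \<open>The linear factors of the form around the centre. The word \<open>[i, j]\<close>
    divides \<open>L1\<close> by \<open>\<mu>\<^sup>2\<close> and multiplies \<open>L2\<close> by
    it; both are non-zero at p, so one of them grows.\<close>
  define L1 L2 where "L1 y = (y i - ci) + \<mu> * (y j - cj)" and "L2 y = (y i - ci) + (y j - cj) / \<mu>"
    for y :: "letter \<Rightarrow> complex"
  have "L1 p * L2 p = (q i - ci)\<^sup>2 + (x - cj)\<^sup>2 + \<xi> * (q i - ci) * (x - cj)"
    unfolding L1_def L2_def p \<mu>(2) using \<mu>(1) by (simp add: field_simps power2_eq_square)
  also have "\<dots> = D + a k * \<xi> - \<xi>\<^sup>2 + (a i * ci + a j * cj) / 2"
    using x(1) unfolding c[symmetric] by (simp add: field_simps power2_eq_square) algebra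
  finally have L: "L1 p * L2 p = D + a k * \<xi> - \<xi>\<^sup>2 + (a i * ci + a j * cj) / 2" .
  have "(4 - \<xi>\<^sup>2) * (L1 p * L2 p)
      = (4 - \<xi>\<^sup>2) * (D + a k * \<xi> - \<xi>\<^sup>2) + (a i * (ci * (4 - \<xi>\<^sup>2)) + a j * (cj * (4 - \<xi>\<^sup>2))) / 2"
    unfolding L by (simp add: field_simps)
  also have "\<dots> = poly h \<xi>" unfolding cw h_def by (simp add: field_simps power2_eq_square)
  finally have "(4 - \<xi>\<^sup>2) * (L1 p * L2 p) = poly h \<xi>" .
  then have L0: "L1 p \<noteq> 0" "L2 p \<noteq> 0" using \<xi>(2) by auto
  have Li: "L1 (vieta a i y) = - L2 y" "L2 (vieta a i y) = - L1 y" "vieta a i y k = \<xi>" if "y k = \<xi>" for y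
    unfolding L1_def L2_def vieta_eq[OF d] c[symmetric] using d \<mu>(1) by (simp_all add: that \<mu>(2) field_simps)
  have d': "j \<noteq> i" "i \<noteq> k" "j \<noteq> k" using d by auto
  have Lj: "L1 (vieta a j y) = - \<mu>\<^sup>2 * L2 y" "L2 (vieta a j y) = - L1 y / \<mu>\<^sup>2" "vieta a j y k = \<xi>" if "y k = \<xi>" for y
    unfolding L1_def L2_def vieta_eq[OF d'] c[symmetric] using d \<mu>(1) by (simp_all add: that \<mu>(2) field_simps power2_eq_square)
  have pw: "L1 ((act a [i, j] ^^ m) p) = L1 p / \<mu> ^ (2 * m) \<and> L2 ((act a [i, j] ^^ m) p) = L2 p * \<mu> ^ (2 * m)
    \<and> (act a [i, j] ^^ m) p k = \<xi>" for m
  proof (induction m)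
    case (Suc m)
    have st: "L1 (act a [i, j] y) = L1 y / \<mu>\<^sup>2 \<and> L2 (act a [i, j] y) = L2 y * \<mu>\<^sup>2 \<and> act a [i, j] y k = \<xi>" if "y k = \<xi>" for y
      using Li[of "vieta a j y"] Lj[of y] that by (simp add: mult.commute)
    have e: "(act a [i, j] ^^ Suc m) p = act a [i, j] ((act a [i, j] ^^ m) p)" by simp
    have "2 * Suc m = 2 * m + 2" by simp
    then show ?case using st[of "(act a [i, j] ^^ m) p"] Suc unfolding e
      by (simp only: power_add) (simp add: mult.assoc divide_divide_eq_left)
  qed (simp add: p)
  have Bp: "cmod ((act a [i, j] ^^ (n * r m)) p l) \<le> B" for m l
    using B[OF pD near, of m l] unfolding act_replicate funpow_mult .
  have nr: "2 * (n * r m) \<ge> m" for m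
  proof -
    have "m \<le> r m" by (rule seq_suble[OF r])
    also have "r m \<le> n * r m" using n by simp
    finally show ?thesis by simp
  qed
  show False
  proof (cases "cmod \<mu> > 1")
    case True
    have "cmod \<mu> ^ (2 * (n * r m)) * cmod (L2 p) \<le> (B + cmod ci) + (B + cmod cj) / cmod \<mu>" for m
    proof -
      let ?y = "(act a [i, j] ^^ (n * r m)) p"
      have "cmod (L2 ?y) \<le> cmod (?y i - ci) + cmod ((?y j - cj) / \<mu>)" unfolding L2_def by (rule norm_triangle_ineq)
      also have "\<dots> \<le> (B + cmod ci) + (B + cmod cj) / cmod \<mu>"
        unfolding norm_divide
        by (intro add_mono divide_right_mono order_trans[OF norm_triangle_ineq4] Bp) auto
      finally show ?thesis using pw[of "n * r m"] by (simp add: norm_mult norm_power mult.commute)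
    qed
    then show False using unbounded_powers[OF True, of "cmod (L2 p)" "\<lambda>m. 2 * (n * r m)"] L0 nr by auto
  next
    case False
    then have m1: "1 / cmod \<mu> > 1" using \<mu>1 \<mu>(1) by simp
    have "(1 / cmod \<mu>) ^ (2 * (n * r m)) * cmod (L1 p) \<le> (B + cmod ci) + cmod \<mu> * (B + cmod cj)" for m
    proof -
      let ?y = "(act a [i, j] ^^ (n * r m)) p"
      have "cmod (L1 ?y) \<le> cmod (?y i - ci) + cmod (\<mu> * (?y j - cj))" unfolding L1_def by (rule norm_triangle_ineq)
      also have "\<dots> \<le> (B + cmod ci) + cmod \<mu> * (B + cmod cj)"
        unfolding norm_mult
        by (intro add_mono mult_left_mono order_trans[OF norm_triangle_ineq4] Bp) auto
      finally show ?thesis using pw[of "n * r m"] by (simp add: norm_divide norm_power power_one_over field_simps)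
    qed
    then show False using unbounded_powers[OF m1, of "cmod (L1 p)" "\<lambda>m. 2 * (n * r m)"] L0 nr by auto
  qed
qed

section \<open>Multipliers at fixed points and Cauchy's estimate\<close>

lemma act_has_field_derivative:
  assumes "\<And>l. ((\<lambda>z. \<gamma> z l) has_field_derivative v l) (at z0)"
  shows "((\<lambda>z. act a w (\<gamma> z) l) has_field_derivative dact a w (\<gamma> z0) v l) (at z0)"
proof (induction w arbitrary: l)
  case (Cons m w)
  show ?case
    unfolding act.simps dact.simps vieta_def dvieta_def
    by (cases "l = m") (auto intro!: derivative_eq_intros Cons simp: algebra_simps)
qed (use assms in simp)

lemma act_holomorphic_on:
  assumes "\<And>l. (\<lambda>z. \<gamma> z l) holomorphic_on A"
  shows "(\<lambda>z. act a w (\<gamma> z) l) holomorphic_on A"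
proof (induction w arbitrary: l)
  case (Cons m w)
  show ?case
    unfolding act.simps vieta_def
    by (cases "l = m") (auto intro!: holomorphic_intros Cons)
qed (use assms in simp)

text \<open>Coordinates i and j run along straight lines, and k is the root of the quadratic
  equation through q. Its derivative needs no computation: differentiating the equation of the
  surface determines it, as the gradient is non-zero at k.\<close>

lemma tangent_disc:
  assumes q: "cubic a q = D" and g: "grad a q k \<noteq> 0" and e: "pair (grad a q) e = 0"
  shows "\<exists>\<gamma> \<rho>. \<rho> > 0 \<and> \<gamma> 0 = q \<and> (\<forall>l. (\<lambda>z. \<gamma> z l) holomorphic_on ball 0 \<rho>)
    \<and> (\<forall>l. ((\<lambda>z. \<gamma> z l) has_field_derivative e l) (at 0)) \<and> (\<forall>z\<in>ball 0 \<rho>. cubic a (\<gamma> z) = D)"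
proof -
  define i where "i = nxt k"
  define j where "j = nxt i"
  have d: "i \<noteq> j" "j \<noteq> k" "i \<noteq> k" by (cases k; simp add: j_def i_def)+
  have d': "k \<noteq> i" "i \<noteq> j" "k \<noteq> j" using d by auto
  define G where "G = grad a q k"
  define pi pj where "pi z = q i + z * e i" and "pj z = q j + z * e j" for z
  define b where "b z = pi z * pj z - a k" for z
  define c where "c z = (pi z)\<^sup>2 + (pj z)\<^sup>2 - a i * pi z - a j * pj z - D" for z
  \<comment> \<open>The discriminant normalized to be 1 at 0, so that \<open>csqrt\<close> is
    holomorphic nearby and selects the root \<open>q k\<close>.\<close>
  define h where "h z = ((b z)\<^sup>2 - 4 * c z) / G\<^sup>2" for z
  have Gb: "G = 2 * q k + b 0" unfolding G_def grad_eq[OF d'] by (simp add: b_def pi_def pj_def)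
  have "(q k)\<^sup>2 + b 0 * q k + c 0 = 0"
    using q unfolding cubic_eq[OF d] by (simp add: b_def c_def pi_def pj_def algebra_simps)
  then have "(b 0)\<^sup>2 - 4 * c 0 = G\<^sup>2" unfolding Gb by (simp add: power2_eq_square) algebra
  then have h0: "h 0 = 1" using g by (simp add: h_def G_def)
  have hh: "h holomorphic_on UNIV"
    unfolding h_def b_def c_def pi_def pj_def by (intro holomorphic_intros) (use g in \<open>auto simp: G_def\<close>)
  then have "isCont h 0"
    by (metis UNIV_I continuous_on_eq_continuous_at holomorphic_on_imp_continuous_on open_UNIV)
  then obtain \<rho> where \<rho>: "\<rho> > 0" "\<And>z. cmod z < \<rho> \<Longrightarrow> cmod (h z - 1) < 1"
    unfolding continuous_at_eps_delta dist_norm h0 by (metis diff_zero zero_less_one)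
  have hpos: "h z \<notin> \<real>\<^sub>\<le>\<^sub>0" if "z \<in> ball 0 \<rho>" for z
  proof
    assume "h z \<in> \<real>\<^sub>\<le>\<^sub>0"
    then have "Re (h z) \<le> 0" by (simp add: complex_nonpos_Reals_iff)
    then have "1 \<le> \<bar>Re (h z - 1)\<bar>" by simp
    then show False using abs_Re_le_cmod[of "h z - 1"] \<rho>(2)[of z] that by simp
  qed
  define pk where "pk z = (- b z + G * csqrt (h z)) / 2" for z
  define \<gamma> where "\<gamma> z = (\<lambda>l. if l = k then pk z else if l = i then pi z else pj z)" for z
  have gl: "\<gamma> z k = pk z" "\<gamma> z i = pi z" "\<gamma> z j = pj z" for z using d by (auto simp: \<gamma>_def)
  have pk0: "pk 0 = q k" using h0 Gb by (simp add: pk_def)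
  have g0: "\<gamma> 0 = q"
  proof
    fix l show "\<gamma> 0 l = q l" using letter_cases3[OF d, of l] gl[of 0] pk0 by (auto simp: pi_def pj_def)
  qed
  have "pk holomorphic_on ball 0 \<rho>"
    unfolding pk_def
    by (intro holomorphic_intros holomorphic_on_subset[OF hh] hpos) (auto simp: b_def pi_def pj_def intro!: holomorphic_intros)
  then have hol: "(\<lambda>z. \<gamma> z l) holomorphic_on ball 0 \<rho>" for l
    using letter_cases3[OF d, of l] unfolding pi_def pj_def
    by (auto simp: gl pi_def pj_def intro!: holomorphic_intros)
  have cub: "cubic a (\<gamma> z) = D" for z
  proof -
    have "2 * pk z + b z = G * csqrt (h z)" by (simp add: pk_def field_simps)
    then have "(2 * pk z + b z)\<^sup>2 = G\<^sup>2 * (csqrt (h z))\<^sup>2" by (simp only: power_mult_distrib)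
    also have "\<dots> = (b z)\<^sup>2 - 4 * c z" using g by (simp add: h_def G_def)
    finally have "4 * ((pk z)\<^sup>2 + b z * pk z + c z) = 0" by (simp add: power2_eq_square algebra_simps)
    then have "(pk z)\<^sup>2 + b z * pk z + c z = 0" unfolding mult_eq_0_iff by simp
    then show ?thesis unfolding cubic_eq[OF d] gl by (simp add: b_def c_def algebra_simps)
  qed
  define v where "v l = deriv (\<lambda>z. \<gamma> z l) 0" for l
  have dv: "((\<lambda>z. \<gamma> z l) has_field_derivative v l) (at 0)" for l
    unfolding v_def by (rule holomorphic_derivI[OF hol]) (use \<rho> in auto)
  have vij: "v i = e i" "v j = e j"
    unfolding v_def gl pi_def pj_def by (auto intro!: DERIV_imp_deriv derivative_eq_intros)
  have "((\<lambda>z. cubic a (\<gamma> z)) has_field_derivative pair (grad a q) v) (at 0)"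
    unfolding cubic_def power2_eq_square
    by (rule derivative_eq_intros dv HOL.refl)+ (simp add: g0 pair_def grad_def algebra_simps)
  moreover have "((\<lambda>z. cubic a (\<gamma> z)) has_field_derivative 0) (at 0)" unfolding cub by simp
  ultimately have v0: "pair (grad a q) v = 0" by (rule DERIV_unique)
  have "G * (v k - e k) = pair (grad a q) v - pair (grad a q) e"
    unfolding pair_eq[OF d] G_def vij by (simp add: algebra_simps)
  then have "G * (v k - e k) = 0" using v0 e by simp
  then have "v k = e k" using g by (simp add: G_def)
  then have "v l = e l" for l using letter_cases3[OF d, of l] vij by auto
  then show ?thesis using \<rho>(1) g0 hol dv cub by (intro exI[of _ \<gamma>] exI[of _ \<rho>]) auto
qed

lemma det3_kernel:
  assumes "det3 u v w = (0 :: complex)"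
  shows "\<exists>\<alpha>. (\<exists>l. \<alpha> l \<noteq> 0) \<and> (\<forall>m. \<alpha> Lx * u m + \<alpha> Ly * v m + \<alpha> Lz * w m = 0)"
proof -
  define A :: "complex^3^3" where "A = vector [vector [u Lx, v Lx, w Lx], vector [u Ly, v Ly, w Ly], vector [u Lz, v Lz, w Lz]]"
  have A: "A $ 1 $ 1 = u Lx" "A $ 1 $ 2 = v Lx" "A $ 1 $ 3 = w Lx"
    "A $ 2 $ 1 = u Ly" "A $ 2 $ 2 = v Ly" "A $ 2 $ 3 = w Ly"
    "A $ 3 $ 1 = u Lz" "A $ 3 $ 2 = v Lz" "A $ 3 $ 3 = w Lz"
    by (simp_all add: A_def vector_3)
  have "det A = 0" using assms unfolding det_3 A det3_def by (simp add: algebra_simps)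
  then have "\<not> (\<exists>B. B ** A = mat 1)"
    using invertible_det_nz[of A] matrix_left_right_inverse[of _ A] unfolding invertible_def by blast
  then obtain x where x: "A *v x = 0" "x \<noteq> 0" using matrix_left_invertible_ker by blast
  have row: "A $ i $ 1 * x $ 1 + A $ i $ 2 * x $ 2 + A $ i $ 3 * x $ 3 = 0" for i
    using x(1) by (simp add: vec_eq_iff matrix_vector_mult_def sum_3)
  define \<alpha> where "\<alpha> = (\<lambda>l. case l of Lx \<Rightarrow> x $ 1 | Ly \<Rightarrow> x $ 2 | Lz \<Rightarrow> x $ 3)"
  have "\<exists>l. \<alpha> l \<noteq> 0"
  proof (rule ccontr)
    assume "\<not> ?thesis"
    then have "\<alpha> Lx = 0" "\<alpha> Ly = 0" "\<alpha> Lz = 0" by auto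
    then show False using x(2) by (simp add: \<alpha>_def vec_eq_iff forall_3)
  qed
  moreover have "\<alpha> Lx * u m + \<alpha> Ly * v m + \<alpha> Lz * w m = 0" for m
    using row[of 1] row[of 2] row[of 3] unfolding A by (cases m) (simp_all add: \<alpha>_def mult.commute)
  ultimately show ?thesis by blast
qed

lemma det3_annihilated:
  assumes "pair g u = 0" "pair g v = 0" "pair g w = 0" "g l \<noteq> (0 :: complex)"
  shows "det3 u v w = 0"
proof -
  have "g Lx * det3 u v w = pair g u * (v Ly * w Lz - v Lz * w Ly) - pair g v * (u Ly * w Lz - u Lz * w Ly) + pair g w * (u Ly * v Lz - u Lz * v Ly)"
    "g Ly * det3 u v w = - pair g u * (v Lx * w Lz - v Lz * w Lx) + pair g v * (u Lx * w Lz - u Lz * w Lx) - pair g w * (u Lx * v Lz - u Lz * v Lx)"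
    "g Lz * det3 u v w = pair g u * (v Lx * w Ly - v Ly * w Lx) - pair g v * (u Lx * w Ly - u Ly * w Lx) + pair g w * (u Lx * v Ly - u Ly * v Lx)"
    by (simp_all add: det3_def pair_def algebra_simps)
  then show ?thesis using assms by (cases l) auto
qed

theorem bounded_powers_trace:
  assumes q: "cubic a q = D" and g: "grad a q k \<noteq> 0" and ev: "even (length c)" and fx: "act a c q = q"
    and bd: "locally_bounded_powers a D c q"
  shows "\<exists>t. dtrace a c q = complex_of_real t \<and> - 1 \<le> t \<and> t \<le> 3"
proof (rule ccontr)
  assume neg: "\<not> ?thesis"
  let ?T = "dtrace a c q"
  obtain u where u: "u \<noteq> 0" "?T - 1 = u + 1 / u" using joukowski_exists by blast
  have u1: "cmod u \<noteq> 1"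
  proof
    assume "cmod u = 1"
    from joukowski_unimodular[OF this] u(2) have "?T = complex_of_real (1 + 2 * Re u)" "\<bar>Re u\<bar> \<le> 1"
      by (auto simp: algebra_simps)
    then have "?T = complex_of_real (1 + 2 * Re u) \<and> - 1 \<le> 1 + 2 * Re u \<and> 1 + 2 * Re u \<le> 3" by auto
    then show False using neg by blast
  qed
  obtain \<kappa> where \<kappa>: "cmod \<kappa> > 1" "\<kappa>\<^sup>2 - (?T - 1) * \<kappa> + 1 = 0"
  proof (cases "cmod u > 1")
    case True
    then show ?thesis using that[of u] u by (simp add: field_simps power2_eq_square)
  next
    case False
    then have "cmod (1 / u) > 1" using u u1 by (simp add: norm_divide)
    then show ?thesis using that[of "1 / u"] u by (simp add: field_simps power2_eq_square)
  qed
  define N where "N = dact a c q"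
  define col where "col s l = (\<lambda>m. N (single l) m - s * single l m)" for s l
  \<comment> \<open>The sum of the principal 2 by 2 minors. It equals the trace because 1 is an
    eigenvalue and the determinant is 1.\<close>
  define c2 where "c2 = N (single Lx) Lx * N (single Ly) Ly - N (single Ly) Lx * N (single Lx) Ly
    + N (single Lx) Lx * N (single Lz) Lz - N (single Lz) Lx * N (single Lx) Lz
    + N (single Ly) Ly * N (single Lz) Lz - N (single Lz) Ly * N (single Ly) Lz"
  have char: "det3 (col s Lx) (col s Ly) (col s Lz) = 1 - s * c2 + s\<^sup>2 * ?T - s ^ 3" for s
  proof -
    have "det3 (col s Lx) (col s Ly) (col s Lz)
      = det3 (N (single Lx)) (N (single Ly)) (N (single Lz)) - s * c2 + s\<^sup>2 * ?T - s ^ 3"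
      unfolding det3_def col_def c2_def dtrace_def N_def[symmetric]
      by (simp add: single_def algebra_simps power2_eq_square power3_eq_cube)
    then show ?thesis using det3_dact_single[OF ev, of a q] unfolding N_def by simp
  qed
  have inv: "pair (grad a q) (N v) = pair (grad a q) v" for v
    using pair_grad_dact[of a c q v] fx by (simp add: N_def)
  have "pair (grad a q) (col 1 l) = 0" for l
    using inv[of "single l"] by (simp add: pair_def col_def algebra_simps)
  then have "det3 (col 1 Lx) (col 1 Ly) (col 1 Lz) = 0"
    by (intro det3_annihilated[of "grad a q"]) (use g in auto)
  then have "c2 = ?T" unfolding char by simp
  then have "det3 (col \<kappa> Lx) (col \<kappa> Ly) (col \<kappa> Lz) = - (\<kappa> - 1) * (\<kappa>\<^sup>2 - (?T - 1) * \<kappa> + 1)"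
    unfolding char by (simp add: algebra_simps power2_eq_square power3_eq_cube)
  then have "det3 (col \<kappa> Lx) (col \<kappa> Ly) (col \<kappa> Lz) = 0" using \<kappa>(2) by simp
  then obtain \<alpha> l where \<alpha>: "\<alpha> l \<noteq> 0" "\<And>m. \<alpha> Lx * col \<kappa> Lx m + \<alpha> Ly * col \<kappa> Ly m + \<alpha> Lz * col \<kappa> Lz m = 0"
    using det3_kernel by blast
  have eig: "N \<alpha> = (\<lambda>m. \<kappa> * \<alpha> m)"
  proof
    fix m
    have "N \<alpha> m = \<alpha> Lx * N (single Lx) m + \<alpha> Ly * N (single Ly) m + \<alpha> Lz * N (single Lz) m"
      unfolding N_def by (rule dact_expand)
    then show "N \<alpha> m = \<kappa> * \<alpha> m"
      using \<alpha>(2)[of m] by (cases m) (simp_all add: col_def single_def algebra_simps)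
  qed
  \<comment> \<open>An eigenvector for an eigenvalue other than 1 is killed by the invariant
    gradient, so it is tangent to the surface.\<close>
  have "pair (grad a q) \<alpha> = \<kappa> * pair (grad a q) \<alpha>"
    using inv[of \<alpha>] unfolding eig by (simp add: pair_def algebra_simps)
  moreover have "\<kappa> \<noteq> 1" using \<kappa>(1) by auto
  ultimately have "pair (grad a q) \<alpha> = 0" by simp
  from tangent_disc[OF q g this] obtain \<gamma> \<rho> where \<gamma>: "\<rho> > 0" "\<gamma> 0 = q" "\<And>l. (\<lambda>z. \<gamma> z l) holomorphic_on ball 0 \<rho>"
    "\<And>l. ((\<lambda>z. \<gamma> z l) has_field_derivative \<alpha> l) (at 0)" "\<And>z. z \<in> ball 0 \<rho> \<Longrightarrow> cubic a (\<gamma> z) = D"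
    by blast
  obtain r \<epsilon> B where r: "strict_mono (r :: nat \<Rightarrow> nat)" and \<epsilon>: "\<epsilon> > 0"
    and B: "\<And>q' m l. cubic a q' = D \<Longrightarrow> (\<And>l. cmod (q' l - q l) < \<epsilon>) \<Longrightarrow> cmod ((act a c ^^ r m) q' l) \<le> B"
    using bd unfolding locally_bounded_powers_def by blast
  have "\<forall>\<^sub>F z in nhds 0. cmod (\<gamma> z m - q m) < \<epsilon>" for m
  proof -
    have "isCont (\<lambda>z. \<gamma> z m) 0" using DERIV_isCont[OF \<gamma>(4)] .
    then have "((\<lambda>z. \<gamma> z m) \<longlongrightarrow> q m) (nhds 0)" 
      using tendsto_at_iff_tendsto_nhds[of "\<lambda>z. \<gamma> z m" 0] \<gamma>(2) by (simp add: isCont_def)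
    then show ?thesis using \<epsilon> by (auto simp: tendsto_iff dist_norm)
  qed
  then have "\<forall>\<^sub>F z in nhds 0. \<forall>m. cmod (\<gamma> z m - q m) < \<epsilon>" by (simp add: eventually_all_finite)
  then obtain \<delta> where \<delta>: "\<delta> > 0" "\<And>z m. cmod z < \<delta> \<Longrightarrow> cmod (\<gamma> z m - q m) < \<epsilon>"
    unfolding eventually_nhds_metric by auto
  define R where "R = min \<rho> \<delta> / 2"
  have R: "R > 0" "R < \<rho>" "R < \<delta>" using \<gamma>(1) \<delta>(1) by (auto simp: R_def)
  define F where "F n z = (act a c ^^ n) (\<gamma> z) l" for n z
  have N: "dact a (concat (replicate n c)) q \<alpha> = (\<lambda>m. \<kappa> ^ n * \<alpha> m)" for n
  proof (induction n)
    case (Suc n)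
    have fixn: "act a (concat (replicate n c)) q = q"
      unfolding act_replicate using fx by (induction n) auto
    have "dact a (concat (replicate (Suc n) c)) q \<alpha> = N (\<lambda>m. \<kappa> ^ n * \<alpha> m)"
      using Suc fixn by (simp add: dact_append N_def)
    also have "\<dots> = (\<lambda>m. \<kappa> ^ n * N \<alpha> m)" unfolding N_def by (rule dact_scale)
    finally show ?case unfolding eig by (simp add: fun_eq_iff algebra_simps)
  qed simp
  have dF: "(F n has_field_derivative \<kappa> ^ n * \<alpha> l) (at 0)" for n
  proof -
    have "((\<lambda>z. act a (concat (replicate n c)) (\<gamma> z) l) has_field_derivative dact a (concat (replicate n c)) (\<gamma> 0) \<alpha> l) (at 0)"
      by (rule act_has_field_derivative) (rule \<gamma>(4))
    then show ?thesis unfolding \<gamma>(2) N act_replicate F_def[abs_def] .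
  qed
  have hF: "F n holomorphic_on ball 0 \<rho>" for n
    using act_holomorphic_on[of \<gamma> "ball 0 \<rho>" a "concat (replicate n c)" l, OF \<gamma>(3)]
    unfolding act_replicate F_def[abs_def] .
  have est: "cmod \<kappa> ^ r m * cmod (\<alpha> l) \<le> B / R" for m
  proof -
    have "norm ((deriv ^^ 1) (F (r m)) 0) \<le> fact 1 * B / R ^ 1"
    proof (rule Cauchy_inequality)
      show "F (r m) holomorphic_on ball 0 R" using hF R by (meson holomorphic_on_subset less_imp_le subset_ball)
      show "continuous_on (cball 0 R) (F (r m))"
        using continuous_on_subset[OF holomorphic_on_imp_continuous_on[OF hF]] R cball_subset_ball_iff[of 0 R 0 \<rho>]
        by (simp add: dist_norm)
      show "norm (F (r m) z) \<le> B" if "norm (0 - z) = R" for z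
        unfolding F_def by (rule B) (use that R \<gamma>(5) \<delta>(2) in auto)
    qed (use R in auto)
    then show ?thesis using DERIV_imp_deriv[OF dF] by (simp add: norm_mult norm_power)
  qed
  show False
    by (rule unbounded_powers[OF \<kappa>(1), of "cmod (\<alpha> l)" r "B / R"]) (use est \<alpha>(1) seq_suble[OF r] in auto)
qed

section \<open>The group and its Fatou set\<close>

lemma not_distinct_adjD: "\<not> distinct_adj w \<Longrightarrow> \<exists>u l v. w = u @ l # l # v"
proof (induction w rule: induct_list012)
  case (3 x y zs)
  show ?case
  proof (cases "x = y")
    case True
    then show ?thesis by (intro exI[of _ "[]"]) auto
  next
    case False
    then obtain u l v where "y # zs = u @ l # l # v" using 3 by auto
    then show ?thesis by (intro exI[of _ "x # u"]) auto
  qed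
qed auto

text \<open>Equal neighbours cancel, and equal end letters are moved into the conjugator; both
  shorten the word by two, so even length excludes a single remaining letter.\<close>

lemma cyclic_reduction:
  fixes w :: "letter list"
  assumes "even (length w)"
  shows "(\<forall>a p. act a w p = (p :: letter \<Rightarrow> complex)) \<or>
    (\<exists>h c. c \<noteq> [] \<and> even (length c) \<and> distinct_adj c \<and> hd c \<noteq> last c \<and>
      (\<forall>a p. act a w p = act a h (act a c (act a (rev h) (p :: letter \<Rightarrow> complex)))))"
  using assms
proof (induction "length w" arbitrary: w rule: less_induct)
  case less
  consider "w = []" | "\<not> distinct_adj w" | "w \<noteq> []" "distinct_adj w" "hd w \<noteq> last w" | "w \<noteq> []" "distinct_adj w" "hd w = last w"
    by blast
  then show ?case
  proof cases
    case 1
    then show ?thesis by simp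
  next
    case 2
    then obtain u l v where w: "w = u @ l # l # v" using not_distinct_adjD by blast
    have "act a w p = act a (u @ v) p" for a and p :: "letter \<Rightarrow> complex"
      unfolding w by (simp add: act_append vieta_vieta)
    then show ?thesis using less(1)[of "u @ v"] less(2) w by simp
  next
    case 3
    then show ?thesis using less(2) by (intro disjI2 exI[of _ "[]"] exI[of _ w]) auto
  next
    case 4
    then obtain l w' where w': "w = l # w'" by (cases w) auto
    then have "w' \<noteq> []" using less(2) by auto
    then obtain v where v: "w = l # v @ [l]" using 4 w' by (metis append_butlast_last_id last.simps list.sel(1))
    have *: "act a w p = act a [l] (act a v (act a [l] p))" for a and p :: "letter \<Rightarrow> complex"
      unfolding v by (simp add: act_append)
    have "even (length v)" "length v < length w" using less(2) v by auto
    from less(1)[OF this(2,1)] show ?thesis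
    proof
      assume "\<forall>a p. act a v p = (p :: letter \<Rightarrow> complex)"
      then show ?thesis unfolding * by (simp add: vieta_vieta)
    next
      assume "\<exists>h c. c \<noteq> [] \<and> even (length c) \<and> distinct_adj c \<and> hd c \<noteq> last c \<and>
        (\<forall>a p. act a v p = act a h (act a c (act a (rev h) (p :: letter \<Rightarrow> complex))))"
      then obtain h c where c: "c \<noteq> []" "even (length c)" "distinct_adj c" "hd c \<noteq> last c"
        "\<And>a p. act a v p = act a h (act a c (act a (rev h) (p :: letter \<Rightarrow> complex)))" by blast
      then show ?thesis unfolding *
        by (intro disjI2 exI[of _ "l # h"] exI[of _ c]) (auto simp: act_append)
    qed
  qed
qed

text \<open>A rotation of a word is a conjugate; the normal form is the one used in the ping-pong of
  \<open>monomial_trace\<close>.\<close>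

lemma rotate_to_Lz:
  assumes c: "distinct_adj c" "hd c \<noteq> last c" "set c = UNIV" "even (length c)"
  obtains u c' where "distinct_adj c'" "hd c' = Lz" "last c' \<noteq> Lz" "set c' = UNIV" "even (length c')"
    "\<And>a p. act a c p = act a u (act a c' (act a (rev u) (p :: letter \<Rightarrow> complex)))"
proof -
  obtain u v where uv: "c = u @ Lz # v" using c(3) by (metis UNIV_I split_list)
  let ?c = "(Lz # v) @ u"
  have s: "distinct_adj u" "distinct_adj (Lz # v)" "u = [] \<or> last u \<noteq> Lz"
    using c(1) unfolding uv by (auto simp: distinct_adj_append_iff)
  have "distinct_adj ?c"
    using s c(2) unfolding distinct_adj_append_iff uv by (cases "u = []") auto
  moreover have "last ?c \<noteq> Lz" using s c(2) unfolding uv by (cases "u = []") auto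
  moreover have "set ?c = UNIV" using c(3) unfolding uv by auto
  moreover have "even (length ?c)" using c(4) unfolding uv by simp
  moreover have "act a c p = act a u (act a ?c (act a (rev u) p))" for a and p :: "letter \<Rightarrow> complex"
    unfolding uv by (simp only: act_append act_rev')
  ultimately show ?thesis using that[of ?c u] by simp
qed

lemma alternating_word:
  assumes "distinct_adj c" "set c \<subseteq> {i, j}" "even (length c)" "c \<noteq> [] \<Longrightarrow> hd c = i" "i \<noteq> j"
  shows "\<exists>n. c = concat (replicate n [i, j])"
  using assms
proof (induction c rule: induct_list012)
  case 1
  show ?case by (intro exI[of _ 0]) simp
next
  case (3 x y zs)
  have xy: "x = i" "y = j" using 3(3-) by auto
  have "\<exists>n. zs = concat (replicate n [i, j])"
    by (rule 3(1)) (use 3(3-) xy in \<open>cases zs; auto\<close>)+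
  then obtain n where "zs = concat (replicate n [i, j])" by blast
  then show ?case using xy by (intro exI[of _ "Suc n"]) simp
qed auto

section \<open>From words to the group and the Fatou set of the surface\<close>

definition tuple :: "(letter \<Rightarrow> complex) \<Rightarrow> complex3" where
  "tuple p = (p Lx, p Ly, p Lz)"

definition untuple :: "complex3 \<Rightarrow> letter \<Rightarrow> complex" where
  "untuple x = (\<lambda>l. case l of Lx \<Rightarrow> fst x | Ly \<Rightarrow> fst (snd x) | Lz \<Rightarrow> snd (snd x))"

lemma tuple_untuple [simp]: "tuple (untuple x) = x" "untuple (tuple p) = p"
  by (auto simp: tuple_def untuple_def fun_eq_iff split: letter.split)

definition wmap :: "complex4 \<Rightarrow> letter list \<Rightarrow> complex3 \<Rightarrow> complex3" where
  "wmap P w x = tuple (act (params P) w (untuple x))"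

definition const_term :: "complex4 \<Rightarrow> complex" where
  "const_term P = snd (snd (snd P))"

lemma cubic_surface_iff: "x \<in> cubic_surface P \<longleftrightarrow> cubic (params P) (untuple x) = const_term P"
  by (cases P; cases x) (auto simp: cubic_surface_def cubic_def untuple_def const_term_def algebra_simps)

lemma wmap_Nil [simp]: "wmap P [] x = x"
  by (simp add: wmap_def)

lemma wmap_append: "wmap P (u @ w) x = wmap P u (wmap P w x)"
  by (simp add: wmap_def act_append)

lemma wmap_rev [simp]: "wmap P (rev w) (wmap P w x) = x"
  by (simp add: wmap_def)

lemma wmap_surface: "x \<in> cubic_surface P \<Longrightarrow> wmap P w x \<in> cubic_surface P"
  by (simp add: wmap_def cubic_surface_iff)

lemma wmap_replicate: "wmap P (concat (replicate n w)) = wmap P w ^^ n"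
proof (induction n)
  case (Suc n)
  show ?case by (rule ext) (simp add: wmap_append Suc)
qed (rule ext, simp)

lemma wmap_involutions:
  "wmap P [Lx] = s_x P" "wmap P [Ly] = s_y P" "wmap P [Lz] = s_z P"
  by (rule ext, rename_tac x, case_tac P, case_tac x,
      simp add: wmap_def vieta_def tuple_def untuple_def s_x_def s_y_def s_z_def algebra_simps)+

lemma wmap_generators:
  "wmap P [Lz, Ly] = g_x P" "wmap P [Lx, Lz] = g_y P" "wmap P [Ly, Lx] = g_z P"
  using wmap_append[of P "[Lz]" "[Ly]"] wmap_append[of P "[Lx]" "[Lz]"] wmap_append[of P "[Ly]" "[Lx]"]
  by (auto simp: fun_eq_iff wmap_involutions g_x_def g_y_def g_z_def)

lemma continuous_on_wmap [continuous_intros]: "continuous_on A (wmap P w)"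
proof -
  have "continuous_on UNIV (wmap P w)"
  proof (induction w)
    case Nil
    have "wmap P [] = (\<lambda>x. x)" by auto
    then show ?case by simp
  next
    case (Cons l w)
    obtain a b c d where P: "P = (a, b, c, d)" by (metis prod_cases4)
    have "continuous_on UNIV (wmap P [l])"
    proof (cases l)
      case Lx
      have "wmap P [Lx] = (\<lambda>x. (- fst x - fst (snd x) * snd (snd x) + a, fst (snd x), snd (snd x)))"
        unfolding wmap_involutions by (auto simp: s_x_def P)
      then show ?thesis unfolding Lx by (simp add: continuous_intros)
    next
      case Ly
      have "wmap P [Ly] = (\<lambda>x. (fst x, - fst (snd x) - fst x * snd (snd x) + b, snd (snd x)))"
        unfolding wmap_involutions by (auto simp: s_y_def P)
      then show ?thesis unfolding Ly by (simp add: continuous_intros)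
    next
      case Lz
      have "wmap P [Lz] = (\<lambda>x. (fst x, fst (snd x), - snd (snd x) - fst x * fst (snd x) + c))"
        unfolding wmap_involutions by (auto simp: s_z_def P)
      then show ?thesis unfolding Lz by (simp add: continuous_intros)
    qed
    then have "continuous_on UNIV (wmap P [l] \<circ> wmap P w)"
      using Cons by (metis continuous_on_compose continuous_on_subset subset_UNIV)
    moreover have "wmap P [l] \<circ> wmap P w = wmap P (l # w)"
      using wmap_append[of P "[l]" w] by (auto simp: fun_eq_iff)
    ultimately show ?case by simp
  qed
  then show ?thesis using continuous_on_subset by blast
qed

lemma closed_cubic_surface: "closed (cubic_surface P)"
proof -
  obtain a b c d where P: "P = (a, b, c, d)" by (metis prod_cases4)
  have "cubic_surface P = {x. (fst x)\<^sup>2 + (fst (snd x))\<^sup>2 + (snd (snd x))\<^sup>2 + fst x * fst (snd x) * snd (snd x)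
      = a * fst x + b * fst (snd x) + c * snd (snd x) + d}"
    by (auto simp: cubic_surface_def P)
  also have "closed \<dots>" by (intro closed_Collect_eq continuous_intros)
  finally show ?thesis .
qed

lemma BijGroup_simps:
  "\<one>\<^bsub>BijGroup S\<^esub> = (\<lambda>x\<in>S. x)"
  "g \<in> carrier (BijGroup S) \<Longrightarrow> f \<in> carrier (BijGroup S) \<Longrightarrow> g \<otimes>\<^bsub>BijGroup S\<^esub> f = compose S g f"
  by (auto simp: BijGroup_def)

lemma surface_group_word:
  assumes "f \<in> surface_group P"
  shows "\<exists>w. even (length w) \<and> (\<forall>x\<in>cubic_surface P. f x = wmap P w x)"
proof -
  let ?S = "cubic_surface P"
  let ?gen = "{restrict (g_x P) ?S, restrict (g_y P) ?S, restrict (g_z P) ?S}"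
  have gen: "\<exists>w. even (length w) \<and> (\<forall>x\<in>?S. h x = wmap P w x)" if "h \<in> ?gen" for h
  proof -
    consider "h = restrict (wmap P [Lz, Ly]) ?S" | "h = restrict (wmap P [Lx, Lz]) ?S" | "h = restrict (wmap P [Ly, Lx]) ?S"
      using \<open>h \<in> ?gen\<close> unfolding wmap_generators by blast
    then show ?thesis by cases (force intro: exI[of _ "[_, _]"])+
  qed
  have "f \<in> generate (BijGroup ?S) ?gen" using assms by (simp add: surface_group_def)
  then show ?thesis
  proof (induction rule: generate.induct)
    case one
    show ?case by (intro exI[of _ "[]"]) (auto simp: BijGroup_simps)
  next
    case (incl h)
    then show ?case by (rule gen)
  next
    case (inv h)
    then obtain w where w: "even (length w)" "\<And>x. x \<in> ?S \<Longrightarrow> h x = wmap P w x" using gen by blast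
    have hB: "h \<in> Bij ?S" using inv generators_in_carrier[of P] by (auto simp: BijGroup_def)
    have "(inv\<^bsub>BijGroup ?S\<^esub> h) x = wmap P (rev w) x" if x: "x \<in> ?S" for x
    proof -
      have im: "h ` ?S = ?S" using hB by (auto simp: Bij_def bij_betw_def)
      then have y: "inv_into ?S h x \<in> ?S" "h (inv_into ?S h x) = x"
        using x by (auto intro: inv_into_into f_inv_into_f)
      then have "wmap P (rev w) x = inv_into ?S h x" using w(2) by (metis wmap_rev)
      then show ?thesis using inv_BijGroup[OF hB] x by simp
    qed
    then show ?case using w(1) by (intro exI[of _ "rev w"]) auto
  next
    case (eng h1 h2)
    then obtain w1 w2 where w: "even (length w1)" "even (length w2)"
      "\<And>x. x \<in> ?S \<Longrightarrow> h1 x = wmap P w1 x" "\<And>x. x \<in> ?S \<Longrightarrow> h2 x = wmap P w2 x" by blast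
    have "h1 \<in> surface_group P" "h2 \<in> surface_group P" using eng by (simp_all add: surface_group_def)
    then have "h1 \<in> carrier (BijGroup ?S)" "h2 \<in> carrier (BijGroup ?S)"
      using subgroup.subset[OF surface_group_subgroup] by blast+
    then have "(h1 \<otimes>\<^bsub>BijGroup ?S\<^esub> h2) x = wmap P (w1 @ w2) x" if "x \<in> ?S" for x
      using that w by (simp add: BijGroup_simps compose_def wmap_append wmap_surface)
    then show ?case using w(1,2) by (intro exI[of _ "w1 @ w2"]) auto
  qed
qed

lemma surface_group_extensional: "f \<in> surface_group P \<Longrightarrow> f \<in> extensional (cubic_surface P)"
  using subgroup.subset[OF surface_group_subgroup[of P]] by (auto simp: BijGroup_def Bij_def)

lemma surface_group_power:
  assumes "f \<in> surface_group P"
  shows "restrict (f ^^ n) (cubic_surface P) \<in> surface_group P"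
proof (induction n)
  case 0
  have "restrict (f ^^ 0) (cubic_surface P) = \<one>\<^bsub>BijGroup (cubic_surface P)\<^esub>"
    by (auto simp: BijGroup_simps)
  then show ?case using subgroup.one_closed[OF surface_group_subgroup] by metis
next
  case (Suc n)
  let ?S = "cubic_surface P"
  have c: "f \<in> carrier (BijGroup ?S)" "restrict (f ^^ n) ?S \<in> carrier (BijGroup ?S)"
    using Suc assms subgroup.subset[OF surface_group_subgroup[of P]] by blast+
  have "restrict (f ^^ Suc n) ?S = f \<otimes>\<^bsub>BijGroup ?S\<^esub> restrict (f ^^ n) ?S"
    unfolding BijGroup_simps(2)[OF c] by (auto simp: compose_def fun_eq_iff restrict_def)
  then show ?case using subgroup.m_closed[OF surface_group_subgroup assms Suc] by metis
qed

text \<open>The fixed point rules out convergence to infinity. Under uniform convergence near p, all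
  late iterates stay close to one of them, which is continuous and hence bounded on a compact
  neighbourhood.\<close>

lemma fatou_bounded_powers:
  assumes p: "p \<in> fatou_set P" and f: "f \<in> surface_group P" and fx: "f p = p"
  obtains r \<delta> B where "strict_mono (r :: nat \<Rightarrow> nat)" "\<delta> > 0"
    "\<And>x m. x \<in> cubic_surface P \<Longrightarrow> dist x p < \<delta> \<Longrightarrow> norm ((f ^^ r m) x) \<le> B"
proof -
  let ?S = "cubic_surface P"
  obtain U where U: "openin (top_of_set ?S) U" "p \<in> U" "normal_family_on ?S U (surface_group P)" and pS: "p \<in> ?S"
    using p by (auto simp: fatou_set_def)
  define F where "F n = restrict (f ^^ n) ?S" for n
  have "range F \<subseteq> surface_group P" using surface_group_power[OF f] by (auto simp: F_def)
  then obtain r where r: "strict_mono r"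
    "converges_uniformly_on_compacts U (F \<circ> r) \<or> converges_to_infinity_on ?S U (F \<circ> r)"
    using U(3) unfolding normal_family_on_def by blast
  have Fp: "F n p = p" for n
  proof -
    have "(f ^^ n) p = p" using fx by (induction n) auto
    then show ?thesis using pS by (simp add: F_def)
  qed
  have "\<not> converges_to_infinity_on ?S U (F \<circ> r)"
  proof
    assume "converges_to_infinity_on ?S U (F \<circ> r)"
    then have "finite {i. (F \<circ> r) i ` {p} \<inter> {p} \<noteq> {}}"
      unfolding converges_to_infinity_on_def using U(2) pS by (metis compact_sing empty_subsetI insert_subset)
    then show False by (simp add: Fp)
  qed
  then obtain h where h: "\<And>V. compact V \<Longrightarrow> V \<subseteq> U \<Longrightarrow> uniform_limit V (F \<circ> r) h sequentially"
    using r(2) unfolding converges_uniformly_on_compacts_def by blast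
  obtain e where e: "e > 0" "\<And>x. x \<in> ?S \<Longrightarrow> dist x p < e \<Longrightarrow> x \<in> U"
    using U(1,2) unfolding openin_euclidean_subtopology_iff by blast
  define V where "V = ?S \<inter> cball p (e / 2)"
  have V: "compact V" unfolding V_def by (intro closed_Int_compact closed_cubic_surface) auto
  have VU: "V \<subseteq> U" using e by (force simp: V_def dist_commute)
  have "\<forall>\<^sub>F n in sequentially. \<forall>x\<in>V. dist ((F \<circ> r) n x) (h x) < 1"
    using uniform_limitD[OF h[OF V VU], of 1] by simp
  then obtain M where M: "\<And>n x. n \<ge> M \<Longrightarrow> x \<in> V \<Longrightarrow> dist (F (r n) x) (h x) < 1"
    unfolding eventually_sequentially by auto
  obtain w where w: "\<And>x. x \<in> ?S \<Longrightarrow> f x = wmap P w x" using surface_group_word[OF f] by blast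
  have fw: "(f ^^ n) x = (wmap P w ^^ n) x \<and> (wmap P w ^^ n) x \<in> ?S" if "x \<in> ?S" for x n
    by (induction n) (use that w wmap_surface in auto)
  have "bounded (wmap P (concat (replicate (r M) w)) ` V)"
    by (intro compact_imp_bounded compact_continuous_image continuous_intros V)
  then obtain B where B: "\<And>x. x \<in> V \<Longrightarrow> norm ((wmap P w ^^ r M) x) \<le> B"
    unfolding bounded_iff wmap_replicate by auto
  \<comment> \<open>The 2 is twice the distance 1 to the limit h, through which the two iterates are
    compared.\<close>
  have "norm ((f ^^ r (m + M)) x) \<le> B + 2" if "x \<in> ?S" "dist x p < e / 2" for x m
  proof -
    have x: "x \<in> V" using that by (simp add: V_def dist_commute)
    have "norm (F (r M) x) \<le> B" using B[OF x] fw[OF that(1)] that(1) by (simp add: F_def)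
    moreover have "dist (F (r (m + M)) x) (F (r M) x) < 2"
      using M[of "m + M" x] M[of M x] x dist_triangle2[of "F (r (m + M)) x" "F (r M) x" "h x"] by simp
    moreover have "norm (F (r (m + M)) x) \<le> dist (F (r (m + M)) x) (F (r M) x) + norm (F (r M) x)"
      unfolding dist_norm using norm_triangle_ineq[of "F (r (m + M)) x - F (r M) x" "F (r M) x"] by simp
    ultimately show ?thesis using that(1) by (simp add: F_def)
  qed
  moreover have "strict_mono (\<lambda>m. r (m + M))" using r(1) by (simp add: strict_mono_def)
  ultimately show ?thesis using that[of "\<lambda>m. r (m + M)" "e / 2" "B + 2"] e(1) by simp
qed

lemma norm_component_le: "cmod (untuple x l) \<le> norm x"
  by (cases x; cases l) (auto simp: untuple_def intro: order_trans[OF norm_fst_le] order_trans[OF norm_snd_le]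
      norm_fst_le[of "fst x" "snd x"] norm_Pair)

lemma norm_tuple_le: "norm (x :: complex3) \<le> cmod (untuple x Lx) + cmod (untuple x Ly) + cmod (untuple x Lz)"
proof (cases x)
  case (fields a b c)
  have "norm (a, b, c) \<le> norm a + norm (b, c)" by (rule norm_Pair_le)
  also have "norm (b, c) \<le> norm b + norm c" by (rule norm_Pair_le)
  finally show ?thesis by (simp add: fields untuple_def)
qed

text \<open>The bound moves from f at p to the reduced word c at the corresponding point through the
  map of h. The inverse map keeps it finite, because it is continuous on the closed ball of radius
  B.\<close>

lemma fatou_locally_bounded:
  assumes p: "p \<in> fatou_set P" and f: "f \<in> surface_group P" and fx: "f p = p"
    and w: "\<And>x. x \<in> cubic_surface P \<Longrightarrow> f x = wmap P w x"
    and conj: "\<And>y. act (params P) w y = act (params P) h (act (params P) c (act (params P) (rev h) y))"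
  shows "locally_bounded_powers (params P) (const_term P) c (act (params P) (rev h) (untuple p))"
proof -
  let ?S = "cubic_surface P" and ?a = "params P" and ?q = "act (params P) (rev h) (untuple p)"
  obtain r \<delta> B where r: "strict_mono (r :: nat \<Rightarrow> nat)" "\<delta> > 0"
    "\<And>x m. x \<in> ?S \<Longrightarrow> dist x p < \<delta> \<Longrightarrow> norm ((f ^^ r m) x) \<le> B"
    using fatou_bounded_powers[OF p f fx] by blast
  have cw: "(wmap P w ^^ n) (wmap P h x) = wmap P h ((wmap P c ^^ n) x)" for n x
  proof (induction n)
    case (Suc n)
    have "wmap P w (wmap P h y) = wmap P h (wmap P c y)" for y by (simp add: wmap_def conj)
    then show ?case by (simp add: Suc)
  qed simp
  have fw: "(f ^^ n) x = (wmap P w ^^ n) x \<and> (wmap P w ^^ n) x \<in> ?S" if "x \<in> ?S" for x n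
    by (induction n) (use that w wmap_surface in auto)
  have "isCont (wmap P h) (tuple ?q)"
    using continuous_on_wmap[of UNIV P h] continuous_on_eq_continuous_at[OF open_UNIV] by blast
  moreover have "wmap P h (tuple ?q) = p" by (simp add: wmap_def)
  ultimately obtain e where e: "e > 0" "\<And>x. dist x (tuple ?q) < e \<Longrightarrow> dist (wmap P h x) p < \<delta>"
    unfolding continuous_at_eps_delta using r(2) by metis
  have "bounded (wmap P (rev h) ` cball 0 B)"
    by (intro compact_imp_bounded compact_continuous_image continuous_intros) auto
  then obtain B' where "\<forall>x\<in>cball 0 B. norm (wmap P (rev h) x) \<le> B'"
    unfolding bounded_iff by blast
  then have B': "norm x \<le> B \<Longrightarrow> norm (wmap P (rev h) x) \<le> B'" for x by simp
  have "cmod ((act ?a c ^^ r m) y l) \<le> B'"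
    if y: "cubic ?a y = const_term P" "\<forall>l. cmod (y l - ?q l) < e / 3" for y m l
  proof -
    have yS: "tuple y \<in> ?S" using y(1) by (simp add: cubic_surface_iff)
    have "dist (tuple y) (tuple ?q) < e"
    proof -
      have u: "untuple (tuple y - tuple ?q) l = y l - ?q l" for l
        by (cases l) (simp_all add: untuple_def tuple_def)
      have "norm (tuple y - tuple ?q) \<le> cmod (y Lx - ?q Lx) + cmod (y Ly - ?q Ly) + cmod (y Lz - ?q Lz)"
        using norm_tuple_le[of "tuple y - tuple ?q"] unfolding u .
      also have "\<dots> < e / 3 + e / 3 + e / 3" using y(2) by (intro add_strict_mono) auto
      finally show ?thesis by (simp add: dist_norm)
    qed
    then have "norm ((f ^^ r m) (wmap P h (tuple y))) \<le> B"
      by (intro r(3) wmap_surface yS e(2))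
    then have "norm (wmap P h ((wmap P c ^^ r m) (tuple y))) \<le> B"
      using fw[OF wmap_surface[OF yS]] cw by simp
    then have "norm ((wmap P c ^^ r m) (tuple y)) \<le> B'" using B' by fastforce
    moreover have "(wmap P c ^^ n) (tuple y) = tuple ((act ?a c ^^ n) y)" for n
      by (induction n) (auto simp: wmap_def)
    ultimately show ?thesis using norm_component_le[of "tuple ((act ?a c ^^ r m) y)" l] by simp
  qed
  then show ?thesis unfolding locally_bounded_powers_def using r(1) e(1)
    by (intro exI[of _ r] exI[of _ "e / 3"] exI[of _ B']) auto
qed

theorem generic_fixed_point_julia:
  assumes P: "generic P" and f: "f \<in> surface_group P" "f \<noteq> \<one>\<^bsub>BijGroup (cubic_surface P)\<^esub>"
    and p: "p \<in> cubic_surface P" "f p = p"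
  shows "p \<in> julia_set P"
proof (rule ccontr)
  let ?a = "params P" and ?D = "const_term P"
  assume "p \<notin> julia_set P"
  then have pF: "p \<in> fatou_set P" using p(1) by (simp add: julia_set_def)
  obtain A B C D where P4: "P = (A, B, C, D)" by (metis prod_cases4)
  obtain w where w: "even (length w)" "\<And>x. x \<in> cubic_surface P \<Longrightarrow> f x = wmap P w x"
    using surface_group_word[OF f(1)] by blast
  have "\<not> (\<forall>a y. act a w y = (y :: letter \<Rightarrow> complex))"
  proof
    assume "\<forall>a y. act a w y = (y :: letter \<Rightarrow> complex)"
    then have "f x = x" if "x \<in> cubic_surface P" for x using w(2)[OF that] by (simp add: wmap_def)
    then have "f = (\<lambda>x\<in>cubic_surface P. x)"
      using surface_group_extensional[OF f(1)] by (auto simp: extensional_def fun_eq_iff)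
    then show False using f(2) by (simp add: BijGroup_simps)
  qed
  then obtain h c where c: "c \<noteq> []" "even (length c)" "distinct_adj c" "hd c \<noteq> last c"
    and conj: "\<And>a y. act a w y = act a h (act a c (act a (rev h) (y :: letter \<Rightarrow> complex)))"
    using cyclic_reduction[OF w(1)] by blast
  have fw: "act ?a w (untuple p) = untuple p"
    using w(2)[OF p(1)] p(2) by (metis wmap_def tuple_untuple(2))
  have Dp: "cubic ?a (untuple p) = ?D" using p(1) by (simp add: cubic_surface_iff)
  show False
  proof (cases "set c = UNIV")
    case True
    obtain u c' where c': "distinct_adj c'" "hd c' = Lz" "last c' \<noteq> Lz" "set c' = UNIV" "even (length c')"
      "\<And>a y. act a c y = act a u (act a c' (act a (rev u) (y :: letter \<Rightarrow> complex)))"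
      using rotate_to_Lz[OF c(3,4) True c(2)] by metis
    have conj': "act a w y = act a (h @ u) (act a c' (act a (rev (h @ u)) y))" for a and y :: "letter \<Rightarrow> complex"
      unfolding conj c'(6) by (simp add: act_append)
    let ?q = "act ?a (rev (h @ u)) (untuple p)"
    have bd: "locally_bounded_powers ?a ?D c' ?q"
      by (rule fatou_locally_bounded[OF pF f(1) p(2) w(2) conj'])
    have fq: "act ?a c' ?q = ?q"
    proof -
      have "act ?a (rev (h @ u)) (act ?a (h @ u) (act ?a c' ?q)) = ?q" using fw conj' by metis
      then show ?thesis by (simp only: act_rev)
    qed
    have Dq: "cubic ?a ?q = ?D" using Dp by simp
    obtain k where "grad ?a ?q k \<noteq> 0"
      using generic_smooth[of A B C D ?q] P Dq unfolding P4 const_term_def by auto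
    then obtain t where t: "dtrace ?a c' ?q = complex_of_real t" "- 1 \<le> t" "t \<le> 3"
      using bounded_powers_trace[OF Dq _ c'(5) fq bd] by blast
    have "t < - 1 \<or> t > 3"
      using generic_trace[of A B C D ?q c' t] P Dq c' fq t(1) unfolding P4 const_term_def by auto
    then show False using t by linarith
  next
    case False
    then obtain k where k: "k \<notin> set c" by auto
    define i where "i = hd c"
    have ik: "i \<noteq> k" using k c(1) by (auto simp: i_def)
    obtain j where j: "j \<noteq> i" "j \<noteq> k" using letter_third by blast
    have sub: "set c \<subseteq> {i, j}" using k letter_cases3[of i j k] ik j by blast
    have ij: "i \<noteq> j" using j by simp
    obtain n where n: "c = concat (replicate n [i, j])"
      using alternating_word[OF c(3) sub c(2) i_def[symmetric] ij] by blast
    have "n \<ge> 1" using n c(1) by (cases n) auto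
    moreover have "cubic ?a (act ?a (rev h) (untuple p)) = ?D" using Dp by simp
    ultimately show False
      using parabolic_unbounded[of ?a _ ?D i j k n] fatou_locally_bounded[OF pF f(1) p(2) w(2) conj] ik j
      unfolding n by auto
  qed
qed

section \<open>The exceptional hypersurfaces\<close>

lemma real_polynomial_function_coords:
  "real_polynomial_function (\<lambda>P. Re (coords P i)) \<and> real_polynomial_function (\<lambda>P. Im (coords P i))"
proof -
  have lin: "bounded_linear (\<lambda>P :: complex4. Re (fst P))" "bounded_linear (\<lambda>P :: complex4. Re (fst (snd P)))"
    "bounded_linear (\<lambda>P :: complex4. Re (fst (snd (snd P))))" "bounded_linear (\<lambda>P :: complex4. Re (snd (snd (snd P))))"
    "bounded_linear (\<lambda>P :: complex4. Im (fst P))" "bounded_linear (\<lambda>P :: complex4. Im (fst (snd P)))"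
    "bounded_linear (\<lambda>P :: complex4. Im (fst (snd (snd P))))" "bounded_linear (\<lambda>P :: complex4. Im (snd (snd (snd P))))"
    by (intro bounded_linear_compose[OF bounded_linear_Re] bounded_linear_compose[OF bounded_linear_Im]
        bounded_linear_fst_comp bounded_linear_snd_comp bounded_linear_ident)+
  note rp = lin[THEN real_polynomial_function.intros(1)]
  have neg: "real_polynomial_function (\<lambda>P. - g P)" if "real_polynomial_function g" for g :: "complex4 \<Rightarrow> real"
    using real_polynomial_function.intros(4)[OF real_polynomial_function.intros(2)[of "- 1"] that] by simp
  have z: "real_polynomial_function (\<lambda>P :: complex4. 0)" by (rule real_polynomial_function.intros(2))
  have e: "coords P = (\<lambda>i. if i = 0 then fst P else if i = 1 then fst (snd P) else if i = 2 then fst (snd (snd P))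
    else if i = 3 then snd (snd (snd P)) else if i = 4 then cnj (fst P) else if i = 5 then cnj (fst (snd P))
    else if i = 6 then cnj (fst (snd (snd P))) else if i = 7 then cnj (snd (snd (snd P))) else 0)" for P
  proof
    fix i :: nat
    have "i < 8 \<Longrightarrow> i \<in> {0,1,2,3,4,5,6,7}" by auto
    then show "coords P i = (if i = 0 then fst P else if i = 1 then fst (snd P) else if i = 2 then fst (snd (snd P))
      else if i = 3 then snd (snd (snd P)) else if i = 4 then cnj (fst P) else if i = 5 then cnj (fst (snd P))
      else if i = 6 then cnj (fst (snd (snd P))) else if i = 7 then cnj (snd (snd (snd P))) else 0)"
      by (cases "i < 8"; cases P) (auto simp: coords_def numeral_eq_Suc)
  qed
  consider "i \<ge> 8" | "i = 0" | "i = 1" | "i = 2" | "i = 3" | "i = 4" | "i = 5" | "i = 6" | "i = 7" by linarith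
  then show ?thesis
    unfolding e by cases (simp_all add: rp neg z)
qed

lemma real_polynomial_function_eval:
  "real_polynomial_function (\<lambda>P. Re (peval e (coords P))) \<and> real_polynomial_function (\<lambda>P. Im (peval e (coords P)))"
proof (induction e)
  case (Cst q)
  show ?case by (simp add: real_polynomial_function.intros(2))
next
  case (Var i)
  then show ?case using real_polynomial_function_coords by simp
qed (auto intro: real_polynomial_function.intros real_polynomial_function_diff)

text \<open>The sum of the squares of real and imaginary part turns one complex equation into one
  real equation.\<close>

lemma real_algebraic_hypersurface_eval:
  assumes "peval e (coords Q) \<noteq> 0"
  shows "real_algebraic_hypersurface {P. peval e (coords P) = 0}"
proof -
  let ?p = "\<lambda>P. Re (peval e (coords P)) * Re (peval e (coords P)) + Im (peval e (coords P)) * Im (peval e (coords P))"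
  have z: "?p P = 0 \<longleftrightarrow> peval e (coords P) = 0" for P
    by (simp add: complex_eq_iff sum_squares_eq_zero_iff)
  have "real_polynomial_function ?p"
    using real_polynomial_function_eval by (intro real_polynomial_function.intros(3,4)) auto
  moreover have "?p \<noteq> (\<lambda>_. 0)" using z[of Q] assms by (metis (mono_tags))
  ultimately show ?thesis unfolding real_algebraic_hypersurface_def
    using z by (intro exI[of _ ?p]) auto
qed

theorem proposition10p9:
  "\<exists>\<Z> :: complex4 set set.
     countable \<Z> \<and> (\<forall>Z\<in>\<Z>. real_algebraic_hypersurface Z) \<and>
     (\<forall>P. P \<notin> \<Union>\<Z> \<longrightarrow>
        (\<forall>f \<in> surface_group P - {\<one>\<^bsub>BijGroup (cubic_surface P)\<^esub>}.
           \<forall>p \<in> cubic_surface P. f p = p \<longrightarrow> p \<in> julia_set P))"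
proof (intro exI conjI allI impI ballI)
  let ?\<Z> = "(\<lambda>e. {P. peval e (coords P) = 0}) ` {e. \<exists>Q. peval e (coords Q) \<noteq> 0}"
  show "countable ?\<Z>" by (intro countable_image) simp
  show "real_algebraic_hypersurface Z" if "Z \<in> ?\<Z>" for Z
    using that real_algebraic_hypersurface_eval by auto
  fix P f p
  assume P: "P \<notin> \<Union> ?\<Z>" and f: "f \<in> surface_group P - {\<one>\<^bsub>BijGroup (cubic_surface P)\<^esub>}"
    and p: "p \<in> cubic_surface P" "f p = p"
  have "generic P" unfolding generic_def using P by blast
  then show "p \<in> julia_set P" using generic_fixed_point_julia f p by blast
qed

end
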